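(* Let $P,Q\in C^{2}((0,\infty))\cap C([0,\infty))$ be nonnegative functions with $P'>0$ and $Q'>0$ on $(0,\infty)$, let $F:=Q\circ P^{-1}$, and suppose that both $P$ and $F$ satisfy the growth condition. Suppose that $$F''(t)>0 \text{ for all } t\in(0,\infty)\quad\text{and}\quad t\mapsto \frac{F'(t)}{F''(t)}\ \text{ is concave on } (0,\infty).$$ Let $z\in\mathbb{C}$ with $|z|\le 1$ be such that $$\left|\frac{tP''(t)}{P'(t)}-z^{2}\frac{tQ''(t)}{Q'(t)}+z^{2}-1\right|\leq \frac{tP''(t)}{P'(t)}-|z|^{2}\frac{tQ''(t)}{Q'(t)}+1-|z|^{2}\qquad\text{for all } t>0.$$ Then for all $k\ge 1$ and all polynomials $f:\mathbb{R}^{k}\to\mathbb{C}$, $$Q^{-1}\left(\int_{\mathbb{R}^{k}} Q(|T_{z} f|)\, d\gamma \right) \leq P^{-1}\left(\int_{\mathbb{R}^{k}} P(|f|)\,d\gamma \right).$$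
   Context: $d\gamma(x)=(2\pi)^{-k/2}e^{-|x|^2/2}\,dx$ is the standard Gaussian measure on $\mathbb{R}^k$. For a multiindex $\alpha\in(\mathbb{Z}_{\ge 0})^k$, $|\alpha|=\alpha_1+\dots+\alpha_k$ and $w^\alpha=w_1^{\alpha_1}\cdots w_k^{\alpha_k}$ for $w\in\mathbb{C}^k$; the (probabilist's) Hermite polynomials are $H_\alpha(x)=\int_{\mathbb{R}^k}(x+iy)^\alpha\,d\gamma(y)$. Every polynomial $f:\mathbb{R}^k\to\mathbb{C}$ (complex coefficients) has a unique expansion $f=\sum_{|\alpha|\le\deg f}c_\alpha H_\alpha$ with $c_\alpha\in\mathbb{C}$, and for $z\in\mathbb{C}$, $|z|\le1$, one sets $T_zf(x)=\sum_{|\alpha|\le \deg f}z^{|\alpha|}c_\alpha H_\alpha(x)$. Growth condition: a function $B\in C^2((0,\infty))$ satisfies the growth condition if there exist $N,R>0$ such that $|B''(t)|<\exp(\log^{N}(t+N))$ for all $t\ge R$ (where $\log^N(\cdot)=(\log(\cdot))^N$). Here $P^{-1},Q^{-1}$ are the inverse functions of the strictly increasing functions $P,Q$ on $[0,\infty)$. The hypotheses on $F=Q\circ P^{-1}$ are imposed on $(0,\infty)$, so it is presupposed that $F$ is defined on $[0,\infty)$, i.e. that $P(0)=0$ and $P(t)\to\infty$ as $t\to\infty$. *)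

theory Defs
  imports "HOL-Analysis.Analysis"
begin

(* Meant for open S: deriv is the two-sided derivative. *)
definition C2_on :: "real set \<Rightarrow> (real \<Rightarrow> real) \<Rightarrow> bool" where
  "C2_on S f \<longleftrightarrow>
     f differentiable_on S \<and> deriv f differentiable_on S \<and> continuous_on S (deriv (deriv f))"

(* ln (t + N) is positive for all large t, and R may always be enlarged, so the
   value of powr at nonpositive arguments does not affect the condition. *)
definition growth_condition :: "(real \<Rightarrow> real) \<Rightarrow> bool" where
  "growth_condition B \<longleftrightarrow>
     C2_on {0<..} B \<and>
     (\<exists>N>0. \<exists>R>0. \<forall>t\<ge>R. \<bar>deriv (deriv B) t\<bar> < exp (ln (t + N) powr N))"

definition gaussian_measure :: "(real ^ 'k) measure" where
  "gaussian_measure =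
     density lborel
       (\<lambda>x. ennreal ((2 * pi) powr (- (real CARD('k) / 2)) * exp (- ((norm x)\<^sup>2 / 2))))"

definition multi_degree :: "('k::finite \<Rightarrow> nat) \<Rightarrow> nat" where
  "multi_degree \<alpha> = (\<Sum>i\<in>UNIV. \<alpha> i)"

definition multi_power :: "complex ^ 'k \<Rightarrow> ('k \<Rightarrow> nat) \<Rightarrow> complex" where
  "multi_power w \<alpha> = (\<Prod>i\<in>UNIV. (w $ i) ^ \<alpha> i)"

definition hermite :: "('k \<Rightarrow> nat) \<Rightarrow> real ^ 'k \<Rightarrow> complex" where
  "hermite \<alpha> x = (\<integral>y. multi_power (\<chi> i. of_real (x $ i) + \<i> * of_real (y $ i)) \<alpha> \<partial>gaussian_measure)"

definition hermite_expansion :: "(real ^ 'k \<Rightarrow> complex) \<Rightarrow> (('k \<Rightarrow> nat) \<Rightarrow> complex) \<Rightarrow> bool" where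
  "hermite_expansion f c \<longleftrightarrow>
     finite {\<alpha>. c \<alpha> \<noteq> 0} \<and> (\<forall>x. f x = (\<Sum>\<alpha> | c \<alpha> \<noteq> 0. c \<alpha> * hermite \<alpha> x))"

(* Since hermite \<alpha> has leading term x^\<alpha>, every polynomial function has exactly one
   hermite_expansion, and its support lies in {\<alpha>. multi_degree \<alpha> \<le> d} for d the degree. *)
definition hermite_coeffs :: "(real ^ 'k \<Rightarrow> complex) \<Rightarrow> ('k \<Rightarrow> nat) \<Rightarrow> complex" where
  "hermite_coeffs f = (THE c. hermite_expansion f c)"

definition hermite_operator :: "complex \<Rightarrow> (real ^ 'k \<Rightarrow> complex) \<Rightarrow> real ^ 'k \<Rightarrow> complex" where
  "hermite_operator z f x =
     (\<Sum>\<alpha> | hermite_coeffs f \<alpha> \<noteq> 0. z ^ multi_degree \<alpha> * hermite_coeffs f \<alpha> * hermite \<alpha> x)"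

end

theory Submission
  imports Defs "HOL-Probability.Probability" "HOL-Real_Asymp.Real_Asymp"
begin

text \<open>Write \<open>\<gamma>\<close> for the Gaussian measure, \<open>p(\<zeta>) = P(|\<zeta>|)\<close> for complex \<open>\<zeta>\<close>, and \<open>F = Q \<circ> P\<^sup>-\<^sup>1\<close>. After applying the
increasing function \<open>Q\<close> to both sides, the claim reads
\<open>\<integral>F(p(T\<^sub>z f)) d\<gamma> \<le> F(\<integral>p(f) d\<gamma>)\<close>: the operator \<open>T\<^sub>z\<close> has to outweigh the convexity of \<open>F\<close>.

The two sides are joined by an interpolation that moves \<open>F\<close> gradually across the integral. In one
variable, let \<open>h\<^sub>n(w, \<tau>)\<close> be the Hermite polynomials with variance \<open>\<tau>\<close>, which satisfy
\<open>\<partial>\<^sub>\<tau> h = - \<partial>\<^sub>w\<^sup>2 h / 2\<close> and \<open>h\<^sub>n(z w, z\<^sup>2 \<tau>) = z\<^sup>n h\<^sub>n(w, \<tau>)\<close>. For \<open>f = \<Sum> a\<^sub>n h\<^sub>n(\<sqdot>, 1)\<close> put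
\<open>\<phi>\<^sub>\<theta>(x, y) = \<Sum> a\<^sub>n h\<^sub>n(z x sin \<theta> + y cos \<theta>, z\<^sup>2 sin\<^sup>2 \<theta> + cos\<^sup>2 \<theta>)\<close> and
\<open>J(\<theta>) = \<integral> F(\<integral> p(\<phi>\<^sub>\<theta>(x, y)) d\<gamma>(y)) d\<gamma>(x)\<close>. Then \<open>J(0)\<close> is the right-hand side, and \<open>J(\<pi>/2)\<close> is the
left-hand side by homogeneity. Two Gaussian integrations by parts, in \<open>y\<close> and in \<open>x\<close>, make all terms with
second derivatives of \<open>\<phi>\<close> cancel (lemma \<open>J_deriv\<close>). With \<open>V\<close> for the inner integral, what is left is
\<open>sin \<theta> cos \<theta>\<close> times the outer integral of
\<open>F''(V) (\<integral> Dp(\<phi>)[z \<phi>'])\<^sup>2 + F'(V) \<integral> (D\<^sup>2p(\<phi>)[z \<phi>', z \<phi>'] - D\<^sup>2p(\<phi>)[\<phi>', \<phi>'])\<close>.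

The sign of this expression uses both hypotheses. The condition on \<open>z\<close> is equivalent to the pointwise
inequality \<open>D\<^sup>2p(\<zeta>)[z \<eta>, z \<eta>] + (F''/F')(p(\<zeta>)) (Dp(\<zeta>)[z \<eta>])\<^sup>2 \<le> D\<^sup>2p(\<zeta>)[\<eta>, \<eta>]\<close>, that is,
\<open>D\<^sup>2(F \<circ> p)[z \<eta>, z \<eta>] \<le> F'(p) D\<^sup>2p[\<eta>, \<eta>]\<close> (lemmas \<open>rotation_inequality\<close> and \<open>hypercontractive_pair_regularized\<close>). Since
\<open>F'/F''\<close> is concave, the function \<open>(g, h) \<mapsto> g\<^sup>2 F''(h)/F'(h)\<close> is jointly convex, and Jensen's inequality
turns the pointwise inequality into the integrated one (lemma \<open>dissipation\<close>).

The interpolation is carried out with an additional probability space in the inner integral. This lets it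
be applied to one coordinate after another, the remaining coordinates serving as that space (lemma
\<open>tensorization\<close>). Since \<open>p\<close> need not be differentiable at the origin, the argument is run for
\<open>P(sqrt(|\<zeta>|\<^sup>2 + \<epsilon>\<^sup>2))\<close>; the second-order condition survives this change because \<open>|z| \<le> 1\<close>, and \<open>\<epsilon>\<close>
tends to 0 at the end. The growth condition guarantees that all integrals converge.\<close>

section \<open>Growth bounds that are stable under composition\<close>

text \<open>The bounds \<open>exp(C log(3 + r)\<^sup>M)\<close> match the growth condition and are closed under products and, what matters
most here, under composition: \<open>F\<close> is applied to integrals of \<open>P\<close>. The size \<open>r\<close> is a function on an arbitrary
set of points, so that one notion serves the real line, products and parameter spaces. Adding 3 keeps
the logarithm above 1, so that raising \<open>M\<close> weakens the bound.\<close>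
definition tame :: "('a \<Rightarrow> real) \<Rightarrow> ('a \<Rightarrow> 'b::real_normed_vector) \<Rightarrow> bool" where
  "tame r g \<longleftrightarrow> (\<forall>x. 0 \<le> r x) \<and>
     (\<exists>C\<ge>0. \<exists>M::nat. \<forall>x. norm (g x) \<le> exp (C * ln (3 + r x) ^ M))"

lemma ln_three_ge_one: "1 \<le> ln (3 + t)" if "0 \<le> t" for t :: real
proof -
  have "exp 1 \<le> (3::real)" using e_less_272 by simp
  then show ?thesis using that by (subst ln_ge_iff) auto
qed

lemma tameI:
  assumes "\<And>x. 0 \<le> r x" "0 \<le> C" "\<And>x. norm (g x) \<le> exp (C * ln (3 + r x) ^ M)"
  shows "tame r g"
  using assms unfolding tame_def by blast

lemma tame_size_nonneg: "tame r g \<Longrightarrow> 0 \<le> r x"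
  unfolding tame_def by blast

lemma tame_norm_le:
  assumes "tame r g" "\<And>x. norm (f x) \<le> norm (g x)"
  shows "tame r f"
  using assms unfolding tame_def by (meson order_trans)

lemma log_power_le:
  fixes t :: real
  assumes "0 \<le> t" "0 \<le> C" "C \<le> D" "M \<le> N"
  shows "C * ln (3 + t) ^ M \<le> D * ln (3 + t) ^ (N::nat)"
  using assms ln_three_ge_one[OF assms(1)]
  by (intro mult_mono power_increasing) auto

lemma tame_const: "(\<And>x. 0 \<le> r x) \<Longrightarrow> tame r (\<lambda>x. c)"
proof (rule tameI[where C = "norm c" and M = 0])
  show "norm c \<le> exp (norm c * ln (3 + r x) ^ 0)" for x
    using exp_ge_add_one_self[of "norm c"] by (simp only: power_0 mult_1_right)
qed auto

lemma tame_size: "(\<And>x. 0 \<le> r x) \<Longrightarrow> tame r r"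
proof (rule tameI[where C = 1 and M = 1])
  fix x assume "\<And>x. 0 \<le> r x"
  then have "0 \<le> r x" by auto
  then show "norm (r x) \<le> exp (1 * ln (3 + r x) ^ 1)" by simp
qed auto

lemma tame_id: "tame (\<lambda>x. \<bar>x\<bar>) (\<lambda>x. x :: real)"
  by (rule tame_norm_le[OF tame_size[of "\<lambda>x::real. \<bar>x\<bar>"]]) auto

lemma tame_common:
  assumes "tame r f" "tame r g"
  obtains C M where "\<And>x. 0 \<le> r x" "1 \<le> C" "\<And>x. norm (f x) \<le> exp (C * ln (3 + r x) ^ M)"
    "\<And>x. norm (g x) \<le> exp (C * ln (3 + r x) ^ M)" 
proof -
  obtain C M where 1: "\<And>x. 0 \<le> r x" "0 \<le> C" "\<And>x. norm (f x) \<le> exp (C * ln (3 + r x) ^ M)"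
    using assms(1) unfolding tame_def by blast
  obtain D N where 2: "0 \<le> D" "\<And>x. norm (g x) \<le> exp (D * ln (3 + r x) ^ N)"
    using assms(2) unfolding tame_def by blast
  show ?thesis
  proof
    show "1 \<le> 1 + C + D" using 1 2 by simp
    fix x
    have "C * ln (3 + r x) ^ M \<le> (1 + C + D) * ln (3 + r x) ^ max M N"
      using 1 2 by (intro log_power_le) auto
    then show "norm (f x) \<le> exp ((1 + C + D) * ln (3 + r x) ^ max M N)"
      using 1(3)[of x] by (meson exp_le_cancel_iff order_trans)
    have "D * ln (3 + r x) ^ N \<le> (1 + C + D) * ln (3 + r x) ^ max M N"
      using 1 2 by (intro log_power_le) auto
    then show "norm (g x) \<le> exp ((1 + C + D) * ln (3 + r x) ^ max M N)"
      using 2(2)[of x] by (meson exp_le_cancel_iff order_trans)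
  qed (use 1 in auto)
qed

lemma tame_mult_norm:
  assumes "tame r f" "tame r g" "\<And>x. norm (h x) \<le> norm (f x) * norm (g x)"
  shows "tame r h"
proof -
  obtain C M where *: "\<And>x. 0 \<le> r x" "1 \<le> C" "\<And>x. norm (f x) \<le> exp (C * ln (3 + r x) ^ M)"
    "\<And>x. norm (g x) \<le> exp (C * ln (3 + r x) ^ M)" using tame_common[OF assms(1,2)] by blast
  show ?thesis
  proof (rule tameI[where C = "2 * C"])
    fix x
    have "norm (h x) \<le> exp (C * ln (3 + r x) ^ M) * exp (C * ln (3 + r x) ^ M)"
      using assms(3)[of x] *(3,4)[of x] by (meson exp_ge_zero mult_mono norm_ge_zero order_trans)
    also have "\<dots> = exp (2 * C * ln (3 + r x) ^ M)" by (simp flip: exp_add)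
    finally show "norm (h x) \<le> exp (2 * C * ln (3 + r x) ^ M)" .
  qed (use * in auto)
qed

lemma tame_add_norm:
  assumes "tame r f" "tame r g" "\<And>x. norm (h x) \<le> norm (f x) + norm (g x)"
  shows "tame r h"
proof -
  obtain C M where *: "\<And>x. 0 \<le> r x" "1 \<le> C" "\<And>x. norm (f x) \<le> exp (C * ln (3 + r x) ^ M)"
    "\<And>x. norm (g x) \<le> exp (C * ln (3 + r x) ^ M)" using tame_common[OF assms(1,2)] by blast
  show ?thesis
  proof (rule tameI[where C = "2 * C"])
    fix x
    let ?e = "exp (C * ln (3 + r x) ^ M)"
    have "1 * 1 \<le> C * ln (3 + r x) ^ M" using * ln_three_ge_one[of "r x"] by (intro mult_mono one_le_power) auto
    then have "2 \<le> ?e" using exp_ge_add_one_self[of "C * ln (3 + r x) ^ M"] by linarith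
    then have "2 * ?e \<le> ?e * ?e" by simp
    moreover have "norm (h x) \<le> ?e + ?e" using assms(3)[of x] *(3,4)[of x] by linarith
    moreover have "?e * ?e = exp (2 * C * ln (3 + r x) ^ M)" by (simp flip: exp_add)
    ultimately show "norm (h x) \<le> exp (2 * C * ln (3 + r x) ^ M)" by linarith
  qed (use * in auto)
qed

lemma tame_add: "tame r f \<Longrightarrow> tame r g \<Longrightarrow> tame r (\<lambda>x. f x + g x)"
  by (erule tame_add_norm, assumption, rule norm_triangle_ineq)
lemma tame_diff: "tame r f \<Longrightarrow> tame r g \<Longrightarrow> tame r (\<lambda>x. f x - g x)"
  by (erule tame_add_norm, assumption, rule norm_triangle_ineq4)
lemma tame_minus: "tame r f \<Longrightarrow> tame r (\<lambda>x. - f x)"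
  by (erule tame_norm_le) simp
lemma tame_mult: "tame r f \<Longrightarrow> tame r g \<Longrightarrow> tame r (\<lambda>x. f x * g x :: 'b::real_normed_algebra)"
  by (erule tame_mult_norm, assumption, rule norm_mult_ineq)
lemma tame_inner: "tame r f \<Longrightarrow> tame r g \<Longrightarrow> tame r (\<lambda>x. f x \<bullet> g x)"
  by (erule tame_mult_norm, assumption) (simp add: Cauchy_Schwarz_ineq2)
lemma tame_scaleR: "tame r f \<Longrightarrow> tame r g \<Longrightarrow> tame r (\<lambda>x. f x *\<^sub>R g x)"
  by (erule tame_mult_norm, assumption) simp
lemma tame_of_real: "tame r f \<Longrightarrow> tame r (\<lambda>x. of_real (f x) :: 'b::real_normed_algebra_1)"
  by (erule tame_norm_le) simp
lemma tame_power:
  fixes f :: "_ \<Rightarrow> 'b::real_normed_algebra_1"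
  shows "tame r f \<Longrightarrow> tame r (\<lambda>x. f x ^ n)"
  by (induction n) (auto intro: tame_mult tame_const tame_size_nonneg)
lemma tame_sum:
  assumes "\<And>x. 0 \<le> r x" "\<And>i. i \<in> S \<Longrightarrow> tame r (f i)"
  shows "tame r (\<lambda>x. \<Sum>i\<in>S. f i x)"
  using assms by (induction S rule: infinite_finite_induct) (auto intro: tame_const tame_add)
lemma tame_prod:
  fixes f :: "_ \<Rightarrow> _ \<Rightarrow> 'b::real_normed_field"
  assumes "\<And>x. 0 \<le> r x" "\<And>i. i \<in> S \<Longrightarrow> tame r (f i)"
  shows "tame r (\<lambda>x. \<Prod>i\<in>S. f i x)"
  using assms by (induction S rule: infinite_finite_induct) (auto intro: tame_const tame_mult)

text \<open>As \<open>3 + s + t \<le> (3 + s)(3 + t)\<close>, a bound in terms of a sum of sizes splits into a product of bounds. Hence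
variables can be frozen, and integrated out, without leaving the class of tame functions.\<close>
lemma log_sum_power_le:
  fixes s t :: real
  assumes "0 \<le> s" "0 \<le> t"
  shows "ln (3 + (s + t)) ^ M \<le> 2 ^ M * ln (3 + s) ^ M + 2 ^ M * ln (3 + t) ^ (M::nat)"
proof -
  let ?a = "ln (3 + s)" and ?b = "ln (3 + t)"
  have "3 + (s + t) \<le> (3 + s) * (3 + t)" using assms by (simp add: algebra_simps)
  then have "ln (3 + (s + t)) \<le> ln ((3 + s) * (3 + t))"
    using assms by (subst ln_le_cancel_iff) auto
  also have "\<dots> = ?a + ?b" using assms by (intro ln_mult_pos) auto
  also have "\<dots> \<le> 2 * max ?a ?b" by simp
  finally have "ln (3 + (s + t)) ^ M \<le> (2 * max ?a ?b) ^ M"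
    using ln_three_ge_one[of "s + t"] assms by (intro power_mono) auto
  also have "\<dots> \<le> 2 ^ M * ?a ^ M + 2 ^ M * ?b ^ M"
    using ln_three_ge_one[OF assms(1)] ln_three_ge_one[OF assms(2)]
    by (auto simp: power_mult_distrib max_def)
  finally show ?thesis .
qed

text \<open>Freezing a variable, adding a dummy variable, and renaming variables are all instances; the constant \<open>K\<close>
absorbs the size of what is frozen.\<close>
lemma tame_reindex:
  assumes "tame r g" "\<And>q. r (h q) \<le> K + r' q" "\<And>q. 0 \<le> r' q"
  shows "tame r' (\<lambda>q. g (h q))"
proof -
  obtain C M where *: "\<And>x. 0 \<le> r x" "0 \<le> C" "\<And>x. norm (g x) \<le> exp (C * ln (3 + r x) ^ M)"
    using assms(1) unfolding tame_def by blast
  define K' where "K' = max K 0"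
  have K': "0 \<le> K'" "K \<le> K'" by (auto simp: K'_def)
  have "tame r' (\<lambda>q. exp (C * 2 ^ M * ln (3 + r' q) ^ M))"
    using assms(3) * by (intro tameI[where C = "C * 2 ^ M" and M = M]) auto
  moreover have "tame r' (\<lambda>q. exp (C * 2 ^ M * ln (3 + K') ^ M))" using assms(3) by (rule tame_const)
  ultimately show ?thesis
  proof (rule tame_mult_norm)
    fix q
    have "ln (3 + r (h q)) \<le> ln (3 + (K' + r' q))"
      using assms(2,3)[of q] K' *(1)[of "h q"] by (subst ln_le_cancel_iff) auto
    then have "ln (3 + r (h q)) ^ M \<le> ln (3 + (K' + r' q)) ^ M"
      using ln_three_ge_one[OF *(1)[of "h q"]] by (intro power_mono) auto
    also have "\<dots> \<le> 2 ^ M * ln (3 + K') ^ M + 2 ^ M * ln (3 + r' q) ^ M"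
      using K' assms(3) by (intro log_sum_power_le) auto
    finally have "C * ln (3 + r (h q)) ^ M \<le> C * (2 ^ M * ln (3 + K') ^ M + 2 ^ M * ln (3 + r' q) ^ M)"
      using *(2) by (rule mult_left_mono)
    then have "exp (C * ln (3 + r (h q)) ^ M) \<le> 
      exp (C * 2 ^ M * ln (3 + r' q) ^ M) * exp (C * 2 ^ M * ln (3 + K') ^ M)"
      by (simp add: algebra_simps flip: exp_add)
    then show "norm (g (h q)) \<le> norm (exp (C * 2 ^ M * ln (3 + r' q) ^ M)) * norm (exp (C * 2 ^ M * ln (3 + K') ^ M))"
      using *(3)[of "h q"] by simp
  qed
qed

text \<open>The profiles \<open>P\<close> and \<open>F\<close> may have unbounded derivatives near 0, so their growth is only recorded on a
set that stays away from 0.\<close>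
definition slow_on :: "real set \<Rightarrow> (real \<Rightarrow> real) \<Rightarrow> bool" where
  "slow_on S b \<longleftrightarrow> (\<exists>C\<ge>0. \<exists>M::nat. \<forall>t\<in>S. \<bar>b t\<bar> \<le> exp (C * ln (3 + \<bar>t\<bar>) ^ M))"

text \<open>Taking the logarithm of \<open>exp(C L\<^sup>M)\<close> brings back \<open>C L\<^sup>M\<close>, so composition merely multiplies the exponents.\<close>
lemma tame_compose:
  assumes "tame r g" "slow_on S b" "\<And>x. g x \<in> S"
  shows "tame r (\<lambda>x. b (g x))"
proof -
  obtain C M where *: "\<And>x. 0 \<le> r x" "0 \<le> C" "\<And>x. norm (g x) \<le> exp (C * ln (3 + r x) ^ M)"
    using assms(1) unfolding tame_def by blast
  obtain D N where b: "0 \<le> D" "\<And>t. t \<in> S \<Longrightarrow> \<bar>b t\<bar> \<le> exp (D * ln (3 + \<bar>t\<bar>) ^ N)"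
    using assms(2) unfolding slow_on_def by blast
  show ?thesis
  proof (rule tameI)
    fix x
    let ?L = "ln (3 + r x)" and ?e = "exp (C * ln (3 + r x) ^ M)"
    have L: "1 \<le> ?L" using ln_three_ge_one *(1) by auto
    have e1: "1 \<le> ?e" using * L by simp
    have "3 + \<bar>g x\<bar> \<le> 4 * ?e" using e1 *(3)[of x] unfolding real_norm_def by linarith
    also have "\<dots> \<le> exp 2 * ?e"
    proof -
      have "2 * 2 \<le> exp 1 * exp (1::real)" using exp_ge_add_one_self[of "1::real"] by (intro mult_mono) auto
      then have "4 \<le> exp (2::real)" by (simp flip: exp_add)
      then show ?thesis by (intro mult_right_mono) auto
    qed
    finally have "ln (3 + \<bar>g x\<bar>) \<le> ln (exp (2 + C * ?L ^ M))"
      by (subst ln_le_cancel_iff) (auto simp: exp_add)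
    then have "ln (3 + \<bar>g x\<bar>) \<le> 2 + C * ?L ^ M" by simp
    also have "\<dots> \<le> (2 + C) * ?L ^ M" using L one_le_power[OF L, of M] by (simp add: algebra_simps)
    finally have "ln (3 + \<bar>g x\<bar>) ^ N \<le> ((2 + C) * ?L ^ M) ^ N"
      using ln_three_ge_one[of "\<bar>g x\<bar>"] by (intro power_mono) auto
    then have "D * ln (3 + \<bar>g x\<bar>) ^ N \<le> D * (2 + C) ^ N * ?L ^ (M * N)"
      using b(1) by (simp add: power_mult_distrib power_mult mult_left_mono mult.assoc)
    then show "norm (b (g x)) \<le> exp (D * (2 + C) ^ N * ?L ^ (M * N))"
      using b(2)[OF assms(3)[of x]] by (smt (verit) exp_le_cancel_iff real_norm_def)
  qed (use * b in auto)
qed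

text \<open>Measures for which tameness is an integrability criterion.\<close>
definition integrates_tame :: "'a measure \<Rightarrow> ('a \<Rightarrow> real) \<Rightarrow> bool" where
  "integrates_tame N r \<longleftrightarrow> r \<in> borel_measurable N \<and> (\<forall>x. 0 \<le> r x) \<and>
     (\<forall>C M. integrable N (\<lambda>x. exp (C * ln (3 + r x) ^ M)))"

lemma integrates_tame_integrable:
  fixes g :: "'a \<Rightarrow> 'b::{banach, second_countable_topology}"
  assumes "integrates_tame N r" "tame r g" "g \<in> borel_measurable N"
  shows "integrable N g"
proof -
  obtain C M where *: "\<And>x. 0 \<le> r x" "0 \<le> C" "\<And>x. norm (g x) \<le> exp (C * ln (3 + r x) ^ M)"
    using assms(2) unfolding tame_def by blast
  show ?thesis
  proof (rule Bochner_Integration.integrable_bound[OF _ assms(3)])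
    show "integrable N (\<lambda>x. exp (C * ln (3 + r x) ^ M))" using assms(1) unfolding integrates_tame_def by blast
  qed (use * in auto)
qed

lemma integrates_tame_pair:
  assumes "integrates_tame N1 r1" "integrates_tame N2 r2" "sigma_finite_measure N1" "sigma_finite_measure N2"
  shows "integrates_tame (N1 \<Otimes>\<^sub>M N2) (\<lambda>(x, y). r1 x + r2 y)"
proof -
  interpret pair_sigma_finite N1 N2 using assms(3,4) by (simp add: pair_sigma_finite_def)
  have [measurable]: "r1 \<in> borel_measurable N1" "r2 \<in> borel_measurable N2"
    and nn: "\<And>x. 0 \<le> r1 x" "\<And>x. 0 \<le> r2 x" using assms(1,2) by (auto simp: integrates_tame_def)
  have "integrable (N1 \<Otimes>\<^sub>M N2) (\<lambda>(x, y). exp (C * ln (3 + (r1 x + r2 y)) ^ M))" for C M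
  proof (rule Bochner_Integration.integrable_bound)
    let ?D = "\<bar>C\<bar> * 2 ^ M"
    show "integrable (N1 \<Otimes>\<^sub>M N2) (\<lambda>(x, y). exp (?D * ln (3 + r1 x) ^ M) * exp (?D * ln (3 + r2 y) ^ M))"
    proof (rule Fubini_integrable)
      have 1: "integrable N1 (\<lambda>x. exp (?D * ln (3 + r1 x) ^ M))" using assms(1) by (simp add: integrates_tame_def)
      have 2: "integrable N2 (\<lambda>x. exp (?D * ln (3 + r2 x) ^ M))" using assms(2) by (simp add: integrates_tame_def)
      show "integrable N1 (\<lambda>x. LINT y|N2. norm (case (x, y) of (x, y) \<Rightarrow> exp (?D * ln (3 + r1 x) ^ M) * exp (?D * ln (3 + r2 y) ^ M)))"
        using 1 by (simp add: norm_mult)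
      show "AE x in N1. integrable N2 (\<lambda>y. case (x, y) of (x, y) \<Rightarrow> exp (?D * ln (3 + r1 x) ^ M) * exp (?D * ln (3 + r2 y) ^ M))"
        using 2 by simp
    qed measurable
    show "AE q in N1 \<Otimes>\<^sub>M N2. norm (case q of (x, y) \<Rightarrow> exp (C * ln (3 + (r1 x + r2 y)) ^ M)) \<le>
      norm (case q of (x, y) \<Rightarrow> exp (?D * ln (3 + r1 x) ^ M) * exp (?D * ln (3 + r2 y) ^ M))"
    proof (rule AE_I2, clarsimp simp flip: exp_add)
      fix x y
      have "C * ln (3 + (r1 x + r2 y)) ^ M \<le> \<bar>C\<bar> * ln (3 + (r1 x + r2 y)) ^ M"
        using nn ln_three_ge_one[of "r1 x + r2 y"] by (intro mult_right_mono) auto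
      also have "\<dots> \<le> \<bar>C\<bar> * (2 ^ M * ln (3 + r1 x) ^ M + 2 ^ M * ln (3 + r2 y) ^ M)"
        using nn by (intro mult_left_mono log_sum_power_le) auto
      finally show "C * ln (3 + (r1 x + r2 y)) ^ M \<le> \<bar>C\<bar> * 2 ^ M * ln (3 + r1 x) ^ M + \<bar>C\<bar> * 2 ^ M * ln (3 + r2 y) ^ M"
        by (simp add: algebra_simps)
    qed
  qed measurable
  then show ?thesis using nn unfolding integrates_tame_def by (auto simp: split_beta')
qed

lemma tame_integral:
  fixes g :: "'u \<times> 'a \<Rightarrow> 'b::{banach, second_countable_topology}"
  assumes "integrates_tame N r" "tame (\<lambda>(u, q). r' u + r q) g" "\<And>u. 0 \<le> r' u"
  shows "tame r' (\<lambda>u. LINT q|N. g (u, q))"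
proof -
  obtain C M where *: "0 \<le> C" "\<And>u q. norm (g (u, q)) \<le> exp (C * ln (3 + (r' u + r q)) ^ M)"
    using assms(2) unfolding tame_def by auto
  let ?D = "C * 2 ^ M"
  have nn: "0 \<le> r q" for q using assms(1) by (simp add: integrates_tame_def)
  have i: "integrable N (\<lambda>q. exp (?D * ln (3 + r q) ^ M))" using assms(1) by (simp add: integrates_tame_def)
  have "tame r' (\<lambda>u. exp (?D * ln (3 + r' u) ^ M))" using assms(3) * by (intro tameI[where C = ?D and M = M]) auto
  moreover have "tame r' (\<lambda>u. LINT q|N. exp (?D * ln (3 + r q) ^ M))" using assms(3) by (rule tame_const)
  ultimately show ?thesis
  proof (rule tame_mult_norm)
    fix u
    have "norm (g (u, q)) \<le> exp (?D * ln (3 + r' u) ^ M) * exp (?D * ln (3 + r q) ^ M)" for q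
    proof -
      have "C * ln (3 + (r' u + r q)) ^ M \<le> C * (2 ^ M * ln (3 + r' u) ^ M + 2 ^ M * ln (3 + r q) ^ M)"
        using nn assms(3) * by (intro mult_left_mono log_sum_power_le) auto
      then show ?thesis
        using *(2)[of u q] by (smt (verit) exp_le_cancel_iff exp_add distrib_left mult.assoc)
    qed
    then have "norm (LINT q|N. g (u, q)) \<le> (LINT q|N. exp (?D * ln (3 + r' u) ^ M) * exp (?D * ln (3 + r q) ^ M))"
      by (intro integral_norm_bound[THEN order_trans] integral_mono' integrable_mult_right i) auto
    then show "norm (LINT q|N. g (u, q)) \<le> norm (exp (?D * ln (3 + r' u) ^ M)) * norm (LINT q|N. exp (?D * ln (3 + r q) ^ M))"
      by (simp add: abs_of_nonneg)
  qed
qed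

section \<open>Differentiation under the integral sign and Gaussian integration by parts\<close>

text \<open>By the mean value theorem the difference quotients along a bounded sequence of increments are dominated by
one tame function.\<close>
lemma has_real_derivative_integral:
  fixes g g' :: "real \<times> 'a \<Rightarrow> real"
  assumes N: "integrates_tame N r"
    and m: "\<And>t. (\<lambda>q. g (t, q)) \<in> borel_measurable N" "\<And>t. (\<lambda>q. g' (t, q)) \<in> borel_measurable N"
    and d: "\<And>t q. ((\<lambda>t. g (t, q)) has_real_derivative g' (t, q)) (at t)"
    and g: "tame (\<lambda>(t, q). \<bar>t\<bar> + r q) g" and g': "tame (\<lambda>(t, q). \<bar>t\<bar> + r q) g'"
  shows "((\<lambda>t. LINT q|N. g (t, q)) has_real_derivative (LINT q|N. g' (t, q))) (at t)"
proof -
  have r: "0 \<le> r q" for q using N by (simp add: integrates_tame_def)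
  have [measurable]: "r \<in> borel_measurable N" using N by (simp add: integrates_tame_def)
  have ig: "integrable N (\<lambda>q. g (t, q))" for t
    using tame_reindex[OF g, where h = "\<lambda>q. (t, q)" and K = "\<bar>t\<bar>"] r N m by (intro integrates_tame_integrable) auto
  show ?thesis unfolding DERIV_def tendsto_at_iff_sequentially comp_def
  proof (intro allI impI)
    fix X :: "nat \<Rightarrow> real" assume X: "\<forall>i. X i \<in> UNIV - {0}" "X \<longlonglongrightarrow> 0"
    obtain K where K: "0 < K" "\<And>i. \<bar>X i\<bar> \<le> K"
      using convergent_imp_Bseq[OF convergentI[OF X(2)]] unfolding Bseq_def by auto
    obtain C M where CM: "0 \<le> C" "\<And>t q. \<bar>g' (t, q)\<bar> \<le> exp (C * ln (3 + (\<bar>t\<bar> + r q)) ^ M)"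
      using g' unfolding tame_def by auto
    define w where "w q = exp (C * ln (3 + (\<bar>t\<bar> + K + r q)) ^ M)" for q
    have b: "\<bar>g' (s, q)\<bar> \<le> w q" if "\<bar>s - t\<bar> \<le> K" for s q
    proof -
      have "ln (3 + (\<bar>s\<bar> + r q)) \<le> ln (3 + (\<bar>t\<bar> + K + r q))"
        using that r[of q] by (subst ln_le_cancel_iff) auto
      then have "C * ln (3 + (\<bar>s\<bar> + r q)) ^ M \<le> C * ln (3 + (\<bar>t\<bar> + K + r q)) ^ M"
        using ln_three_ge_one[of "\<bar>s\<bar> + r q"] r[of q] CM(1) by (intro mult_left_mono power_mono) auto
      then show ?thesis using CM(2)[of s q] unfolding w_def by (meson exp_le_cancel_iff order_trans)
    qed
    have quot: "\<bar>(g (t + X i, q) - g (t, q)) / X i\<bar> \<le> w q" for i q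
    proof -
      have "norm (g (t + X i, q) - g (t, q)) \<le> w q * norm (t + X i - t)"
      proof (rule field_differentiable_bound[where S = "cball t K" and f' = "\<lambda>s. g' (s, q)"])
        show "((\<lambda>t. g (t, q)) has_field_derivative g' (s, q)) (at s within cball t K)" for s
          using d[of q s] by (rule has_field_derivative_at_within)
        show "norm (g' (s, q)) \<le> w q" if "s \<in> cball t K" for s
          using b[of s q] that by (simp add: dist_real_def abs_minus_commute)
      qed (use K in \<open>auto simp: dist_real_def less_imp_le\<close>)
      then show ?thesis using X(1) by (auto simp: field_simps abs_divide)
    qed
    have iw: "integrable N w"
    proof (rule integrates_tame_integrable[OF N])
      have "tame (\<lambda>s. \<bar>s\<bar>) (\<lambda>s. exp (C * ln (3 + \<bar>s\<bar>) ^ M))" for s :: real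
        using CM(1) by (intro tameI[where C = C and M = M]) auto
      then have "tame r (\<lambda>q. exp (C * ln (3 + \<bar>\<bar>t\<bar> + K + r q\<bar>) ^ M))"
        by (rule tame_reindex[where K = "\<bar>t\<bar> + K"]) (use K r in auto)
      moreover have "\<bar>\<bar>t\<bar> + K + r q\<bar> = \<bar>t\<bar> + K + r q" for q using K r[of q] by auto
      ultimately show "tame r w" by (simp add: w_def[abs_def])
    qed (simp add: w_def[abs_def])
    have "(\<lambda>i. LINT q|N. (g (t + X i, q) - g (t, q)) / X i) \<longlonglongrightarrow> (LINT q|N. g' (t, q))"
    proof (rule integral_dominated_convergence[where w = w])
      show "AE q in N. (\<lambda>i. (g (t + X i, q) - g (t, q)) / X i) \<longlonglongrightarrow> g' (t, q)"
        using d[of _ t] X unfolding DERIV_def tendsto_at_iff_sequentially comp_def by auto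
      show "(\<lambda>q. (g (t + X i, q) - g (t, q)) / X i) \<in> borel_measurable N" for i
        using m(1)[of t] m(1)[of "t + X i"] by measurable
    qed (use m iw quot in auto)
    moreover have "(LINT q|N. (g (t + X i, q) - g (t, q)) / X i)
        = ((LINT q|N. g (t + X i, q)) - (LINT q|N. g (t, q))) / X i" for i
      using ig by simp
    ultimately show "(\<lambda>i. ((LINT q|N. g (t + X i, q)) - (LINT q|N. g (t, q))) / X i) \<longlonglongrightarrow> (LINT q|N. g' (t, q))"
      by (simp only:)
  qed
qed

lemma isCont_integral:
  fixes g :: "real \<times> 'a \<Rightarrow> real"
  assumes N: "integrates_tame N r"
    and m: "\<And>t. (\<lambda>q. g (t, q)) \<in> borel_measurable N"
    and c: "\<And>t q. isCont (\<lambda>t. g (t, q)) t"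
    and g: "tame (\<lambda>(t, q). \<bar>t\<bar> + r q) g"
  shows "isCont (\<lambda>t. LINT q|N. g (t, q)) t"
proof -
  have r: "0 \<le> r q" for q using N by (simp add: integrates_tame_def)
  have [measurable]: "r \<in> borel_measurable N" using N by (simp add: integrates_tame_def)
  show ?thesis unfolding continuous_at_sequentially comp_def
  proof (intro allI impI)
    fix X :: "nat \<Rightarrow> real" assume X: "X \<longlonglongrightarrow> t"
    obtain K where K: "0 < K" "\<And>i. \<bar>X i\<bar> \<le> K"
      using convergent_imp_Bseq[OF convergentI[OF X]] unfolding Bseq_def by auto
    obtain C M where CM: "0 \<le> C" "\<And>t q. \<bar>g (t, q)\<bar> \<le> exp (C * ln (3 + (\<bar>t\<bar> + r q)) ^ M)"
      using g unfolding tame_def by auto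
    define w where "w q = exp (C * ln (3 + (K + r q)) ^ M)" for q
    have b: "\<bar>g (s, q)\<bar> \<le> w q" if "\<bar>s\<bar> \<le> K" for s q
    proof -
      have "ln (3 + (\<bar>s\<bar> + r q)) \<le> ln (3 + (K + r q))"
        using that r[of q] by (subst ln_le_cancel_iff) auto
      then have "C * ln (3 + (\<bar>s\<bar> + r q)) ^ M \<le> C * ln (3 + (K + r q)) ^ M"
        using ln_three_ge_one[of "\<bar>s\<bar> + r q"] r[of q] CM(1) by (intro mult_left_mono power_mono) auto
      then show ?thesis using CM(2)[of s q] unfolding w_def by (meson exp_le_cancel_iff order_trans)
    qed
    have iw: "integrable N w"
    proof (rule integrates_tame_integrable[OF N])
      have "tame (\<lambda>s. \<bar>s\<bar>) (\<lambda>s. exp (C * ln (3 + \<bar>s\<bar>) ^ M))" for s :: real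
        using CM(1) by (intro tameI[where C = C and M = M]) auto
      then have "tame r (\<lambda>q. exp (C * ln (3 + \<bar>K + r q\<bar>) ^ M))"
        by (rule tame_reindex[where K = K]) (use K r in auto)
      moreover have "\<bar>K + r q\<bar> = K + r q" for q using K r[of q] by auto
      ultimately show "tame r w" by (simp add: w_def[abs_def])
    qed (simp add: w_def[abs_def])
    show "(\<lambda>i. LINT q|N. g (X i, q)) \<longlonglongrightarrow> (LINT q|N. g (t, q))"
    proof (rule integral_dominated_convergence[where w = w])
      show "AE q in N. (\<lambda>i. g (X i, q)) \<longlonglongrightarrow> g (t, q)"
        using c[of t] X unfolding continuous_at_sequentially comp_def by auto
    qed (use m iw b K in auto)
  qed
qed

abbreviation std_gauss :: "real measure" where
  "std_gauss \<equiv> density lborel (\<lambda>x. ennreal (std_normal_density x))"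

lemma prob_space_std_gauss: "prob_space std_gauss"
  by (rule prob_space_normal_density) simp

text \<open>Exponential moments therefore suffice to integrate every tame function.\<close>
lemma log_power_le_linear:
  fixes t :: real
  assumes "0 \<le> t"
  shows "ln (3 + t) ^ M \<le> real M ^ M * (3 + t)"
proof (cases "M = 0")
  case False
  have "ln (3 + t) \<le> (3 + t) powr (1 / M) / (1 / M)"
    using assms False by (intro ln_powr_bound) auto
  then have "ln (3 + t) ^ M \<le> (real M * (3 + t) powr (1 / M)) ^ M"
    using ln_three_ge_one[OF assms] by (intro power_mono) (auto simp: mult.commute)
  also have "\<dots> = real M ^ M * (3 + t)"
    using assms False by (simp add: power_mult_distrib powr_power)
  finally show ?thesis .
qed (use assms in auto)

lemma integrates_tame_if_exp_integrable:
  assumes [measurable]: "r \<in> borel_measurable N" and r: "\<And>x. 0 \<le> r x"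
    and i: "\<And>K. 0 \<le> K \<Longrightarrow> integrable N (\<lambda>x. exp (K * r x))"
  shows "integrates_tame N r"
  unfolding integrates_tame_def
proof (intro conjI allI assms)
  fix C :: real and M :: nat
  let ?K = "\<bar>C\<bar> * real M ^ M"
  show "integrable N (\<lambda>x. exp (C * ln (3 + r x) ^ M))"
  proof (rule Bochner_Integration.integrable_bound)
    show "integrable N (\<lambda>x. exp (?K * 3) * exp (?K * r x))"
      by (intro integrable_mult_right i) auto
    have "exp (C * ln (3 + r x) ^ M) \<le> exp (?K * 3) * exp (?K * r x)" for x
    proof -
      have "C * ln (3 + r x) ^ M \<le> \<bar>C\<bar> * ln (3 + r x) ^ M"
        using ln_three_ge_one[OF r[of x]] by (intro mult_right_mono) auto
      also have "\<dots> \<le> \<bar>C\<bar> * (real M ^ M * (3 + r x))"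
        by (intro mult_left_mono log_power_le_linear r) auto
      finally show ?thesis by (simp add: algebra_simps flip: exp_add)
    qed
    then show "AE x in N. norm (exp (C * ln (3 + r x) ^ M)) \<le> norm (exp (?K * 3) * exp (?K * r x))" by simp
  qed measurable
qed

lemma std_gauss_exp_integrable: "integrable std_gauss (\<lambda>x. exp (K * \<bar>x\<bar>))"
proof (rule Bochner_Integration.integrable_bound)
  have "integrable std_gauss (\<lambda>x. exp (K * x))" for K
  proof -
    have "(\<lambda>x. std_normal_density x * exp (K * x)) = (\<lambda>x. exp (K\<^sup>2 / 2) * normal_density K 1 x)"
      by (auto simp: normal_density_def power2_eq_square algebra_simps fun_eq_iff exp_diff field_simps simp flip: exp_add)
    then show ?thesis
      using integrable_normal_density[of 1 K] by (subst integrable_density) auto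
  qed
  from this[of K] this[of "-K"] show "integrable std_gauss (\<lambda>x. exp (K * x) + exp (- K * x))" by auto
  show "AE x in std_gauss. norm (exp (K * \<bar>x\<bar>)) \<le> norm (exp (K * x) + exp (- K * x))"
    by (intro AE_I2, subst (2) real_norm_def, subst abs_of_nonneg) (auto simp: abs_if add_nonneg_nonneg)
qed measurable

lemma integrates_tame_std_gauss: "integrates_tame std_gauss (\<lambda>x. \<bar>x\<bar>)"
  by (rule integrates_tame_if_exp_integrable) (auto intro: std_gauss_exp_integrable)

lemma product_prob_space_std_gauss: "product_prob_space (\<lambda>_. std_gauss)"
  by (intro product_prob_space.intro product_sigma_finite.intro product_prob_space_axioms.intro
    prob_space_imp_sigma_finite prob_space_std_gauss)

lemma integrates_tame_PiM_std_gauss: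
  assumes "finite I"
  shows "integrates_tame (Pi\<^sub>M I (\<lambda>_. std_gauss)) (\<lambda>x. \<Sum>i\<in>I. \<bar>x i\<bar>)"
proof (rule integrates_tame_if_exp_integrable)
  interpret product_prob_space "\<lambda>_. std_gauss" by (rule product_prob_space_std_gauss)
  fix K :: real
  show "integrable (Pi\<^sub>M I (\<lambda>_. std_gauss)) (\<lambda>x. exp (K * (\<Sum>i\<in>I. \<bar>x i\<bar>)))"
    using assms product_integrable_prod[OF assms, of "\<lambda>_ x. exp (K * \<bar>x\<bar>)"]
    by (simp add: exp_sum sum_distrib_left std_gauss_exp_integrable)
qed (auto intro: sum_nonneg)

lemma std_normal_density_tame_tendsto:
  fixes G :: "real \<Rightarrow> 'b::euclidean_space"
  assumes "tame (\<lambda>x. \<bar>x\<bar>) G"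
  shows "((\<lambda>x. std_normal_density x *\<^sub>R G x) \<longlongrightarrow> 0) at_top"
    "((\<lambda>x. std_normal_density x *\<^sub>R G x) \<longlongrightarrow> 0) at_bot"
proof -
  obtain C M where CM: "0 \<le> C" "\<And>x. norm (G x) \<le> exp (C * ln (3 + \<bar>x\<bar>) ^ M)"
    using assms unfolding tame_def by blast
  define K where "K = C * real M ^ M"
  have "norm (G x) \<le> exp (K * (3 + \<bar>x\<bar>))" for x
    using CM(2)[of x] mult_left_mono[OF log_power_le_linear[of "\<bar>x\<bar>" M] CM(1)]
    by (simp add: K_def mult.assoc) (meson exp_le_cancel_iff order_trans)
  then have *: "norm (std_normal_density x *\<^sub>R G x) \<le> std_normal_density x * exp (K * (3 + \<bar>x\<bar>))" for x
    by (simp add: mult_left_mono)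
  have **: "norm (std_normal_density x *\<^sub>R G x) \<le> exp (3 * K + K\<^sup>2) * exp (- x\<^sup>2 / 4)" for x
  proof -
    have "0 \<le> (\<bar>x\<bar> / 2 - K)\<^sup>2" by simp
    then have "- x\<^sup>2 / 2 + K * (3 + \<bar>x\<bar>) \<le> 3 * K + K\<^sup>2 + - x\<^sup>2 / 4"
      by (simp add: power2_diff field_simps)
    then have "exp (- x\<^sup>2 / 2) * exp (K * (3 + \<bar>x\<bar>)) \<le> exp (3 * K + K\<^sup>2) * exp (- x\<^sup>2 / 4)"
      by (simp flip: exp_add)
    moreover have "std_normal_density x \<le> exp (- x\<^sup>2 / 2)"
    proof -
      have "1 \<le> sqrt (2 * pi)" using pi_ge_two by simp
      then show ?thesis unfolding std_normal_density_def by (simp add: field_simps)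
    qed
    ultimately show ?thesis using *[of x]
      by (smt (verit) exp_ge_zero mult_right_mono)
  qed
  have "((\<lambda>x. exp (3 * K + K\<^sup>2) * exp (- x\<^sup>2 / 4)) \<longlongrightarrow> 0) at_top" by real_asymp
  then show "((\<lambda>x. std_normal_density x *\<^sub>R G x) \<longlongrightarrow> 0) at_top"
    by (rule Lim_null_comparison[OF always_eventually, rotated]) (use ** in auto)
  have "((\<lambda>x. exp (3 * K + K\<^sup>2) * exp (- x\<^sup>2 / 4)) \<longlongrightarrow> 0) at_bot" by real_asymp
  then show "((\<lambda>x. std_normal_density x *\<^sub>R G x) \<longlongrightarrow> 0) at_bot"
    by (rule Lim_null_comparison[OF always_eventually, rotated]) (use ** in auto)
qed

text \<open>The density satisfies \<open>\<rho>' = - x \<rho>\<close>, so the difference of the two integrands, times \<open>\<rho>\<close>, is minus the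
derivative of \<open>\<rho> G\<close>, which vanishes at both ends.\<close>
lemma gaussian_integration_by_parts:
  fixes G G' :: "real \<Rightarrow> 'b::euclidean_space"
  assumes d: "\<And>x. (G has_vector_derivative G' x) (at x)" and c: "\<And>x. isCont G' x"
    and G: "tame (\<lambda>x. \<bar>x\<bar>) G" and G': "tame (\<lambda>x. \<bar>x\<bar>) G'"
  shows "(LINT x|std_gauss. x *\<^sub>R G x) = (LINT x|std_gauss. G' x)"
proof -
  have cG: "isCont G x" for x using d has_vector_derivative_continuous by blast
  have [measurable]: "G \<in> borel_measurable borel" "G' \<in> borel_measurable borel"
    using c cG by (auto intro!: borel_measurable_continuous_onI continuous_at_imp_continuous_on)
  have i1: "integrable std_gauss (\<lambda>x. x *\<^sub>R G x)"
    using tame_scaleR[OF tame_id G]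
    by (intro integrates_tame_integrable[OF integrates_tame_std_gauss]) auto
  have i2: "integrable std_gauss G'" by (intro integrates_tame_integrable[OF integrates_tame_std_gauss] G') auto
  let ?\<rho> = "std_normal_density"
  let ?H' = "\<lambda>x. ?\<rho> x *\<^sub>R G' x - ?\<rho> x *\<^sub>R (x *\<^sub>R G x)"
  have i1': "integrable lborel (\<lambda>x. ?\<rho> x *\<^sub>R (x *\<^sub>R G x))"
    using i1 by (subst (asm) integrable_density) auto
  have i2': "integrable lborel (\<lambda>x. ?\<rho> x *\<^sub>R G' x)"
    using i2 by (subst (asm) integrable_density) auto
  have "(LBINT x=-\<infinity>..\<infinity>. ?H' x) = 0 - 0"
  proof (rule interval_integral_FTC_integrable)
    fix x :: real
    have "(?\<rho> has_real_derivative - (x * ?\<rho> x)) (at x)"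
      unfolding std_normal_density_def by (auto intro!: derivative_eq_intros simp: field_simps)
    then show "((\<lambda>x. ?\<rho> x *\<^sub>R G x) has_vector_derivative ?H' x) (at x)"
      using d by (auto intro!: derivative_eq_intros simp: has_real_derivative_iff_has_vector_derivative algebra_simps)
    show "isCont ?H' x" unfolding std_normal_density_def using c cG by (intro continuous_intros) auto
  next
    show "set_integrable lborel (einterval (- \<infinity>) \<infinity>) ?H'"
      using i1' i2' by (simp add: set_integrable_def)
  qed (simp_all add: ereal_tendsto_simps std_normal_density_tame_tendsto[OF G])
  then have "(LINT x|lborel. ?\<rho> x *\<^sub>R G' x) = (LINT x|lborel. ?\<rho> x *\<^sub>R (x *\<^sub>R G x))"
    using i1' i2' by (simp add: interval_lebesgue_integral_def set_lebesgue_integral_def)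
  then show ?thesis by (simp add: integral_density)
qed

section \<open>Hermite polynomials as solutions of the heat equation\<close>

text \<open>The Hermite polynomials of variance \<open>\<tau>\<close>: formally \<open>\<integral>(w + i sqrt(\<tau>) y)\<^sup>n d\<gamma>(y)\<close>, extended to complex
\<open>\<tau>\<close>, where the recursion needs no choice of a square root.\<close>
fun heat_hermite :: "nat \<Rightarrow> complex \<Rightarrow> complex \<Rightarrow> complex" where
  "heat_hermite 0 w \<tau> = 1"
| "heat_hermite (Suc 0) w \<tau> = w"
| "heat_hermite (Suc (Suc n)) w \<tau> = w * heat_hermite (Suc n) w \<tau> - of_nat (Suc n) * \<tau> * heat_hermite n w \<tau>"

lemma heat_hermite_Suc:
  "heat_hermite (Suc n) w \<tau> = w * heat_hermite n w \<tau> - of_nat n * \<tau> * heat_hermite (n - 1) w \<tau>"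
  by (cases n) auto

text \<open>This identity brings in the operator of the theorem: multiplying the n-th coefficient by \<open>z\<^sup>n\<close> amounts to
rescaling space by \<open>z\<close> and time by \<open>z\<^sup>2\<close>.\<close>
lemma heat_hermite_scale: "heat_hermite n (z * w) (z\<^sup>2 * \<tau>) = z ^ n * heat_hermite n w \<tau>"
  by (induction n w \<tau> rule: heat_hermite.induct) (auto simp: algebra_simps power2_eq_square)

text \<open>The chain rule along a curve \<open>(w(t), \<tau>(t))\<close>. The coefficients encode \<open>\<partial>\<^sub>w h\<^sub>n = n h\<^bsub>n-1\<^esub>\<close> and the backward heat
equation \<open>\<partial>\<^sub>\<tau> h\<^sub>n = - \<partial>\<^sub>w\<^sup>2 h\<^sub>n / 2\<close>.\<close>
lemma heat_hermite_has_vector_derivative: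
  assumes "(w has_vector_derivative w') (at t)" "(\<tau> has_vector_derivative \<tau>') (at t)"
  shows "((\<lambda>t. heat_hermite n (w t) (\<tau> t)) has_vector_derivative
    of_nat n * heat_hermite (n - 1) (w t) (\<tau> t) * w'
    - of_nat (n * (n - 1)) / 2 * heat_hermite (n - 2) (w t) (\<tau> t) * \<tau>') (at t)"
proof (induction n rule: less_induct)
  case (less n)
  show ?case
  proof (cases n)
    case 0
    then show ?thesis by simp
  next
    case (Suc m)
    show ?thesis
    proof (cases m)
      case 0
      then show ?thesis using assms(1) Suc by simp
    next
      case (Suc k)
      define h where "h j = heat_hermite j (w t) (\<tau> t)" for j
      have n: "n = Suc (Suc k)" using Suc \<open>n = Suc m\<close> by simp
      have 1: "((\<lambda>t. heat_hermite (Suc k) (w t) (\<tau> t)) has_vector_derivative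
          of_nat (Suc k) * h k * w' - of_nat (Suc k * k) / 2 * h (k - 1) * \<tau>') (at t)"
        using less[of "Suc k"] n by (simp add: h_def)
      have 2: "((\<lambda>t. heat_hermite k (w t) (\<tau> t)) has_vector_derivative
          of_nat k * h (k - 1) * w' - of_nat (k * (k - 1)) / 2 * h (k - 2) * \<tau>') (at t)"
        using less[of k] n by (simp add: h_def)
      have e1: "h (Suc k) = w t * h k - of_nat k * \<tau> t * h (k - 1)"
        unfolding h_def by (rule heat_hermite_Suc)
      have e2: "of_nat k * h k = of_nat k * (w t * h (k - 1) - of_nat (k - 1) * \<tau> t * h (k - 2))"
        by (cases k) (auto simp: h_def heat_hermite_Suc numeral_2_eq_2)
      have d: "((\<lambda>t. heat_hermite n (w t) (\<tau> t)) has_vector_derivative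
         (w t * (of_nat (Suc k) * h k * w' - of_nat (Suc k * k) / 2 * h (k - 1) * \<tau>') + w' * h (Suc k))
         - of_nat (Suc k) * (\<tau> t * (of_nat k * h (k - 1) * w' - of_nat (k * (k - 1)) / 2 * h (k - 2) * \<tau>') + \<tau>' * h k)) (at t)"
        unfolding n heat_hermite.simps mult.assoc[of "of_nat (Suc k)" "\<tau> _"] unfolding h_def
        by (intro has_vector_derivative_diff has_vector_derivative_mult_right has_vector_derivative_mult
            assms 1[unfolded h_def] 2[unfolded h_def])
      have alg: "(W * ((1 + a) * hk * W' - (1 + a) * a / 2 * h1 * T') + W' * hs)
          - (1 + a) * (T * (a * h1 * W' - a * b / 2 * h2 * T') + T' * hk)
        = W' * (hs + (1 + a) * (W * hk - a * T * h1)) - T' * (1 + a) * (hk + a * (W * h1 - b * T * h2) / 2)"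
        for a b hk h1 h2 W T W' T' hs :: complex
        by (simp add: field_simps)
      have "(w t * (of_nat (Suc k) * h k * w' - of_nat (Suc k * k) / 2 * h (k - 1) * \<tau>') + w' * h (Suc k))
         - of_nat (Suc k) * (\<tau> t * (of_nat k * h (k - 1) * w' - of_nat (k * (k - 1)) / 2 * h (k - 2) * \<tau>') + \<tau>' * h k)
        = w' * (h (Suc k) + of_nat (Suc k) * (w t * h k - of_nat k * \<tau> t * h (k - 1)))
          - \<tau>' * of_nat (Suc k) * (h k + of_nat k * (w t * h (k - 1) - of_nat (k - 1) * \<tau> t * h (k - 2)) / 2)"
        unfolding of_nat_mult of_nat_Suc by (rule alg)
      also have "\<dots> = w' * (h (Suc k) + of_nat (Suc k) * h (Suc k)) - \<tau>' * of_nat (Suc k) * (h k + of_nat k * h k / 2)"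
        by (simp only: e1[symmetric] e2[symmetric])
      also have "\<dots> = of_nat n * h (n - 1) * w' - of_nat (n * (n - 1)) / 2 * h (n - 2) * \<tau>'"
        by (simp add: n field_simps)
      finally show ?thesis using d by (simp add: h_def)
    qed
  qed
qed

lemma tame_heat_hermite:
  assumes "tame r w" "tame r \<tau>"
  shows "tame r (\<lambda>u. heat_hermite n (w u) (\<tau> u))"
proof (induction n rule: less_induct)
  case (less n)
  have "n = 0 \<or> n = 1 \<or> (\<exists>k. n = Suc (Suc k))" by (metis One_nat_def not0_implies_Suc)
  then show ?case using assms less
    by (auto intro!: tame_diff tame_mult tame_const intro: tame_size_nonneg[OF assms(1)])
qed

lemma borel_measurable_heat_hermite [measurable]:
  assumes [measurable]: "w \<in> borel_measurable N" "\<tau> \<in> borel_measurable N"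
  shows "(\<lambda>u. heat_hermite n (w u) (\<tau> u)) \<in> borel_measurable N"
proof (induction n rule: less_induct)
  case (less n)
  have "n = 0 \<or> n = 1 \<or> (\<exists>k. n = Suc (Suc k))" by (metis One_nat_def not0_implies_Suc)
  then show ?case using less by auto
qed

text \<open>The analytic input of the interpolation. The radial function \<open>p\<close> on the complex plane is given by its
profile \<open>p0\<close> in the variable \<open>\<rho> = |\<zeta>|\<^sup>2\<close>, which makes it twice differentiable also at the origin; \<open>p1\<close>, \<open>p2\<close>
and \<open>F1\<close>, \<open>F2\<close> are the derivatives of \<open>p0\<close> and \<open>F0\<close>. The assumption \<open>pointwise\<close> is
\<open>D\<^sup>2p(\<zeta>)[z \<eta>, z \<eta>] + (F2/F1)(p(\<zeta>)) (Dp(\<zeta>)[z \<eta>])\<^sup>2 \<le> D\<^sup>2p(\<zeta>)[\<eta>, \<eta>]\<close>, and \<open>supergradient\<close> is the concavity of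
\<open>F1/F2\<close> in the form in which it is applied.\<close>
locale hypercontractive_pair =
  fixes p0 p1 p2 F0 F1 F2 :: "real \<Rightarrow> real" and v0 :: real and z :: complex
  assumes p0_deriv: "0 \<le> \<rho> \<Longrightarrow> (p0 has_real_derivative p1 \<rho>) (at \<rho>)"
    and p1_deriv: "0 \<le> \<rho> \<Longrightarrow> (p1 has_real_derivative p2 \<rho>) (at \<rho>)"
    and p2_cont: "continuous_on {0..} p2"
    and p_slow: "slow_on {0..} p0" "slow_on {0..} p1" "slow_on {0..} p2"
    and p0_ge: "0 \<le> \<rho> \<Longrightarrow> v0 \<le> p0 \<rho>"
    and F0_deriv: "v0 \<le> v \<Longrightarrow> (F0 has_real_derivative F1 v) (at v)"
    and F1_deriv: "v0 \<le> v \<Longrightarrow> (F1 has_real_derivative F2 v) (at v)"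
    and F2_cont: "continuous_on {v0..} F2"
    and F_slow: "slow_on {v0..} F0" "slow_on {v0..} F1" "slow_on {v0..} F2"
    and F1_pos: "v0 \<le> v \<Longrightarrow> 0 < F1 v" and F2_pos: "v0 \<le> v \<Longrightarrow> 0 < F2 v"
    and supergradient: "v0 \<le> v \<Longrightarrow> \<exists>m. \<forall>h\<ge>v0. F1 h / F2 h \<le> F1 v / F2 v + m * (h - v)"
    and pointwise: "4 * p2 (\<zeta> \<bullet> \<zeta>) * (\<zeta> \<bullet> (z * \<eta>))\<^sup>2 + 2 * p1 (\<zeta> \<bullet> \<zeta>) * ((z * \<eta>) \<bullet> (z * \<eta>))
        + (2 * p1 (\<zeta> \<bullet> \<zeta>) * (\<zeta> \<bullet> (z * \<eta>)))\<^sup>2 * (F2 (p0 (\<zeta> \<bullet> \<zeta>)) / F1 (p0 (\<zeta> \<bullet> \<zeta>)))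
      \<le> 4 * p2 (\<zeta> \<bullet> \<zeta>) * (\<zeta> \<bullet> \<eta>)\<^sup>2 + 2 * p1 (\<zeta> \<bullet> \<zeta>) * (\<eta> \<bullet> \<eta>)"
begin

text \<open>The function \<open>p\<close> itself, its differential \<open>Dp(\<zeta>)[\<eta>]\<close> and its Hessian \<open>D\<^sup>2p(\<zeta>)[\<eta>, \<xi>]\<close>.\<close>
definition pp :: "complex \<Rightarrow> real" where "pp \<zeta> = p0 (\<zeta> \<bullet> \<zeta>)"
definition dp :: "complex \<Rightarrow> complex \<Rightarrow> real" where "dp \<zeta> \<eta> = 2 * p1 (\<zeta> \<bullet> \<zeta>) * (\<zeta> \<bullet> \<eta>)"
definition hp :: "complex \<Rightarrow> complex \<Rightarrow> complex \<Rightarrow> real" where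
  "hp \<zeta> \<eta> \<xi> = 4 * p2 (\<zeta> \<bullet> \<zeta>) * (\<zeta> \<bullet> \<eta>) * (\<zeta> \<bullet> \<xi>) + 2 * p1 (\<zeta> \<bullet> \<zeta>) * (\<eta> \<bullet> \<xi>)"

lemma pp_deriv:
  assumes "(f has_vector_derivative f') (at t)"
  shows "((\<lambda>t. pp (f t)) has_real_derivative dp (f t) f') (at t)"
proof -
  have "((\<lambda>t. f t \<bullet> f t) has_real_derivative 2 * (f t \<bullet> f')) (at t)"
    using assms unfolding has_vector_derivative_def has_field_derivative_def
    by (auto intro!: derivative_eq_intros simp: inner_commute)
  from DERIV_chain2[OF p0_deriv this] show ?thesis unfolding pp_def dp_def by (simp add: mult_ac)
qed

lemma dp_deriv:
  assumes "(f has_vector_derivative f') (at t)" "(g has_vector_derivative g') (at t)"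
  shows "((\<lambda>t. dp (f t) (g t)) has_real_derivative hp (f t) f' (g t) + dp (f t) g') (at t)"
proof -
  have 1: "((\<lambda>t. f t \<bullet> f t) has_real_derivative 2 * (f t \<bullet> f')) (at t)"
    using assms unfolding has_vector_derivative_def has_field_derivative_def
    by (auto intro!: derivative_eq_intros simp: inner_commute)
  have 2: "((\<lambda>t. f t \<bullet> g t) has_real_derivative (f t \<bullet> g' + f' \<bullet> g t)) (at t)"
    using assms unfolding has_vector_derivative_def has_field_derivative_def
    by (auto intro!: derivative_eq_intros simp: inner_commute algebra_simps)
  from DERIV_cmult[OF DERIV_mult[OF DERIV_chain2[OF p1_deriv 1] 2], of 2]
  show ?thesis unfolding hp_def dp_def by (simp add: algebra_simps)
qed

lemma dp_add: "dp \<zeta> (\<eta> + \<xi>) = dp \<zeta> \<eta> + dp \<zeta> \<xi>" by (simp add: dp_def inner_add_right algebra_simps)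
lemma dp_scale: "dp \<zeta> (of_real c * \<eta>) = c * dp \<zeta> \<eta>" by (simp add: dp_def flip: scaleR_conv_of_real)
lemma hp_scale: "hp \<zeta> (of_real c * \<eta>) \<xi> = c * hp \<zeta> \<eta> \<xi>" 
  unfolding scaleR_conv_of_real[symmetric] hp_def by (simp add: algebra_simps)

text \<open>The profiles are only controlled on \<open>[0, \<infinity>)\<close>. Clamping the argument yields functions that are continuous,
hence measurable, on the whole line.\<close>
lemma p_clamp: "p0 (\<zeta> \<bullet> \<zeta>) = p0 (max 0 (\<zeta> \<bullet> \<zeta>))" "p1 (\<zeta> \<bullet> \<zeta>) = p1 (max 0 (\<zeta> \<bullet> \<zeta>))"
   "p2 (\<zeta> \<bullet> \<zeta>) = p2 (max 0 (\<zeta> \<bullet> \<zeta>))" for \<zeta> :: complex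
  by (simp_all add: max_absorb2)

lemma p_clamp_cont: "continuous_on UNIV (\<lambda>t. p0 (max 0 t))" "continuous_on UNIV (\<lambda>t. p1 (max 0 t))"
   "continuous_on UNIV (\<lambda>t. p2 (max 0 t))"
proof -
  have "continuous_on {0..} p0" "continuous_on {0..} p1"
    using p0_deriv p1_deriv by (auto intro!: continuous_at_imp_continuous_on DERIV_isCont)
  moreover have "continuous_on UNIV (\<lambda>t. p (max 0 t))" if "continuous_on {0..} p" for p :: "real \<Rightarrow> real"
    by (rule continuous_on_compose2[OF that]) (auto intro!: continuous_intros)
  ultimately show "continuous_on UNIV (\<lambda>t. p0 (max 0 t))" "continuous_on UNIV (\<lambda>t. p1 (max 0 t))"
   "continuous_on UNIV (\<lambda>t. p2 (max 0 t))" using p2_cont by auto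
qed

lemmas p_clamp_measurable [measurable] = p_clamp_cont[THEN borel_measurable_continuous_onI]

lemma hp_isCont:
  assumes "isCont f t" "isCont g t" "isCont h t"
  shows "isCont (\<lambda>t. hp (f t) (g t) (h t)) t"
proof -
  have ff: "isCont (\<lambda>t. f t \<bullet> f t) t" using assms(1) by simp
  have "isCont (\<lambda>t. p2 (max 0 t)) (f t \<bullet> f t)" "isCont (\<lambda>t. p1 (max 0 t)) (f t \<bullet> f t)"
    using p_clamp_cont(2,3) unfolding continuous_on_eq_continuous_at[OF open_UNIV] by blast+
  note isCont_o2[OF ff this(1)] isCont_o2[OF ff this(2)]
  then show ?thesis unfolding hp_def p_clamp using assms by (intro continuous_intros)
qed

lemma pp_measurable [measurable]:
  assumes [measurable]: "f \<in> borel_measurable N"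
  shows "(\<lambda>u. pp (f u)) \<in> borel_measurable N"
  unfolding pp_def p_clamp by measurable

lemma dp_measurable [measurable]:
  assumes [measurable]: "f \<in> borel_measurable N" "g \<in> borel_measurable N"
  shows "(\<lambda>u. dp (f u) (g u)) \<in> borel_measurable N"
  unfolding dp_def p_clamp by measurable

lemma hp_measurable [measurable]:
  assumes [measurable]: "f \<in> borel_measurable N" "g \<in> borel_measurable N" "h \<in> borel_measurable N"
  shows "(\<lambda>u. hp (f u) (g u) (h u)) \<in> borel_measurable N"
  unfolding hp_def p_clamp by measurable

lemma pp_tame: "tame r f \<Longrightarrow> tame r (\<lambda>u. pp (f u))"
  unfolding pp_def by (rule tame_compose[OF tame_inner p_slow(1)]) auto
lemma dp_tame: "tame r f \<Longrightarrow> tame r g \<Longrightarrow> tame r (\<lambda>u. dp (f u) (g u))"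
  unfolding dp_def
  by (intro tame_mult tame_const tame_inner tame_compose[OF tame_inner p_slow(2)]) (auto intro: tame_size_nonneg)
lemma hp_tame: "tame r f \<Longrightarrow> tame r g \<Longrightarrow> tame r h \<Longrightarrow> tame r (\<lambda>u. hp (f u) (g u) (h u))"
  unfolding hp_def
  by (intro tame_add tame_mult tame_const tame_inner tame_compose[OF tame_inner p_slow(2)]
     tame_compose[OF tame_inner p_slow(3)]) (auto intro: tame_size_nonneg)

lemma pp_ge: "v0 \<le> pp \<zeta>" unfolding pp_def by (rule p0_ge) simp

lemma hp_key: "hp \<zeta> (z * \<eta>) (z * \<eta>) + (dp \<zeta> (z * \<eta>))\<^sup>2 * (F2 (pp \<zeta>) / F1 (pp \<zeta>)) \<le> hp \<zeta> \<eta> \<eta>"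
  using pointwise[of \<zeta> \<eta>] unfolding hp_def dp_def pp_def by (simp add: power2_eq_square mult_ac)

end

section \<open>The interpolation in one coordinate\<close>

text \<open>The random polynomial \<open>\<Sum> a\<^sub>n(\<omega>) h\<^sub>n(y, 1)\<close> in one Gaussian variable \<open>y\<close>; the space \<open>N\<close> of \<open>\<omega>\<close> accommodates the
other coordinates.\<close>
locale gaussian_flow = hypercontractive_pair p0 p1 p2 F0 F1 F2 v0 z
  for p0 p1 p2 F0 F1 F2 :: "real \<Rightarrow> real" and v0 :: real and z :: complex +
  fixes N :: "'w measure" and r :: "'w \<Rightarrow> real" and d :: nat and a :: "nat \<Rightarrow> 'w \<Rightarrow> complex"
  assumes N_prob: "prob_space N" and N_integrates_tame: "integrates_tame N r"
    and a_measurable [measurable]: "\<And>n. a n \<in> borel_measurable N"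
    and a_tame: "\<And>n. tame r (a n)"
begin

definition M :: "(real \<times> 'w) measure" where "M = std_gauss \<Otimes>\<^sub>M N"
definition rM :: "real \<times> 'w \<Rightarrow> real" where "rM = (\<lambda>(y, \<omega>). \<bar>y\<bar> + r \<omega>)"

text \<open>The k-th derivative in \<open>w\<close> of \<open>\<Sum> a\<^sub>n h\<^sub>n(w, \<tau>)\<close>; the product is the falling factorial, which is 0 for
\<open>n < k\<close>.\<close>
definition series :: "nat \<Rightarrow> 'w \<Rightarrow> complex \<Rightarrow> complex \<Rightarrow> complex" where
  "series k \<omega> w \<tau> = (\<Sum>n\<le>d. a n \<omega> * of_nat (\<Prod>i<k. n - i) * heat_hermite (n - k) w \<tau>)"

text \<open>The interpolating polynomial (for \<open>k = 0\<close>) and its derivatives, with \<open>x\<close> the outer and \<open>q = (y, \<omega>)\<close> the inner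
variable. The time argument is the variance of \<open>z x sin \<theta> + y cos \<theta>\<close> with \<open>z\<close> treated as a real number.\<close>
definition phi :: "nat \<Rightarrow> real \<Rightarrow> real \<Rightarrow> real \<times> 'w \<Rightarrow> complex" where
  "phi k \<theta> x q = series k (snd q) (z * of_real (sin \<theta> * x) + of_real (cos \<theta> * fst q))
     (z\<^sup>2 * of_real ((sin \<theta>)\<^sup>2) + of_real ((cos \<theta>)\<^sup>2))"

sublocale N: prob_space N by (rule N_prob)
sublocale G: prob_space std_gauss by (rule prob_space_std_gauss)
sublocale GN: pair_prob_space std_gauss N ..
sublocale M: prob_space M unfolding M_def by (rule GN.P.prob_space_axioms)

lemma r_nonneg: "0 \<le> r \<omega>" using N_integrates_tame by (simp add: integrates_tame_def)

lemma M_integrates_tame: "integrates_tame M rM"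
  unfolding M_def rM_def
  by (intro integrates_tame_pair integrates_tame_std_gauss N_integrates_tame G.sigma_finite_measure_axioms N.sigma_finite_measure_axioms)

lemma rM_nonneg: "0 \<le> rM q" using M_integrates_tame unfolding integrates_tame_def by blast

lemma series_deriv:
  assumes "(w has_vector_derivative w') (at t)" "(\<tau> has_vector_derivative \<tau>') (at t)"
  shows "((\<lambda>t. series k \<omega> (w t) (\<tau> t)) has_vector_derivative
    series (Suc k) \<omega> (w t) (\<tau> t) * w' - series (Suc (Suc k)) \<omega> (w t) (\<tau> t) * \<tau>' / 2) (at t)"
proof -
  have "((\<lambda>t. series k \<omega> (w t) (\<tau> t)) has_vector_derivative
     (\<Sum>n\<le>d. a n \<omega> * of_nat (\<Prod>i<k. n - i) * (of_nat (n - k) * heat_hermite (n - k - 1) (w t) (\<tau> t) * w'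
    - of_nat ((n - k) * (n - k - 1)) / 2 * heat_hermite (n - k - 2) (w t) (\<tau> t) * \<tau>'))) (at t)"
    unfolding series_def
    by (intro has_vector_derivative_sum has_vector_derivative_mult_right heat_hermite_has_vector_derivative assms)
  moreover have "series (Suc k) \<omega> (w t) (\<tau> t) * w' - series (Suc (Suc k)) \<omega> (w t) (\<tau> t) * \<tau>' / 2
    = (\<Sum>n\<le>d. a n \<omega> * of_nat (\<Prod>i<k. n - i) * (of_nat (n - k) * heat_hermite (n - k - 1) (w t) (\<tau> t) * w'
    - of_nat ((n - k) * (n - k - 1)) / 2 * heat_hermite (n - k - 2) (w t) (\<tau> t) * \<tau>'))"
    unfolding series_def sum_distrib_right sum_divide_distrib sum_subtractf[symmetric]
  proof (rule sum.cong[OF refl])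
    fix n
    have e: "n - k - 1 = n - Suc k" "n - k - 2 = n - Suc (Suc k)" by auto
    show "a n \<omega> * of_nat (\<Prod>i<Suc k. n - i) * heat_hermite (n - Suc k) (w t) (\<tau> t) * w'
        - a n \<omega> * of_nat (\<Prod>i<Suc (Suc k). n - i) * heat_hermite (n - Suc (Suc k)) (w t) (\<tau> t) * \<tau>' / 2
      = a n \<omega> * of_nat (\<Prod>i<k. n - i) * (of_nat (n - k) * heat_hermite (n - k - 1) (w t) (\<tau> t) * w'
        - of_nat ((n - k) * (n - k - 1)) / 2 * heat_hermite (n - k - 2) (w t) (\<tau> t) * \<tau>')"
      unfolding e prod.lessThan_Suc of_nat_mult
      by (simp add: field_simps del: of_nat_prod of_nat_mult)
  qed
  ultimately show ?thesis by (simp only:)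
qed

lemma phi_deriv_x:
  "((\<lambda>x. phi k \<theta> x q) has_vector_derivative of_real (sin \<theta>) * (z * phi (Suc k) \<theta> x q)) (at x)"
proof -
  have w: "((\<lambda>x. z * of_real (sin \<theta> * x) + of_real (cos \<theta> * fst q)) has_vector_derivative
      z * of_real (sin \<theta>)) (at x)"
    by (auto intro!: derivative_eq_intros simp: has_real_derivative_iff_has_vector_derivative[symmetric])
  from series_deriv[OF w has_vector_derivative_const, of k "snd q"] show ?thesis
    unfolding phi_def by (simp add: mult_ac)
qed

lemma phi_deriv_y:
  "((\<lambda>y. phi k \<theta> x (y, \<omega>)) has_vector_derivative of_real (cos \<theta>) * phi (Suc k) \<theta> x (y, \<omega>)) (at y)"
proof -
  have w: "((\<lambda>y. z * of_real (sin \<theta> * x) + of_real (cos \<theta> * y)) has_vector_derivative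
      of_real (cos \<theta>)) (at y)"
    by (auto intro!: derivative_eq_intros simp: has_real_derivative_iff_has_vector_derivative[symmetric])
  from series_deriv[OF w has_vector_derivative_const, of k \<omega>] show ?thesis
    unfolding phi_def by (simp add: mult_ac)
qed

definition phi_dot :: "real \<Rightarrow> real \<Rightarrow> real \<times> 'w \<Rightarrow> complex" where
  "phi_dot \<theta> x q = of_real (cos \<theta> * x) * (z * phi 1 \<theta> x q) + of_real (- sin \<theta> * fst q) * phi 1 \<theta> x q
     + of_real (sin \<theta> * cos \<theta>) * ((1 - z\<^sup>2) * phi 2 \<theta> x q)"

text \<open>The time derivative of the series is converted by the heat equation into the term with \<open>phi 2\<close>.\<close>
lemma phi_deriv_theta:
  "((\<lambda>\<theta>. phi 0 \<theta> x q) has_vector_derivative phi_dot \<theta> x q) (at \<theta>)"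
proof -
  have w: "((\<lambda>\<theta>. z * of_real (sin \<theta> * x) + of_real (cos \<theta> * fst q)) has_vector_derivative
      z * of_real (cos \<theta> * x) + of_real (- sin \<theta> * fst q)) (at \<theta>)"
    by (auto intro!: derivative_eq_intros has_vector_derivative_of_real)
  have "((\<lambda>\<theta>. (sin \<theta>)\<^sup>2) has_real_derivative 2 * sin \<theta> * cos \<theta>) (at \<theta>)"
    "((\<lambda>\<theta>. (cos \<theta>)\<^sup>2) has_real_derivative - 2 * sin \<theta> * cos \<theta>) (at \<theta>)"
    by (auto intro!: derivative_eq_intros)
  then have t: "((\<lambda>\<theta>. z\<^sup>2 * of_real ((sin \<theta>)\<^sup>2) + of_real ((cos \<theta>)\<^sup>2)) has_vector_derivative
      z\<^sup>2 * of_real (2 * sin \<theta> * cos \<theta>) + of_real (- 2 * sin \<theta> * cos \<theta>)) (at \<theta>)"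
    by (intro has_vector_derivative_add has_vector_derivative_mult_right has_vector_derivative_of_real)
  have e: "S1 * (z * of_real (cos \<theta> * x) + of_real (- sin \<theta> * fst q))
      - S2 * (z\<^sup>2 * of_real (2 * sin \<theta> * cos \<theta>) + of_real (- 2 * sin \<theta> * cos \<theta>)) / 2
    = of_real (cos \<theta> * x) * (z * S1) + of_real (- sin \<theta> * fst q) * S1
      + of_real (sin \<theta> * cos \<theta>) * ((1 - z\<^sup>2) * S2)" for S1 S2
    by (simp add: field_simps)
  have S: "Suc 0 = 1" "Suc 1 = 2" by auto
  from series_deriv[OF w t, of 0 "snd q"] show ?thesis
    unfolding phi_dot_def phi_def S e .
qed

lemma phi_measurable [measurable]: "phi k \<theta> x \<in> borel_measurable M"
  unfolding phi_def series_def M_def by measurable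

lemma phi_dot_measurable [measurable]: "phi_dot \<theta> x \<in> borel_measurable M"
proof -
  have "fst \<in> borel_measurable M" unfolding M_def by measurable
  then show ?thesis unfolding phi_dot_def by measurable
qed

definition arg_size :: "real \<times> real \<times> real \<times> 'w \<Rightarrow> real" where "arg_size = (\<lambda>(\<theta>, x, q). \<bar>x\<bar> + rM q)"

lemma arg_size_nonneg: "0 \<le> arg_size u" unfolding arg_size_def split_beta' by (simp add: rM_nonneg)

lemma tame_of_bound: "(\<And>u. norm (f u) \<le> arg_size u) \<Longrightarrow> tame arg_size f"
  by (rule tame_norm_le[OF tame_size]) (auto simp: arg_size_nonneg)

lemma tame_coords:
  "tame arg_size (\<lambda>(\<theta>, x, q). x)" "tame arg_size (\<lambda>(\<theta>, x, q). fst q)" "tame arg_size (\<lambda>(\<theta>, x, q). sin \<theta>)" "tame arg_size (\<lambda>(\<theta>, x, q). cos \<theta>)"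
  "tame arg_size (\<lambda>(\<theta>, x, q). a n (snd q))"
proof -
  show "tame arg_size (\<lambda>(\<theta>, x, q). x)" "tame arg_size (\<lambda>(\<theta>, x, q). fst q)"
  proof (rule_tac [!] tame_of_bound)
    fix u :: "real \<times> real \<times> real \<times> 'w"
    obtain \<theta> x y \<omega> where "u = (\<theta>, x, y, \<omega>)" by (cases u) auto
    then show "norm (case u of (\<theta>, x, q) \<Rightarrow> x) \<le> arg_size u" "norm (case u of (\<theta>, x, q) \<Rightarrow> fst q) \<le> arg_size u"
      using r_nonneg[of \<omega>] by (auto simp: arg_size_def rM_def)
  qed
  have "tame arg_size (\<lambda>_. 1 :: real)" using arg_size_nonneg by (rule tame_const)
  then show "tame arg_size (\<lambda>(\<theta>, x, q). sin \<theta>)" "tame arg_size (\<lambda>(\<theta>, x, q). cos \<theta>)"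
    by (auto elim!: tame_norm_le)
  show "tame arg_size (\<lambda>(\<theta>, x, q). a n (snd q))"
    using tame_reindex[OF a_tame[of n], of "\<lambda>u. snd (snd (snd u))" 0 arg_size] r_nonneg arg_size_nonneg
    by (auto simp: arg_size_def rM_def split_beta' add_increasing)
qed

lemmas tame_coords' = tame_coords[unfolded split_beta']

lemma phi_tame: "tame arg_size (\<lambda>(\<theta>, x, q). phi k \<theta> x q)"
  unfolding phi_def series_def split_beta'
  by (intro tame_sum tame_mult tame_heat_hermite tame_add tame_of_real tame_power tame_const tame_coords' arg_size_nonneg)

lemmas phi_tame' = phi_tame[unfolded split_beta']

lemma phi_dot_tame: "tame arg_size (\<lambda>(\<theta>, x, q). phi_dot \<theta> x q)"
  unfolding phi_dot_def split_beta'
  by (intro tame_mult tame_add tame_of_real tame_minus tame_const tame_coords' phi_tame' arg_size_nonneg)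

lemmas phi_dot_tame' = phi_dot_tame[unfolded split_beta']

lemma tame_fix_x: "tame arg_size (\<lambda>(\<theta>, x, q). g \<theta> x q) \<Longrightarrow> tame (\<lambda>(\<theta>, q). \<bar>\<theta>\<bar> + rM q) (\<lambda>(\<theta>, q). g \<theta> x q)"
  using tame_reindex[of arg_size "\<lambda>(\<theta>, x, q). g \<theta> x q" "\<lambda>(\<theta>, q). (\<theta>, x, q)" "\<bar>x\<bar>" "\<lambda>(\<theta>, q). \<bar>\<theta>\<bar> + rM q"] rM_nonneg
  by (auto simp: arg_size_def split_beta')

lemma tame_fix_theta: "tame arg_size (\<lambda>(\<theta>, x, q). g \<theta> x q) \<Longrightarrow> tame (\<lambda>(x, q). \<bar>x\<bar> + rM q) (\<lambda>(x, q). g \<theta> x q)"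
  using tame_reindex[of arg_size "\<lambda>(\<theta>, x, q). g \<theta> x q" "\<lambda>(x, q). (\<theta>, x, q)" 0 "\<lambda>(x, q). \<bar>x\<bar> + rM q"] rM_nonneg
  by (auto simp: arg_size_def split_beta')

lemma tame_fix_both: "tame arg_size (\<lambda>(\<theta>, x, q). g \<theta> x q) \<Longrightarrow> tame rM (\<lambda>q. g \<theta> x q)"
  using tame_reindex[of arg_size "\<lambda>(\<theta>, x, q). g \<theta> x q" "\<lambda>q. (\<theta>, x, q)" "\<bar>x\<bar>" rM] rM_nonneg
  by (auto simp: arg_size_def split_beta')

lemma integrable_M: 
  fixes g :: "_ \<Rightarrow> _ \<Rightarrow> _ \<Rightarrow> real"
  shows "tame arg_size (\<lambda>(\<theta>, x, q). g \<theta> x q) \<Longrightarrow> g \<theta> x \<in> borel_measurable M \<Longrightarrow> integrable M (g \<theta> x)"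
  using integrates_tame_integrable[OF M_integrates_tame tame_fix_both] by blast

lemma tame_integral_M:
  fixes g :: "_ \<Rightarrow> _ \<Rightarrow> _ \<Rightarrow> real"
  assumes "tame arg_size (\<lambda>(\<theta>, x, q). g \<theta> x q)"
  shows "tame (\<lambda>(\<theta>, x). \<bar>x\<bar>) (\<lambda>(\<theta>, x). LINT q|M. g \<theta> x q)"
proof -
  have "tame (\<lambda>(u, q). (case u of (\<theta>, x) \<Rightarrow> \<bar>x\<bar>) + rM q) (\<lambda>(u, q). g (fst u) (snd u) q)"
    using tame_reindex[OF assms, of "\<lambda>(u, q). (fst u, snd u, q)" 0 "\<lambda>(u, q). (case u of (\<theta>, x) \<Rightarrow> \<bar>x\<bar>) + rM q"] rM_nonneg
    by (auto simp: arg_size_def split_beta')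
  from tame_integral[OF M_integrates_tame this] show ?thesis by (auto simp: split_beta')
qed

text \<open>Apart from \<open>V\<close>, these are the integrals that appear when \<open>V\<close> is differentiated: up to trigonometric factors \<open>W\<close>
is its \<open>x\<close>-derivative and \<open>B\<close> the \<open>x\<close>-derivative of \<open>W\<close>, while \<open>A\<close> comes from integration by parts in \<open>y\<close>.
The Hessian terms of \<open>A\<close> and \<open>B\<close> differ by the factor \<open>z\<close>; their terms with \<open>phi 2\<close> agree.\<close>
definition V :: "real \<Rightarrow> real \<Rightarrow> real" where "V \<theta> x = (LINT q|M. pp (phi 0 \<theta> x q))"
definition W :: "real \<Rightarrow> real \<Rightarrow> real" where "W \<theta> x = (LINT q|M. dp (phi 0 \<theta> x q) (z * phi 1 \<theta> x q))"
definition A :: "real \<Rightarrow> real \<Rightarrow> real" where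
  "A \<theta> x = (LINT q|M. hp (phi 0 \<theta> x q) (phi 1 \<theta> x q) (phi 1 \<theta> x q) + dp (phi 0 \<theta> x q) (z\<^sup>2 * phi 2 \<theta> x q))"
definition B :: "real \<Rightarrow> real \<Rightarrow> real" where
  "B \<theta> x = (LINT q|M. hp (phi 0 \<theta> x q) (z * phi 1 \<theta> x q) (z * phi 1 \<theta> x q) + dp (phi 0 \<theta> x q) (z\<^sup>2 * phi 2 \<theta> x q))"

lemma integrands_tame:
  "tame arg_size (\<lambda>(\<theta>, x, q). pp (phi 0 \<theta> x q))"
  "tame arg_size (\<lambda>(\<theta>, x, q). dp (phi 0 \<theta> x q) (phi_dot \<theta> x q))"
  "tame arg_size (\<lambda>(\<theta>, x, q). dp (phi 0 \<theta> x q) (c * phi k \<theta> x q))"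
  "tame arg_size (\<lambda>(\<theta>, x, q). dp (phi 0 \<theta> x q) (phi k \<theta> x q))"
  "tame arg_size (\<lambda>(\<theta>, x, q). fst q * dp (phi 0 \<theta> x q) (phi k \<theta> x q))"
  "tame arg_size (\<lambda>(\<theta>, x, q). hp (phi 0 \<theta> x q) (c * phi 1 \<theta> x q) (c * phi 1 \<theta> x q))"
  "tame arg_size (\<lambda>(\<theta>, x, q). hp (phi 0 \<theta> x q) (phi 1 \<theta> x q) (phi 1 \<theta> x q))"
  unfolding split_beta'
  by (intro pp_tame dp_tame hp_tame phi_tame' phi_dot_tame' tame_mult tame_coords' tame_const arg_size_nonneg)+

lemma integrands_measurable:
  "(\<lambda>q. dp (phi 0 \<theta> x q) (c * phi k \<theta> x q)) \<in> borel_measurable M"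
  "(\<lambda>q. dp (phi 0 \<theta> x q) (phi k \<theta> x q)) \<in> borel_measurable M"
  "(\<lambda>q. hp (phi 0 \<theta> x q) (c * phi 1 \<theta> x q) (c * phi 1 \<theta> x q)) \<in> borel_measurable M"
  "(\<lambda>q. hp (phi 0 \<theta> x q) (phi 1 \<theta> x q) (phi 1 \<theta> x q)) \<in> borel_measurable M"
  "(\<lambda>q. fst q * dp (phi 0 \<theta> x q) (phi k \<theta> x q)) \<in> borel_measurable M"
proof -
  have [measurable]: "fst \<in> borel_measurable M" unfolding M_def by measurable
  show "(\<lambda>q. dp (phi 0 \<theta> x q) (c * phi k \<theta> x q)) \<in> borel_measurable M"
  "(\<lambda>q. dp (phi 0 \<theta> x q) (phi k \<theta> x q)) \<in> borel_measurable M"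
  "(\<lambda>q. hp (phi 0 \<theta> x q) (c * phi 1 \<theta> x q) (c * phi 1 \<theta> x q)) \<in> borel_measurable M"
  "(\<lambda>q. hp (phi 0 \<theta> x q) (phi 1 \<theta> x q) (phi 1 \<theta> x q)) \<in> borel_measurable M"
  "(\<lambda>q. fst q * dp (phi 0 \<theta> x q) (phi k \<theta> x q)) \<in> borel_measurable M"
    by measurable
qed

lemmas integrands_integrable =
  integrable_M[OF integrands_tame(3) integrands_measurable(1)]
  integrable_M[OF integrands_tame(4) integrands_measurable(2)]
  integrable_M[OF integrands_tame(6) integrands_measurable(3)]
  integrable_M[OF integrands_tame(7) integrands_measurable(4)]
  integrable_M[OF integrands_tame(5) integrands_measurable(5)]

lemma inner_integration_by_parts:
  "(LINT q|M. fst q * dp (phi 0 \<theta> x q) (phi 1 \<theta> x q))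
   = cos \<theta> * (LINT q|M. hp (phi 0 \<theta> x q) (phi 1 \<theta> x q) (phi 1 \<theta> x q) + dp (phi 0 \<theta> x q) (phi 2 \<theta> x q))"
proof -
  let ?g = "\<lambda>q. dp (phi 0 \<theta> x q) (phi 1 \<theta> x q)"
  let ?g' = "\<lambda>q. cos \<theta> * (hp (phi 0 \<theta> x q) (phi 1 \<theta> x q) (phi 1 \<theta> x q) + dp (phi 0 \<theta> x q) (phi 2 \<theta> x q))"
  have g: "tame rM ?g" by (rule tame_fix_both[OF integrands_tame(4)])
  have g': "tame rM ?g'"
    by (intro tame_mult tame_add tame_const rM_nonneg tame_fix_both[OF integrands_tame(7)] tame_fix_both[OF integrands_tame(4)])
  have ig': "integrable M ?g'" using integrands_integrable by auto
  have *: "(LINT y|std_gauss. y * ?g (y, \<omega>)) = (LINT y|std_gauss. ?g' (y, \<omega>))" for \<omega>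
  proof -
    have "(LINT y|std_gauss. y *\<^sub>R ?g (y, \<omega>)) = (LINT y|std_gauss. ?g' (y, \<omega>))"
    proof (rule gaussian_integration_by_parts)
      show "((\<lambda>y. ?g (y, \<omega>)) has_vector_derivative ?g' (y, \<omega>)) (at y)" for y
        using dp_deriv[OF phi_deriv_y[of 0 \<theta> x \<omega> y] phi_deriv_y[of 1 \<theta> x \<omega> y]]
        unfolding has_real_derivative_iff_has_vector_derivative hp_scale dp_scale
        by (simp add: algebra_simps numeral_2_eq_2)
      have c: "isCont (\<lambda>y. phi k \<theta> x (y, \<omega>)) y" for k y
        using phi_deriv_y has_vector_derivative_continuous by blast
      have "isCont (\<lambda>y. dp (phi 0 \<theta> x (y, \<omega>)) (phi 2 \<theta> x (y, \<omega>))) y" for y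
        by (rule DERIV_isCont[OF dp_deriv[OF phi_deriv_y phi_deriv_y]])
      then show "isCont (\<lambda>y. ?g' (y, \<omega>)) y" for y
        by (intro continuous_intros hp_isCont c)
      have "rM (y, \<omega>) \<le> r \<omega> + \<bar>y\<bar>" for y by (simp add: rM_def)
      then show "tame (\<lambda>x. \<bar>x\<bar>) (\<lambda>y. ?g (y, \<omega>))" "tame (\<lambda>x. \<bar>x\<bar>) (\<lambda>y. ?g' (y, \<omega>))"
        using tame_reindex[OF g, of "\<lambda>y. (y, \<omega>)" "r \<omega>" "\<lambda>x. \<bar>x\<bar>"] tame_reindex[OF g', of "\<lambda>y. (y, \<omega>)" "r \<omega>" "\<lambda>x. \<bar>x\<bar>"]
        by auto
    qed
    then show ?thesis by simp
  qed
  have "(LINT q|M. fst q * ?g q) = (LINT \<omega>|N. LINT y|std_gauss. y * ?g (y, \<omega>))"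
    using GN.integral_snd[of "\<lambda>y \<omega>. y * ?g (y, \<omega>)"] integrands_integrable(5)[of \<theta> x 1]
    by (simp add: M_def split_beta')
  also have "\<dots> = (LINT \<omega>|N. LINT y|std_gauss. ?g' (y, \<omega>))" by (simp only: *)
  also have "\<dots> = (LINT q|M. ?g' q)"
    using GN.integral_snd[of "\<lambda>y \<omega>. ?g' (y, \<omega>)"] ig' by (simp add: M_def split_beta')
  also have "\<dots> = cos \<theta> * (LINT q|M. hp (phi 0 \<theta> x q) (phi 1 \<theta> x q) (phi 1 \<theta> x q) + dp (phi 0 \<theta> x q) (phi 2 \<theta> x q))"
    by simp
  finally show ?thesis .
qed

end

context gaussian_flow
begin

lemma V_ge: "v0 \<le> V \<theta> x"
  unfolding V_def
  by (intro M.integral_ge_const integrable_M[OF integrands_tame(1)]) (auto simp: pp_ge)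

lemma V_tame: "tame (\<lambda>(\<theta>, x). \<bar>x\<bar>) (\<lambda>(\<theta>, x). V \<theta> x)"
  unfolding V_def by (rule tame_integral_M[OF integrands_tame(1)])
lemma W_tame: "tame (\<lambda>(\<theta>, x). \<bar>x\<bar>) (\<lambda>(\<theta>, x). W \<theta> x)"
  unfolding W_def by (rule tame_integral_M[OF integrands_tame(3)])
lemma AB_integrand_tame:
  "tame arg_size (\<lambda>(\<theta>, x, q). hp (phi 0 \<theta> x q) (phi 1 \<theta> x q) (phi 1 \<theta> x q) + dp (phi 0 \<theta> x q) (z\<^sup>2 * phi 2 \<theta> x q))"
  "tame arg_size (\<lambda>(\<theta>, x, q). hp (phi 0 \<theta> x q) (z * phi 1 \<theta> x q) (z * phi 1 \<theta> x q) + dp (phi 0 \<theta> x q) (z\<^sup>2 * phi 2 \<theta> x q))"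
  using tame_add[OF integrands_tame(7) integrands_tame(3)] tame_add[OF integrands_tame(6) integrands_tame(3)]
  by (auto simp: split_beta')
lemma A_tame: "tame (\<lambda>(\<theta>, x). \<bar>x\<bar>) (\<lambda>(\<theta>, x). A \<theta> x)"
  unfolding A_def by (rule tame_integral_M[OF AB_integrand_tame(1)])
lemma B_tame: "tame (\<lambda>(\<theta>, x). \<bar>x\<bar>) (\<lambda>(\<theta>, x). B \<theta> x)"
  unfolding B_def by (rule tame_integral_M[OF AB_integrand_tame(2)])

text \<open>Integration by parts in \<open>y\<close> contributes \<open>- Dp[phi 2]\<close>, the heat equation \<open>(1 - z\<^sup>2) Dp[phi 2]\<close>; the remainder
\<open>- z\<^sup>2 Dp[phi 2]\<close> is the one that \<open>B\<close> will cancel.\<close>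
lemma V_deriv_theta:
  "((\<lambda>\<theta>. V \<theta> x) has_real_derivative cos \<theta> * x * W \<theta> x - sin \<theta> * cos \<theta> * A \<theta> x) (at \<theta>)"
proof -
  have "((\<lambda>\<theta>. LINT q|M. (case (\<theta>, q) of (\<theta>, q) \<Rightarrow> pp (phi 0 \<theta> x q))) has_real_derivative
      (LINT q|M. (case (\<theta>, q) of (\<theta>, q) \<Rightarrow> dp (phi 0 \<theta> x q) (phi_dot \<theta> x q)))) (at \<theta>)"
    by (rule has_real_derivative_integral[OF M_integrates_tame])
      (auto intro: tame_fix_x integrands_tame pp_deriv phi_deriv_theta)
  moreover have "(LINT q|M. dp (phi 0 \<theta> x q) (phi_dot \<theta> x q)) = cos \<theta> * x * W \<theta> x - sin \<theta> * cos \<theta> * A \<theta> x"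
  proof -
    have e: "dp (phi 0 \<theta> x q) (phi_dot \<theta> x q) = cos \<theta> * x * dp (phi 0 \<theta> x q) (z * phi 1 \<theta> x q)
      - sin \<theta> * (fst q * dp (phi 0 \<theta> x q) (phi 1 \<theta> x q))
      + sin \<theta> * cos \<theta> * (dp (phi 0 \<theta> x q) (phi 2 \<theta> x q) - dp (phi 0 \<theta> x q) (z\<^sup>2 * phi 2 \<theta> x q))" for q
    proof -
      have "dp (phi 0 \<theta> x q) (phi 2 \<theta> x q) = dp (phi 0 \<theta> x q) ((1 - z\<^sup>2) * phi 2 \<theta> x q) + dp (phi 0 \<theta> x q) (z\<^sup>2 * phi 2 \<theta> x q)"
        by (subst dp_add[symmetric]) (simp add: algebra_simps)
      then show ?thesis unfolding phi_dot_def dp_add dp_scale by simp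
    qed
    show ?thesis
    proof -
      have "(LINT q|M. dp (phi 0 \<theta> x q) (phi_dot \<theta> x q)) = cos \<theta> * x * W \<theta> x
        - sin \<theta> * (LINT q|M. fst q * dp (phi 0 \<theta> x q) (phi 1 \<theta> x q))
        + sin \<theta> * cos \<theta> * ((LINT q|M. dp (phi 0 \<theta> x q) (phi 2 \<theta> x q)) - (LINT q|M. dp (phi 0 \<theta> x q) (z\<^sup>2 * phi 2 \<theta> x q)))"
        unfolding e W_def using integrands_integrable by (simp del: One_nat_def)
      also have "\<dots> = cos \<theta> * x * W \<theta> x - sin \<theta> * cos \<theta> * A \<theta> x"
        unfolding inner_integration_by_parts A_def using integrands_integrable
        by (simp add: distrib_left right_diff_distrib del: One_nat_def)
      finally show ?thesis .
    qed
  qed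
  ultimately show ?thesis unfolding V_def by simp
qed

lemma V_deriv_x: "((\<lambda>x. V \<theta> x) has_real_derivative sin \<theta> * W \<theta> x) (at x)"
proof -
  have "((\<lambda>x. LINT q|M. (case (x, q) of (x, q) \<Rightarrow> pp (phi 0 \<theta> x q))) has_real_derivative
      (LINT q|M. (case (x, q) of (x, q) \<Rightarrow> sin \<theta> * dp (phi 0 \<theta> x q) (z * phi 1 \<theta> x q)))) (at x)"
  proof (rule has_real_derivative_integral[OF M_integrates_tame])
    show "tame (\<lambda>(t, q). \<bar>t\<bar> + rM q) (\<lambda>(x, q). sin \<theta> * dp (phi 0 \<theta> x q) (z * phi 1 \<theta> x q))"
      using tame_mult[OF tame_const tame_fix_theta[OF integrands_tame(3)], of "sin \<theta>" \<theta> z 1] rM_nonneg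
      by (auto simp: split_beta')
    show "((\<lambda>t. case (t, q) of (x, q) \<Rightarrow> pp (phi 0 \<theta> x q)) has_real_derivative
      (case (t, q) of (x, q) \<Rightarrow> sin \<theta> * dp (phi 0 \<theta> x q) (z * phi 1 \<theta> x q))) (at t)" for t q
      using pp_deriv[OF phi_deriv_x[of 0 \<theta> q t]] by (simp add: dp_scale flip: One_nat_def)
  qed (auto intro: tame_fix_theta integrands_tame)
  then show ?thesis unfolding V_def W_def by simp
qed

lemma W_deriv_x: "((\<lambda>x. W \<theta> x) has_real_derivative sin \<theta> * B \<theta> x) (at x)"
proof -
  let ?b = "\<lambda>x q. hp (phi 0 \<theta> x q) (z * phi 1 \<theta> x q) (z * phi 1 \<theta> x q) + dp (phi 0 \<theta> x q) (z\<^sup>2 * phi 2 \<theta> x q)"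
  have "((\<lambda>x. LINT q|M. (case (x, q) of (x, q) \<Rightarrow> dp (phi 0 \<theta> x q) (z * phi 1 \<theta> x q))) has_real_derivative
      (LINT q|M. (case (x, q) of (x, q) \<Rightarrow> sin \<theta> * ?b x q))) (at x)"
  proof (rule has_real_derivative_integral[OF M_integrates_tame])
    show "tame (\<lambda>(t, q). \<bar>t\<bar> + rM q) (\<lambda>(x, q). sin \<theta> * ?b x q)"
      using tame_mult[OF tame_const tame_fix_theta[OF AB_integrand_tame(2)], of "sin \<theta>" \<theta>] rM_nonneg
      by (auto simp: split_beta')
    show "((\<lambda>t. case (t, q) of (x, q) \<Rightarrow> dp (phi 0 \<theta> x q) (z * phi 1 \<theta> x q)) has_real_derivative
      (case (t, q) of (x, q) \<Rightarrow> sin \<theta> * ?b x q)) (at t)" for t q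
    proof -
      have e: "z * (of_real (sin \<theta>) * (z * phi (Suc 1) \<theta> t q)) = of_real (sin \<theta>) * (z\<^sup>2 * phi 2 \<theta> t q)"
        by (simp add: power2_eq_square numeral_2_eq_2)
      show ?thesis
        using dp_deriv[OF phi_deriv_x[of 0 \<theta> q t] has_vector_derivative_mult_right[OF phi_deriv_x[of 1 \<theta> q t], of z]]
        unfolding e dp_scale mult.left_commute[of z "of_real _"] hp_scale
        by (simp add: distrib_left power2_eq_square mult.assoc flip: One_nat_def)
    qed
  qed (auto intro: tame_fix_theta integrands_tame)
  then show ?thesis unfolding B_def W_def by simp
qed

lemma phi_isCont_x: "isCont (\<lambda>x. phi k \<theta> x q) x"
  using phi_deriv_x has_vector_derivative_continuous by blast

lemma dp_phi_isCont_x: "isCont (\<lambda>x. dp (phi k \<theta> x q) (c * phi l \<theta> x q)) x"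
  by (rule DERIV_isCont[OF dp_deriv[OF phi_deriv_x has_vector_derivative_mult_right[OF phi_deriv_x]]])

lemma AB_isCont_x: "isCont (\<lambda>x. A \<theta> x) x" "isCont (\<lambda>x. B \<theta> x) x"
proof -
  have "isCont (\<lambda>x. LINT q|M. (case (x, q) of (x, q) \<Rightarrow> hp (phi 0 \<theta> x q) (phi 1 \<theta> x q) (phi 1 \<theta> x q) + dp (phi 0 \<theta> x q) (z\<^sup>2 * phi 2 \<theta> x q))) x"
    by (rule isCont_integral[OF M_integrates_tame])
      (auto intro!: tame_fix_theta AB_integrand_tame continuous_intros hp_isCont phi_isCont_x dp_phi_isCont_x simp del: One_nat_def)
  then show "isCont (\<lambda>x. A \<theta> x) x" unfolding A_def by simp
  have "isCont (\<lambda>x. LINT q|M. (case (x, q) of (x, q) \<Rightarrow> hp (phi 0 \<theta> x q) (z * phi 1 \<theta> x q) (z * phi 1 \<theta> x q) + dp (phi 0 \<theta> x q) (z\<^sup>2 * phi 2 \<theta> x q))) x"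
    by (rule isCont_integral[OF M_integrates_tame])
      (auto intro!: tame_fix_theta AB_integrand_tame continuous_intros hp_isCont phi_isCont_x dp_phi_isCont_x simp del: One_nat_def)
  then show "isCont (\<lambda>x. B \<theta> x) x" unfolding B_def by simp
qed

lemma V_isCont_x: "isCont (\<lambda>x. V \<theta> x) x" using V_deriv_x by (rule DERIV_isCont)
lemma W_isCont_x: "isCont (\<lambda>x. W \<theta> x) x" using W_deriv_x by (rule DERIV_isCont)

lemma F_V_deriv_x:
  "((\<lambda>x. F0 (V \<theta> x)) has_real_derivative F1 (V \<theta> x) * (sin \<theta> * W \<theta> x)) (at x)"
  "((\<lambda>x. F1 (V \<theta> x)) has_real_derivative F2 (V \<theta> x) * (sin \<theta> * W \<theta> x)) (at x)"
  by (rule DERIV_chain2[OF F0_deriv[OF V_ge] V_deriv_x] DERIV_chain2[OF F1_deriv[OF V_ge] V_deriv_x])+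

lemma F2_V_isCont_x: "isCont (\<lambda>x. F2 (V \<theta> x)) x"
proof -
  have "continuous_on UNIV (\<lambda>x. F2 (V \<theta> x))"
    using V_isCont_x V_ge
    by (intro continuous_on_compose2[OF F2_cont] continuous_at_imp_continuous_on) auto
  then show ?thesis by (simp add: continuous_on_eq_continuous_at)
qed

lemma F_V_tame:
  "tame (\<lambda>(\<theta>, x). \<bar>x\<bar>) (\<lambda>(\<theta>, x). F0 (V \<theta> x))"
  "tame (\<lambda>(\<theta>, x). \<bar>x\<bar>) (\<lambda>(\<theta>, x). F1 (V \<theta> x))"
  "tame (\<lambda>(\<theta>, x). \<bar>x\<bar>) (\<lambda>(\<theta>, x). F2 (V \<theta> x))"
  unfolding split_beta'
  by (intro tame_compose[OF V_tame[unfolded split_beta'], where S = "{v0..}"] F_slow; simp add: V_ge)+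

lemma tame_x_weaken: "tame (\<lambda>(\<theta>, x). \<bar>x\<bar>) (\<lambda>(\<theta>, x). g \<theta> x) \<Longrightarrow> tame (\<lambda>(\<theta>, x). \<bar>\<theta>\<bar> + \<bar>x\<bar>) (\<lambda>(\<theta>, x). g \<theta> x)"
  for \<theta> :: real
  using tame_reindex[of "\<lambda>(\<theta>, x). \<bar>x\<bar>" "\<lambda>(\<theta>, x). g \<theta> x" "\<lambda>u. u" 0 "\<lambda>(\<theta>, x). \<bar>\<theta>\<bar> + \<bar>x\<bar>"]
  by (auto simp: split_beta')

lemma tame_x_fix: "tame (\<lambda>(\<theta>, x). \<bar>x\<bar>) (\<lambda>(\<theta>, x). g \<theta> x) \<Longrightarrow> tame (\<lambda>x. \<bar>x\<bar>) (\<lambda>x. g \<theta> x)"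
  using tame_reindex[of "\<lambda>(\<theta>, x). \<bar>x\<bar>" "\<lambda>(\<theta>, x). g \<theta> x" "\<lambda>x. (\<theta>, x)" 0 "\<lambda>x. \<bar>x\<bar>"]
  by auto

lemma measurable_of_isCont: "(\<And>x. isCont f x) \<Longrightarrow> f \<in> borel_measurable std_gauss" for f :: "real \<Rightarrow> real"
  by (auto intro!: borel_measurable_continuous_onI continuous_at_imp_continuous_on)

lemmas fixed_theta_tame = V_tame[THEN tame_x_fix] W_tame[THEN tame_x_fix] A_tame[THEN tame_x_fix] B_tame[THEN tame_x_fix]
  F_V_tame[THEN tame_x_fix]

lemmas fixed_theta_isCont = V_isCont_x W_isCont_x AB_isCont_x F2_V_isCont_x F_V_deriv_x[THEN DERIV_isCont]

lemmas fixed_theta_measurable [measurable] = fixed_theta_isCont[THEN measurable_of_isCont]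

definition J :: "real \<Rightarrow> real" where "J \<theta> = (LINT x|std_gauss. F0 (V \<theta> x))"

lemma outer_integration_by_parts:
  "(LINT x|std_gauss. x * (F1 (V \<theta> x) * W \<theta> x))
    = sin \<theta> * (LINT x|std_gauss. F2 (V \<theta> x) * (W \<theta> x)\<^sup>2 + F1 (V \<theta> x) * B \<theta> x)"
proof -
  have "(LINT x|std_gauss. x *\<^sub>R (F1 (V \<theta> x) * W \<theta> x))
    = (LINT x|std_gauss. sin \<theta> * (F2 (V \<theta> x) * (W \<theta> x)\<^sup>2 + F1 (V \<theta> x) * B \<theta> x))"
  proof (rule gaussian_integration_by_parts)
    show "((\<lambda>x. F1 (V \<theta> x) * W \<theta> x) has_vector_derivative
      sin \<theta> * (F2 (V \<theta> x) * (W \<theta> x)\<^sup>2 + F1 (V \<theta> x) * B \<theta> x)) (at x)" for x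
      unfolding has_real_derivative_iff_has_vector_derivative[symmetric]
      using F_V_deriv_x W_deriv_x
      by (auto intro!: derivative_eq_intros simp: algebra_simps power2_eq_square)
    show "isCont (\<lambda>x. sin \<theta> * (F2 (V \<theta> x) * (W \<theta> x)\<^sup>2 + F1 (V \<theta> x) * B \<theta> x)) x" for x
      by (intro continuous_intros fixed_theta_isCont)
    show "tame (\<lambda>x. \<bar>x\<bar>) (\<lambda>x. F1 (V \<theta> x) * W \<theta> x)"
      "tame (\<lambda>x. \<bar>x\<bar>) (\<lambda>x. sin \<theta> * (F2 (V \<theta> x) * (W \<theta> x)\<^sup>2 + F1 (V \<theta> x) * B \<theta> x))"
      by (intro tame_mult tame_add tame_power tame_const fixed_theta_tame; simp)+
  qed
  then show ?thesis by simp
qed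

text \<open>The term of \<open>V_deriv_theta\<close> that is linear in \<open>x\<close> is removed by integration by parts in \<open>x\<close>. In the difference
\<open>B - A\<close> only Hessian terms survive.\<close>
lemma J_deriv:
  "(J has_real_derivative sin \<theta> * cos \<theta> *
     (LINT x|std_gauss. F2 (V \<theta> x) * (W \<theta> x)\<^sup>2 + F1 (V \<theta> x) * (B \<theta> x - A \<theta> x))) (at \<theta>)"
proof -
  let ?g' = "\<lambda>\<theta> x. F1 (V \<theta> x) * (cos \<theta> * x * W \<theta> x - sin \<theta> * cos \<theta> * A \<theta> x)"
  have tr: "tame (\<lambda>(\<theta>, x). \<bar>x\<bar>) (\<lambda>(\<theta>, x). f \<theta>)" if "\<And>\<theta>. \<bar>f \<theta>\<bar> \<le> 1" for f :: "real \<Rightarrow> real"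
    by (rule tame_norm_le[OF tame_const[of _ "1::real"]]) (use that in \<open>auto simp: split_beta'\<close>)
  have x: "tame (\<lambda>(\<theta>::real, x::real). \<bar>x\<bar>) (\<lambda>(\<theta>, x). x)"
    by (rule tame_norm_le[OF tame_size]) auto
  have d: "((\<lambda>\<theta>. LINT x|std_gauss. (case (\<theta>, x) of (\<theta>, x) \<Rightarrow> F0 (V \<theta> x))) has_real_derivative
      (LINT x|std_gauss. (case (\<theta>, x) of (\<theta>, x) \<Rightarrow> ?g' \<theta> x))) (at \<theta>)"
  proof (rule has_real_derivative_integral[OF integrates_tame_std_gauss])
    show "tame (\<lambda>(t, q). \<bar>t\<bar> + \<bar>q\<bar>) (\<lambda>(\<theta>, x). F0 (V \<theta> x))"
      by (intro tame_x_weaken F_V_tame)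
    show "tame (\<lambda>(t, q). \<bar>t\<bar> + \<bar>q\<bar>) (\<lambda>(\<theta>, x). ?g' \<theta> x)"
      by (intro tame_x_weaken)
        (use F_V_tame(2) W_tame A_tame tr[of sin] tr[of cos] x in
          \<open>auto intro!: tame_mult tame_diff simp: split_beta'\<close>)
    show "((\<lambda>t. case (t, q) of (\<theta>, x) \<Rightarrow> F0 (V \<theta> x)) has_real_derivative (case (t, q) of (\<theta>, x) \<Rightarrow> ?g' \<theta> x)) (at t)" for t q
      using DERIV_chain2[OF F0_deriv[OF V_ge] V_deriv_theta] by simp
  qed (simp_all, measurable)
  have "(LINT x|std_gauss. ?g' \<theta> x) = sin \<theta> * cos \<theta> *
     (LINT x|std_gauss. F2 (V \<theta> x) * (W \<theta> x)\<^sup>2 + F1 (V \<theta> x) * (B \<theta> x - A \<theta> x))"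
  proof -
    have i: "integrable std_gauss (\<lambda>x. x * (F1 (V \<theta> x) * W \<theta> x))" "integrable std_gauss (\<lambda>x. F1 (V \<theta> x) * A \<theta> x)"
      "integrable std_gauss (\<lambda>x. F1 (V \<theta> x) * B \<theta> x)" "integrable std_gauss (\<lambda>x. F2 (V \<theta> x) * (W \<theta> x)\<^sup>2)"
      by (rule integrates_tame_integrable[OF integrates_tame_std_gauss], intro tame_mult tame_power fixed_theta_tame tame_id, measurable)+
    have "(LINT x|std_gauss. ?g' \<theta> x) = (LINT x|std_gauss. cos \<theta> * (x * (F1 (V \<theta> x) * W \<theta> x)) - sin \<theta> * cos \<theta> * (F1 (V \<theta> x) * A \<theta> x))"
      by (simp add: algebra_simps)
    also have "\<dots> = cos \<theta> * (LINT x|std_gauss. x * (F1 (V \<theta> x) * W \<theta> x)) - sin \<theta> * cos \<theta> * (LINT x|std_gauss. F1 (V \<theta> x) * A \<theta> x)"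
      using i by simp
    also have "\<dots> = sin \<theta> * cos \<theta> * ((LINT x|std_gauss. F2 (V \<theta> x) * (W \<theta> x)\<^sup>2 + F1 (V \<theta> x) * B \<theta> x) - (LINT x|std_gauss. F1 (V \<theta> x) * A \<theta> x))"
      unfolding outer_integration_by_parts by (simp add: algebra_simps)
    also have "\<dots> = sin \<theta> * cos \<theta> *
     (LINT x|std_gauss. F2 (V \<theta> x) * (W \<theta> x)\<^sup>2 + F1 (V \<theta> x) * (B \<theta> x - A \<theta> x))"
      using i by (simp add: algebra_simps)
    finally show ?thesis .
  qed
  with d show ?thesis unfolding J_def by simp
qed

text \<open>This is Jensen's inequality for the jointly convex function \<open>g\<^sup>2 F2(h)/F1(h)\<close>, written out through its
supporting affine function at the mean values: \<open>g\<^sup>2/s \<ge> 2 l g - l\<^sup>2 s\<close> for \<open>s = F1(h)/F2(h)\<close>, and \<open>s\<close> lies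
below its supergradient line at \<open>h = V\<close>, which integrates to the value of \<open>F1/F2\<close> at \<open>V\<close>.\<close>
lemma dissipation: "F2 (V \<theta> x) * (W \<theta> x)\<^sup>2 + F1 (V \<theta> x) * (B \<theta> x - A \<theta> x) \<le> 0"
proof -
  let ?F1 = "F1 (V \<theta> x)" and ?F2 = "F2 (V \<theta> x)"
  have pos: "0 < ?F1" "0 < ?F2" using F1_pos F2_pos V_ge by auto
  obtain m where m: "\<And>h. v0 \<le> h \<Longrightarrow> F1 h / F2 h \<le> ?F1 / ?F2 + m * (h - V \<theta> x)"
    using supergradient[OF V_ge[of \<theta> x]] by blast
  \<comment> \<open>The slope of \<open>g\<^sup>2 F2/F1\<close> in \<open>g\<close>, halved, at the mean values \<open>(W, V)\<close>.\<close>
  define l where "l = W \<theta> x * ?F2 / ?F1"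
  have pt: "hp (phi 0 \<theta> x q) (z * phi 1 \<theta> x q) (z * phi 1 \<theta> x q) - hp (phi 0 \<theta> x q) (phi 1 \<theta> x q) (phi 1 \<theta> x q)
      \<le> - 2 * l * dp (phi 0 \<theta> x q) (z * phi 1 \<theta> x q) + l\<^sup>2 * (?F1 / ?F2 + m * (pp (phi 0 \<theta> x q) - V \<theta> x))" for q
  proof -
    define h where "h = pp (phi 0 \<theta> x q)"
    define g where "g = dp (phi 0 \<theta> x q) (z * phi 1 \<theta> x q)"
    have hp: "v0 \<le> h" "0 < F1 h" "0 < F2 h" using pp_ge F1_pos F2_pos by (auto simp: h_def)
    have "0 \<le> (g * F2 h - l * F1 h)\<^sup>2 / (F1 h * F2 h)" using hp by simp
    also have "\<dots> = g\<^sup>2 * (F2 h / F1 h) - 2 * l * g + l\<^sup>2 * (F1 h / F2 h)"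
      using hp by (simp add: power2_eq_square field_simps)
    also have "l\<^sup>2 * (F1 h / F2 h) \<le> l\<^sup>2 * (?F1 / ?F2 + m * (h - V \<theta> x))"
      by (intro mult_left_mono m hp) auto
    finally have "0 \<le> g\<^sup>2 * (F2 h / F1 h) - 2 * l * g + l\<^sup>2 * (?F1 / ?F2 + m * (h - V \<theta> x))" by simp
    then show ?thesis using hp_key[of "phi 0 \<theta> x q" "phi 1 \<theta> x q"] unfolding h_def g_def by linarith
  qed
  have ip: "integrable M (\<lambda>q. pp (phi 0 \<theta> x q))" by (rule integrable_M[OF integrands_tame(1)]) measurable
  have "B \<theta> x - A \<theta> x = (LINT q|M. hp (phi 0 \<theta> x q) (z * phi 1 \<theta> x q) (z * phi 1 \<theta> x q) - hp (phi 0 \<theta> x q) (phi 1 \<theta> x q) (phi 1 \<theta> x q))"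
    unfolding A_def B_def using integrands_integrable by simp
  also have "\<dots> \<le> (LINT q|M. - 2 * l * dp (phi 0 \<theta> x q) (z * phi 1 \<theta> x q) + l\<^sup>2 * (?F1 / ?F2 + m * (pp (phi 0 \<theta> x q) - V \<theta> x)))"
    by (intro integral_mono pt Bochner_Integration.integrable_diff Bochner_Integration.integrable_add
       integrable_mult_right integrands_integrable ip M.integrable_const)
  also have "\<dots> = - 2 * l * W \<theta> x + l\<^sup>2 * (?F1 / ?F2 + m * (V \<theta> x - V \<theta> x))"
    using integrands_integrable(1)[of \<theta> x z 1] ip unfolding W_def V_def[of \<theta> x]
    by (simp add: M.prob_space)
  also have "\<dots> = - (W \<theta> x)\<^sup>2 * ?F2 / ?F1" using pos by (simp add: l_def power2_eq_square field_simps)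
  finally have "?F1 * (B \<theta> x - A \<theta> x) \<le> ?F1 * (- (W \<theta> x)\<^sup>2 * ?F2 / ?F1)"
    using pos by (intro mult_left_mono) auto
  then show ?thesis using pos by (simp add: field_simps)
qed

lemma J_antimono: "J (pi / 2) \<le> J 0"
proof (rule DERIV_nonpos_imp_nonincreasing[where f = J])
  fix \<theta> :: real assume "0 \<le> \<theta>" "\<theta> \<le> pi / 2"
  then have "0 \<le> sin \<theta> * cos \<theta>" by (intro mult_nonneg_nonneg sin_ge_zero cos_ge_zero) auto
  moreover have "(LINT x|std_gauss. F2 (V \<theta> x) * (W \<theta> x)\<^sup>2 + F1 (V \<theta> x) * (B \<theta> x - A \<theta> x)) \<le> 0"
    using Bochner_Integration.integral_nonneg[of std_gauss "\<lambda>x. - (F2 (V \<theta> x) * (W \<theta> x)\<^sup>2 + F1 (V \<theta> x) * (B \<theta> x - A \<theta> x))"] dissipation[of \<theta>]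
    by (simp del: minus_add_distrib)
  ultimately show "\<exists>y. (J has_real_derivative y) (at \<theta>) \<and> y \<le> 0"
    using J_deriv[of \<theta>] by (meson mult_nonneg_nonpos)
qed simp

lemma V_pi_half:
  "V (pi / 2) x = (LINT \<omega>|N. pp (\<Sum>n\<le>d. a n \<omega> * z ^ n * heat_hermite n (of_real x) 1))"
proof -
  have phi: "phi 0 (pi / 2) x q = (\<Sum>n\<le>d. a n (snd q) * z ^ n * heat_hermite n (of_real x) 1)" for q
    using heat_hermite_scale[of _ z "of_real x" 1] by (simp add: phi_def series_def mult.assoc)
  have "integrable M (\<lambda>q. pp (phi 0 (pi / 2) x q))" by (rule integrable_M[OF integrands_tame(1)]) measurable
  then show ?thesis
    unfolding V_def phi M_def
    using GN.integral_snd[of "\<lambda>y \<omega>. pp (\<Sum>n\<le>d. a n \<omega> * z ^ n * heat_hermite n (of_real x) 1)"] G.prob_space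
    by (simp add: split_beta')
qed

lemma flow_integrable:
  "integrable std_gauss (\<lambda>x. F0 (LINT \<omega>|N. pp (\<Sum>n\<le>d. a n \<omega> * z ^ n * heat_hermite n (of_real x) 1)))"
  unfolding V_pi_half[symmetric]
  by (rule integrates_tame_integrable[OF integrates_tame_std_gauss], intro fixed_theta_tame, measurable)

text \<open>The comparison of the two ends of the interpolation. At \<open>\<theta> = 0\<close> the integrand does not depend on \<open>x\<close>, at
\<open>\<theta> = \<pi>/2\<close> it does not depend on \<open>y\<close>.\<close>
lemma flow_inequality:
  "(LINT x|std_gauss. F0 (LINT \<omega>|N. pp (\<Sum>n\<le>d. a n \<omega> * z ^ n * heat_hermite n (of_real x) 1)))
    \<le> F0 (LINT (y, \<omega>)|(std_gauss \<Otimes>\<^sub>M N). pp (\<Sum>n\<le>d. a n \<omega> * heat_hermite n (of_real y) 1))"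
proof -
  have phi: "phi 0 0 x q = (\<Sum>n\<le>d. a n (snd q) * heat_hermite n (of_real (fst q)) 1)" for x q
    by (simp add: phi_def series_def)
  have "J 0 = (LINT x|std_gauss. F0 (LINT (y, \<omega>)|(std_gauss \<Otimes>\<^sub>M N). pp (\<Sum>n\<le>d. a n \<omega> * heat_hermite n (of_real y) 1)))"
    unfolding J_def V_def phi M_def by (simp add: split_beta')
  then have "J 0 = F0 (LINT (y, \<omega>)|(std_gauss \<Otimes>\<^sub>M N). pp (\<Sum>n\<le>d. a n \<omega> * heat_hermite n (of_real y) 1))"
    using G.prob_space by simp
  then show ?thesis using J_antimono unfolding J_def V_pi_half by simp
qed

end

section \<open>Passing to several coordinates\<close>

abbreviation gauss_prod :: "'i set \<Rightarrow> ('i \<Rightarrow> real) measure" where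
  "gauss_prod I \<equiv> Pi\<^sub>M I (\<lambda>_. std_gauss)"

abbreviation hermite_prod :: "'i set \<Rightarrow> ('i \<Rightarrow> nat) \<Rightarrow> ('i \<Rightarrow> real) \<Rightarrow> complex" where
  "hermite_prod I \<alpha> x \<equiv> (\<Prod>i\<in>I. heat_hermite (\<alpha> i) (of_real (x i)) 1)"

lemma prob_space_gauss_prod: "prob_space (gauss_prod I)"
  by (intro prob_space_PiM prob_space_std_gauss)

lemma hermite_prod_tame:
  assumes "finite I"
  shows "tame (\<lambda>x. \<Sum>i\<in>I. \<bar>x i\<bar>) (hermite_prod I \<alpha>)"
proof (rule tame_prod)
  fix i assume i: "i \<in> I"
  have "tame (\<lambda>x. \<Sum>i\<in>I. \<bar>x i\<bar>) (\<lambda>x. x i)"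
    using i assms by (intro tame_norm_le[OF tame_size])
      (auto intro!: sum_nonneg member_le_sum simp: abs_of_nonneg[OF sum_nonneg])
  then show "tame (\<lambda>x. \<Sum>i\<in>I. \<bar>x i\<bar>) (\<lambda>x. heat_hermite (\<alpha> i) (of_real (x i)) 1)"
    by (intro tame_heat_hermite tame_of_real tame_const) (auto intro: sum_nonneg)
qed (auto intro: sum_nonneg)

lemma hermite_prod_measurable [measurable]: "hermite_prod I \<alpha> \<in> borel_measurable (gauss_prod I)"
  by measurable

lemma integral_gauss_prod_insert:
  fixes g :: "('i \<Rightarrow> real) \<Rightarrow> real"
  assumes I: "finite I" "i \<notin> I" and g: "g \<in> borel_measurable (gauss_prod (insert i I))"
    and t: "tame (\<lambda>x. \<Sum>j\<in>insert i I. \<bar>x j\<bar>) g"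
  shows "integrable (std_gauss \<Otimes>\<^sub>M gauss_prod I) (\<lambda>(y, x). g (x(i := y)))"
    and "(LINT x|gauss_prod (insert i I). g x) = (LINT (y, x)|(std_gauss \<Otimes>\<^sub>M gauss_prod I). g (x(i := y)))"
    and "(LINT x|gauss_prod (insert i I). g x) = (LINT y|std_gauss. LINT x|gauss_prod I. g (x(i := y)))"
proof -
  interpret P: product_prob_space "\<lambda>_. std_gauss" by (rule product_prob_space_std_gauss)
  interpret GP: pair_prob_space std_gauss "gauss_prod I"
    by (intro pair_prob_space.intro pair_sigma_finite.intro prob_space_imp_sigma_finite prob_space_std_gauss prob_space_gauss_prod)
  have m: "(\<lambda>(y, x). g (x(i := y))) \<in> borel_measurable (std_gauss \<Otimes>\<^sub>M gauss_prod I)"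
  proof -
    have "(\<lambda>(y, x). x(i := y)) \<in> std_gauss \<Otimes>\<^sub>M gauss_prod I \<rightarrow>\<^sub>M gauss_prod (insert i I)"
      unfolding split_beta' by (rule measurable_fun_upd[where J = I]) auto
    from measurable_compose[OF this g] show ?thesis by (simp add: split_beta')
  qed
  have "tame (\<lambda>(y, x). \<bar>y\<bar> + (\<Sum>j\<in>I. \<bar>x j\<bar>)) (\<lambda>u. g ((snd u)(i := fst u)))"
  proof (rule tame_reindex[OF t, where K = 0])
    fix u :: "real \<times> ('i \<Rightarrow> real)"
    have "(\<Sum>j\<in>I. \<bar>((snd u)(i := fst u)) j\<bar>) = (\<Sum>j\<in>I. \<bar>snd u j\<bar>)"
      using I by (intro sum.cong) auto
    then show "(\<Sum>j\<in>insert i I. \<bar>((snd u)(i := fst u)) j\<bar>) \<le> 0 + (case u of (y, x) \<Rightarrow> \<bar>y\<bar> + (\<Sum>j\<in>I. \<bar>x j\<bar>))"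
      using I by (simp add: split_beta')
    show "0 \<le> (case u of (y, x) \<Rightarrow> \<bar>y\<bar> + (\<Sum>j\<in>I. \<bar>x j\<bar>))" by (auto intro!: add_nonneg_nonneg sum_nonneg simp: split_beta')
  qed
  then show i: "integrable (std_gauss \<Otimes>\<^sub>M gauss_prod I) (\<lambda>(y, x). g (x(i := y)))"
    using m by (intro integrates_tame_integrable[OF integrates_tame_pair[OF integrates_tame_std_gauss integrates_tame_PiM_std_gauss[OF I(1)]]])
      (auto intro!: prob_space_imp_sigma_finite prob_space_std_gauss prob_space_gauss_prod simp: split_beta')
  have "integrable (gauss_prod (insert i I)) g"
    using I by (intro integrates_tame_integrable[OF integrates_tame_PiM_std_gauss] t g) auto
  from P.product_integral_insert[OF I this]
  have "(LINT x|gauss_prod (insert i I). g x) = (LINT x|gauss_prod I. LINT y|std_gauss. g (x(i := y)))" .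
  also have "\<dots> = (LINT (y, x)|(std_gauss \<Otimes>\<^sub>M gauss_prod I). g (x(i := y)))"
    using GP.integral_snd[of "\<lambda>y x. g (x(i := y))"] i by simp
  finally show *: "(LINT x|gauss_prod (insert i I). g x) = (LINT (y, x)|(std_gauss \<Otimes>\<^sub>M gauss_prod I). g (x(i := y)))" .
  show "(LINT x|gauss_prod (insert i I). g x) = (LINT y|std_gauss. LINT x|gauss_prod I. g (x(i := y)))"
    unfolding * using GP.integral_fst[of "\<lambda>y x. g (x(i := y))"] i by simp
qed

context hypercontractive_pair
begin

lemma F0_measurable:
  assumes "f \<in> borel_measurable N" "\<And>u. v0 \<le> f u"
  shows "(\<lambda>u. F0 (f u)) \<in> borel_measurable N"
proof -
  have "continuous_on {v0..} F0"
    using F0_deriv by (auto intro!: continuous_at_imp_continuous_on DERIV_isCont)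
  then have "continuous_on UNIV (\<lambda>t. F0 (max v0 t))"
    by (rule continuous_on_compose2) (auto intro!: continuous_intros)
  from measurable_compose[OF assms(1) borel_measurable_continuous_onI[OF this]] show ?thesis
    using assms(2) by (simp add: max_absorb2)
qed

text \<open>Fix the new coordinate \<open>y\<close>: the induction hypothesis moves \<open>F0\<close> across the integral over the old coordinates.
Then \<open>flow_inequality\<close> moves it across the integral over \<open>y\<close>, with the old coordinates as the space \<open>N\<close>.\<close>
lemma tensorization:
  fixes c :: "('i \<Rightarrow> nat) \<Rightarrow> complex"
  assumes "finite I" "finite S"
  shows "(LINT x|gauss_prod I. F0 (pp (\<Sum>\<alpha>\<in>S. c \<alpha> * (\<Prod>i\<in>I. z ^ \<alpha> i) * hermite_prod I \<alpha> x)))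
    \<le> F0 (LINT x|gauss_prod I. pp (\<Sum>\<alpha>\<in>S. c \<alpha> * hermite_prod I \<alpha> x))"
  using assms(1)
proof (induction I arbitrary: c rule: finite_induct)
  case empty
  interpret prob_space "gauss_prod {} :: ('i \<Rightarrow> real) measure" by (rule prob_space_gauss_prod)
  show ?case using prob_space by simp
next
  case (insert i I)
  \<comment> \<open>Grouping the multiindices by their i-th entry gives a polynomial in the new coordinate alone.\<close>
  define d where "d = Max (insert 0 ((\<lambda>\<alpha>. \<alpha> i) ` S))"
  have d: "(\<lambda>\<alpha>. \<alpha> i) ` S \<subseteq> {..d}" using assms(2) by (auto simp: d_def intro!: Max_ge)
  define a where "a n x = (\<Sum>\<alpha> | \<alpha> \<in> S \<and> \<alpha> i = n. c \<alpha> * hermite_prod I \<alpha> x)" for n x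
  let ?r = "\<lambda>x. \<Sum>j\<in>I. \<bar>x j\<bar>"
  interpret flow: gaussian_flow p0 p1 p2 F0 F1 F2 v0 z "gauss_prod I" ?r d a
  proof (intro gaussian_flow.intro gaussian_flow_axioms.intro)
    show "hypercontractive_pair p0 p1 p2 F0 F1 F2 v0 z" by (rule hypercontractive_pair_axioms)
    show "prob_space (gauss_prod I)" by (rule prob_space_gauss_prod)
    show "integrates_tame (gauss_prod I) ?r" using insert by (intro integrates_tame_PiM_std_gauss)
    show "a n \<in> borel_measurable (gauss_prod I)" for n unfolding a_def by measurable
    show "tame ?r (a n)" for n unfolding a_def using insert.hyps
      by (intro tame_sum tame_mult tame_const hermite_prod_tame) (auto intro: sum_nonneg)
  qed
  have split: "hermite_prod (insert i I) \<alpha> (x(i := y)) = heat_hermite (\<alpha> i) (of_real y) 1 * hermite_prod I \<alpha> x" for \<alpha> x y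
  proof -
    have "hermite_prod I \<alpha> (x(i := y)) = hermite_prod I \<alpha> x" using insert.hyps by (intro prod.cong) auto
    then show ?thesis using insert.hyps by simp
  qed
  have group: "(\<Sum>n\<le>d. a n x * w n) = (\<Sum>\<alpha>\<in>S. c \<alpha> * w (\<alpha> i) * hermite_prod I \<alpha> x)" for w x
  proof -
    have "(\<Sum>n\<le>d. a n x * w n) = (\<Sum>n\<le>d. \<Sum>\<alpha> | \<alpha> \<in> S \<and> \<alpha> i = n. c \<alpha> * w (\<alpha> i) * hermite_prod I \<alpha> x)"
      unfolding a_def sum_distrib_right by (intro sum.cong) (auto simp: mult_ac)
    also have "\<dots> = (\<Sum>\<alpha>\<in>S. c \<alpha> * w (\<alpha> i) * hermite_prod I \<alpha> x)"
      using assms(2) d by (intro sum.group) auto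
    finally show ?thesis .
  qed
  let ?L = "\<lambda>x. F0 (pp (\<Sum>\<alpha>\<in>S. c \<alpha> * (\<Prod>i\<in>insert i I. z ^ \<alpha> i) * hermite_prod (insert i I) \<alpha> x))"
  let ?R = "\<lambda>x. pp (\<Sum>\<alpha>\<in>S. c \<alpha> * hermite_prod (insert i I) \<alpha> x)"
  have fin: "finite (insert i I)" using insert.hyps by simp
  have Lt: "tame (\<lambda>x. \<Sum>j\<in>insert i I. \<bar>x j\<bar>) ?L"
    by (intro tame_compose[OF _ F_slow(1)] pp_tame tame_sum tame_mult tame_const hermite_prod_tame[OF fin] sum_nonneg)
      (auto simp: pp_ge)
  have Lm: "?L \<in> borel_measurable (gauss_prod (insert i I))" by (rule F0_measurable) (auto simp: pp_ge)
  have Rt: "tame (\<lambda>x. \<Sum>j\<in>insert i I. \<bar>x j\<bar>) ?R"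
    by (intro pp_tame tame_sum tame_mult tame_const hermite_prod_tame[OF fin] sum_nonneg) auto
  have Rm: "?R \<in> borel_measurable (gauss_prod (insert i I))" by measurable
  let ?mid = "\<lambda>y. F0 (LINT x|gauss_prod I. pp (\<Sum>n\<le>d. a n x * z ^ n * heat_hermite n (of_real y) 1))"
  have "(LINT x|gauss_prod (insert i I). ?L x) = (LINT y|std_gauss. LINT x|gauss_prod I. ?L (x(i := y)))"
    by (rule integral_gauss_prod_insert(3)[OF insert.hyps(1,2) Lm Lt])
  also have "\<dots> \<le> (LINT y|std_gauss. ?mid y)"
  proof (rule integral_mono)
    show "integrable std_gauss (\<lambda>y. LINT x|gauss_prod I. ?L (x(i := y)))"
      using flow.GN.integrable_fst[OF integral_gauss_prod_insert(1)[OF insert.hyps(1,2) Lm Lt]] .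
    show "integrable std_gauss ?mid" by (rule flow.flow_integrable)
    fix y
    let ?c = "\<lambda>\<alpha>. c \<alpha> * (z ^ \<alpha> i * heat_hermite (\<alpha> i) (of_real y) 1)"
    have "?L (x(i := y)) = F0 (pp (\<Sum>\<alpha>\<in>S. ?c \<alpha> * (\<Prod>i\<in>I. z ^ \<alpha> i) * hermite_prod I \<alpha> x))" for x
      unfolding split using insert.hyps by (simp add: mult_ac)
    then have "(LINT x|gauss_prod I. ?L (x(i := y))) \<le> F0 (LINT x|gauss_prod I. pp (\<Sum>\<alpha>\<in>S. ?c \<alpha> * hermite_prod I \<alpha> x))"
      using insert.IH[of ?c] by simp
    moreover have "(\<Sum>\<alpha>\<in>S. ?c \<alpha> * hermite_prod I \<alpha> x) = (\<Sum>n\<le>d. a n x * z ^ n * heat_hermite n (of_real y) 1)" for x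
      using group[of x "\<lambda>n. z ^ n * heat_hermite n (of_real y) 1"] by (simp add: mult.assoc)
    ultimately show "(LINT x|gauss_prod I. ?L (x(i := y))) \<le> ?mid y" by (simp only:)
  qed
  also have "\<dots> \<le> F0 (LINT (y, x)|(std_gauss \<Otimes>\<^sub>M gauss_prod I). pp (\<Sum>n\<le>d. a n x * heat_hermite n (of_real y) 1))"
    by (rule flow.flow_inequality)
  also have "(LINT (y, x)|(std_gauss \<Otimes>\<^sub>M gauss_prod I). pp (\<Sum>n\<le>d. a n x * heat_hermite n (of_real y) 1))
    = (LINT x|gauss_prod (insert i I). ?R x)"
    unfolding integral_gauss_prod_insert(2)[OF insert.hyps(1,2) Rm Rt] split group
    by (simp add: mult.assoc)
  finally show ?case .
qed

end

lemma (in hypercontractive_pair) hermite_sum_integrable: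
  assumes "finite I"
  shows "integrable (gauss_prod I) (\<lambda>x. pp (\<Sum>\<alpha>\<in>S. c \<alpha> * hermite_prod I \<alpha> x))"
    and "integrable (gauss_prod I) (\<lambda>x. F0 (pp (\<Sum>\<alpha>\<in>S. c \<alpha> * hermite_prod I \<alpha> x)))"
proof -
  have t: "tame (\<lambda>x. \<Sum>i\<in>I. \<bar>x i\<bar>) (\<lambda>x. pp (\<Sum>\<alpha>\<in>S. c \<alpha> * hermite_prod I \<alpha> x))"
    by (intro pp_tame tame_sum tame_mult tame_const hermite_prod_tame[OF assms] sum_nonneg) auto
  then show "integrable (gauss_prod I) (\<lambda>x. pp (\<Sum>\<alpha>\<in>S. c \<alpha> * hermite_prod I \<alpha> x))"
    by (intro integrates_tame_integrable[OF integrates_tame_PiM_std_gauss[OF assms]]) measurable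
  have "tame (\<lambda>x. \<Sum>i\<in>I. \<bar>x i\<bar>) (\<lambda>x. F0 (pp (\<Sum>\<alpha>\<in>S. c \<alpha> * hermite_prod I \<alpha> x)))"
    by (rule tame_compose[OF t F_slow(1)]) (simp add: pp_ge)
  then show "integrable (gauss_prod I) (\<lambda>x. F0 (pp (\<Sum>\<alpha>\<in>S. c \<alpha> * hermite_prod I \<alpha> x)))"
    by (rule integrates_tame_integrable[OF integrates_tame_PiM_std_gauss[OF assms]]) (intro F0_measurable pp_ge, measurable)
qed

section \<open>The Gaussian measure and Hermite expansions\<close>

lemma vec_lambda_measurable:
  assumes "sets M = sets borel"
  shows "(\<lambda>x. \<chi> i. x i) \<in> Pi\<^sub>M UNIV (\<lambda>_. M :: real measure) \<rightarrow>\<^sub>M (borel :: (real ^ 'k) measure)"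
proof (subst borel_measurable_iff_halfspace_le, safe)
  note [measurable_cong] = assms
  fix i :: "real ^ 'k" and a :: real assume "i \<in> Basis"
  have "(\<lambda>x. x j * i $ j) \<in> borel_measurable (Pi\<^sub>M UNIV (\<lambda>_. M))" for j by measurable
  then have "(\<lambda>x. (\<chi> i. x i) \<bullet> i) \<in> borel_measurable (Pi\<^sub>M UNIV (\<lambda>_. M))"
    by (simp add: inner_vec_def)
  then show "{w \<in> space (Pi\<^sub>M UNIV (\<lambda>_. M)). (\<chi> i. w i) \<bullet> i \<le> a} \<in> sets (Pi\<^sub>M UNIV (\<lambda>_. M))"
    by measurable
qed

lemma lborel_vec_eq_distr_PiM:
  "(lborel :: (real ^ 'k) measure) = distr (Pi\<^sub>M UNIV (\<lambda>_. lborel)) borel (\<lambda>x. \<chi> i. x i)"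
proof (rule lborel_eqI)
  interpret product_sigma_finite "\<lambda>_::'k. lborel :: real measure" ..
  have vm: "(\<lambda>x. \<chi> i. x i) \<in> Pi\<^sub>M UNIV (\<lambda>_. lborel :: real measure) \<rightarrow>\<^sub>M (borel :: (real ^ 'k) measure)"
    by (rule vec_lambda_measurable) simp
  fix l u :: "real ^ 'k" assume lu: "\<And>b. b \<in> Basis \<Longrightarrow> l \<bullet> b \<le> u \<bullet> b"
  have le: "l $ i \<le> u $ i" for i using lu[of "axis i 1"] by (simp add: inner_axis axis_in_Basis_iff)
  have "(\<lambda>x. \<chi> i. x i) -` box l u \<inter> space (Pi\<^sub>M UNIV (\<lambda>_. lborel :: real measure)) = Pi\<^sub>E UNIV (\<lambda>i. {l $ i<..<u $ i})"
    by (auto simp: mem_box_cart space_PiM PiE_def Pi_def)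
  then have "emeasure (distr (Pi\<^sub>M UNIV (\<lambda>_. lborel)) borel (\<lambda>x. \<chi> i. x i)) (box l u) = (\<Prod>i\<in>UNIV. ennreal (u $ i - l $ i))"
    using vm le by (subst emeasure_distr) (auto simp: emeasure_PiM)
  also have "\<dots> = ennreal (\<Prod>i\<in>UNIV. u $ i - l $ i)" using le by (intro prod_ennreal) auto
  also have "(\<Prod>i\<in>UNIV. u $ i - l $ i) = (\<Prod>b\<in>Basis. (u - l) \<bullet> b)"
  proof -
    have "(\<Prod>b\<in>Basis. (u - l) \<bullet> b) = (\<Prod>b\<in>range (\<lambda>i. axis i 1 :: real ^ 'k). (u - l) \<bullet> b)"
      by (rule prod.cong) (auto simp: Basis_vec_def)
    also have "\<dots> = (\<Prod>i\<in>UNIV. (u - l) \<bullet> axis i 1)"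
      by (subst prod.reindex) (auto simp: inj_on_def axis_eq_axis)
    finally show ?thesis by (simp add: inner_axis)
  qed
  finally show "emeasure (distr (Pi\<^sub>M UNIV (\<lambda>_. lborel)) borel (\<lambda>x. \<chi> i. x i)) (box l u) = (\<Prod>b\<in>Basis. (u - l) \<bullet> b)" .
qed simp

lemma gauss_prod_eq_density:
  "gauss_prod (UNIV :: 'k::finite set) = density (Pi\<^sub>M UNIV (\<lambda>_. lborel)) (\<lambda>x. \<Prod>i\<in>UNIV. ennreal (std_normal_density (x i)))"
proof (rule sym)
  interpret product_prob_space "\<lambda>_. std_gauss" by (rule product_prob_space_std_gauss)
  interpret L: product_sigma_finite "\<lambda>_::'k. lborel :: real measure" ..
  have s: "sets (Pi\<^sub>M UNIV (\<lambda>_. lborel :: real measure)) = sets (gauss_prod (UNIV :: 'k set))"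
    by (intro sets_PiM_cong) auto
  show "density (Pi\<^sub>M UNIV (\<lambda>_. lborel)) (\<lambda>x. \<Prod>i\<in>UNIV. ennreal (std_normal_density (x i))) = gauss_prod (UNIV :: 'k set)"
  proof (rule PiM_eqI)
    fix A :: "'k \<Rightarrow> real set" assume A: "\<And>i. i \<in> UNIV \<Longrightarrow> A i \<in> sets std_gauss"
    then have [measurable]: "A i \<in> sets borel" for i by simp
    have AP: "Pi\<^sub>E UNIV A \<in> sets (Pi\<^sub>M UNIV (\<lambda>_. lborel :: real measure))" by (intro sets_PiM_I_finite) auto
    have "emeasure (density (Pi\<^sub>M UNIV (\<lambda>_. lborel)) (\<lambda>x. \<Prod>i\<in>UNIV. ennreal (std_normal_density (x i)))) (Pi\<^sub>E UNIV A)
      = (\<integral>\<^sup>+x. (\<Prod>i\<in>UNIV. ennreal (std_normal_density (x i))) * indicator (Pi\<^sub>E UNIV A) x \<partial>Pi\<^sub>M UNIV (\<lambda>_. lborel))"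
      using AP by (subst emeasure_density) auto
    also have "\<dots> = (\<integral>\<^sup>+x. (\<Prod>i\<in>UNIV. ennreal (std_normal_density (x i)) * indicator (A i) (x i)) \<partial>Pi\<^sub>M UNIV (\<lambda>_. lborel))"
    proof (intro nn_integral_cong)
      fix x :: "'k \<Rightarrow> real"
      have "indicator (Pi\<^sub>E UNIV A) x = (\<Prod>i\<in>UNIV. indicator (A i) (x i) :: ennreal)"
        by (auto simp: indicator_def PiE_def Pi_def prod_zero_iff)
      then show "(\<Prod>i\<in>UNIV. ennreal (std_normal_density (x i))) * indicator (Pi\<^sub>E UNIV A) x =
        (\<Prod>i\<in>UNIV. ennreal (std_normal_density (x i)) * indicator (A i) (x i))" by (simp add: prod.distrib)
    qed
    also have "\<dots> = (\<Prod>i\<in>UNIV. \<integral>\<^sup>+y. ennreal (std_normal_density y) * indicator (A i) y \<partial>lborel)"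
      by (intro L.product_nn_integral_prod) auto
    also have "\<dots> = (\<Prod>i\<in>UNIV. emeasure std_gauss (A i))"
      by (intro prod.cong refl) (simp add: emeasure_density)
    finally show "emeasure (density (Pi\<^sub>M UNIV (\<lambda>_. lborel)) (\<lambda>x. \<Prod>i\<in>UNIV. ennreal (std_normal_density (x i)))) (Pi\<^sub>E UNIV A)
      = (\<Prod>i\<in>UNIV. emeasure std_gauss (A i))" .
  qed (simp_all add: s)
qed

lemma gaussian_measure_eq_distr:
  "(gaussian_measure :: (real ^ 'k) measure) = distr (gauss_prod UNIV) borel (\<lambda>x. \<chi> i. x i)"
proof -
  let ?f = "\<lambda>x :: real ^ 'k. ennreal ((2 * pi) powr (- (real CARD('k) / 2)) * exp (- ((norm x)\<^sup>2 / 2)))"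
  have f: "?f (\<chi> i. x i) = (\<Prod>i\<in>UNIV. ennreal (std_normal_density (x i)))" for x :: "'k \<Rightarrow> real"
  proof -
    have n: "(norm (\<chi> i. x i :: real ^ 'k))\<^sup>2 = (\<Sum>i\<in>UNIV. (x i)\<^sup>2)"
      unfolding power2_norm_eq_inner inner_vec_def by (simp add: power2_eq_square)
    have p: "(2 * pi) powr (- (real CARD('k) / 2)) = (1 / sqrt (2 * pi)) ^ CARD('k)"
    proof -
      have "(2 * pi) powr (- (real CARD('k) / 2)) = ((2 * pi) powr (- 1 / 2)) powr real CARD('k)"
        by (simp add: powr_powr)
      also have "(2 * pi) powr (- 1 / 2) = 1 / sqrt (2 * pi)"
        by (simp add: powr_minus_divide powr_half_sqrt)
      finally show ?thesis by (simp add: powr_realpow)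
    qed
    have "(\<Prod>i\<in>UNIV. std_normal_density (x i)) = (1 / sqrt (2 * pi)) ^ CARD('k) * (\<Prod>i\<in>UNIV. exp (- (x i)\<^sup>2 / 2))"
      unfolding std_normal_density_def prod.distrib by (simp only: prod_constant)
    also have "(\<Prod>i\<in>UNIV. exp (- (x i)\<^sup>2 / 2)) = exp (- ((norm (\<chi> i. x i :: real ^ 'k))\<^sup>2 / 2))"
      unfolding n by (simp add: exp_sum[symmetric] sum_negf sum_divide_distrib)
    finally show ?thesis unfolding p by (simp add: prod_ennreal)
  qed
  have "gaussian_measure = density (distr (Pi\<^sub>M UNIV (\<lambda>_. lborel)) borel (\<lambda>x. \<chi> i. x i)) ?f"
    unfolding gaussian_measure_def lborel_vec_eq_distr_PiM[symmetric] ..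
  also have "\<dots> = distr (density (Pi\<^sub>M UNIV (\<lambda>_. lborel)) (\<lambda>x. ?f (\<chi> i. x i))) borel (\<lambda>x. \<chi> i. x i)"
    by (intro density_distr vec_lambda_measurable) auto
  finally show ?thesis unfolding f gauss_prod_eq_density .
qed

lemma integral_gaussian_measure:
  fixes g :: "real ^ 'k \<Rightarrow> 'b::{banach, second_countable_topology}"
  assumes "g \<in> borel_measurable borel"
  shows "(LINT x|gaussian_measure. g x) = (LINT x|gauss_prod UNIV. g (\<chi> i. x i))"
  unfolding gaussian_measure_eq_distr
  by (rule integral_distr) (use assms in \<open>auto intro!: vec_lambda_measurable\<close>)

text \<open>Integration by parts applied to \<open>y (w + i y)\<^sup>n\<close> gives the recursion that defines \<open>heat_hermite\<close>.\<close>
lemma gaussian_shift_moment: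
  "integrable std_gauss (\<lambda>y. (w + \<i> * of_real y) ^ n)"
  "(LINT y|std_gauss. (w + \<i> * of_real y) ^ n) = heat_hermite n w 1"
proof -
  have t: "tame (\<lambda>y. \<bar>y\<bar>) (\<lambda>y. (w + \<i> * of_real y) ^ n)" for n
    by (intro tame_power tame_add tame_mult tame_const tame_of_real tame_id) auto
  have i: "integrable std_gauss (\<lambda>y. (w + \<i> * of_real y) ^ n)" for n
    by (intro integrates_tame_integrable[OF integrates_tame_std_gauss] t) measurable
  then show "integrable std_gauss (\<lambda>y. (w + \<i> * of_real y) ^ n)" .
  have i2: "integrable std_gauss (\<lambda>y. y *\<^sub>R (w + \<i> * of_real y) ^ n)" for n
    by (intro integrates_tame_integrable[OF integrates_tame_std_gauss] tame_scaleR t tame_id) measurable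
  have rec: "(LINT y|std_gauss. (w + \<i> * of_real y) ^ Suc n)
     = w * (LINT y|std_gauss. (w + \<i> * of_real y) ^ n) - of_nat n * (LINT y|std_gauss. (w + \<i> * of_real y) ^ (n - 1))" for n
  proof -
    have "(LINT y|std_gauss. y *\<^sub>R (w + \<i> * of_real y) ^ n) = (LINT y|std_gauss. of_nat n * \<i> * (w + \<i> * of_real y) ^ (n - 1))"
    proof (rule gaussian_integration_by_parts)
      fix y
      have 1: "((\<lambda>y. w + \<i> * of_real y) has_vector_derivative \<i>) (at y)"
        by (auto intro!: derivative_eq_intros)
      have 2: "((\<lambda>u :: complex. u ^ n) has_field_derivative of_nat n * (w + \<i> * of_real y) ^ (n - 1)) (at (w + \<i> * of_real y))"
        by (auto intro!: derivative_eq_intros)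
      show "((\<lambda>y. (w + \<i> * of_real y) ^ n) has_vector_derivative of_nat n * \<i> * (w + \<i> * of_real y) ^ (n - 1)) (at y)"
        using field_vector_diff_chain_at[OF 1 2] by (simp add: o_def mult_ac)
      show "tame (\<lambda>x. \<bar>x\<bar>) (\<lambda>y. of_nat n * \<i> * (w + \<i> * of_real y) ^ (n - 1))"
        by (intro tame_mult tame_const t) auto
    qed (auto intro!: t continuous_intros)
    then have "\<i> * (LINT y|std_gauss. y *\<^sub>R (w + \<i> * of_real y) ^ n) = - of_nat n * (LINT y|std_gauss. (w + \<i> * of_real y) ^ (n - 1))"
      by (simp add: mult.assoc mult.left_commute[of "of_nat n" \<i>])
    then have "(LINT y|std_gauss. \<i> * (y *\<^sub>R (w + \<i> * of_real y) ^ n)) = - of_nat n * (LINT y|std_gauss. (w + \<i> * of_real y) ^ (n - 1))"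
      by (simp only: integral_mult_right_zero)
    moreover have "(LINT y|std_gauss. (w + \<i> * of_real y) ^ Suc n)
       = (LINT y|std_gauss. w * (w + \<i> * of_real y) ^ n + \<i> * (y *\<^sub>R (w + \<i> * of_real y) ^ n))"
      by (intro Bochner_Integration.integral_cong) (auto simp: algebra_simps scaleR_conv_of_real)
    moreover have "(LINT y|std_gauss. w * (w + \<i> * of_real y) ^ n + \<i> * (y *\<^sub>R (w + \<i> * of_real y) ^ n))
       = w * (LINT y|std_gauss. (w + \<i> * of_real y) ^ n) + (LINT y|std_gauss. \<i> * (y *\<^sub>R (w + \<i> * of_real y) ^ n))"
      using i i2 by (subst Bochner_Integration.integral_add) (auto simp del: mult_scaleR_right)
    ultimately show ?thesis by simp
  qed
  interpret prob_space std_gauss by (rule prob_space_std_gauss)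
  show "(LINT y|std_gauss. (w + \<i> * of_real y) ^ n) = heat_hermite n w 1"
  proof (induction n rule: less_induct)
    case (less n)
    show ?case
    proof (cases n)
      case 0
      then show ?thesis using prob_space by simp
    next
      case (Suc m)
      then show ?thesis using rec[of m] less[of m] less[of "m - 1"] prob_space
        by (cases m) (auto simp: heat_hermite_Suc)
    qed
  qed
qed

lemma hermite_eq_prod: "hermite \<alpha> x = (\<Prod>i\<in>UNIV. heat_hermite (\<alpha> i) (of_real (x $ i)) 1)"
proof -
  interpret product_prob_space "\<lambda>_. std_gauss" by (rule product_prob_space_std_gauss)
  have "hermite \<alpha> x = (LINT y|gauss_prod UNIV. (\<Prod>i\<in>UNIV. (of_real (x $ i) + \<i> * of_real (y i)) ^ \<alpha> i))"
    unfolding hermite_def multi_power_def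
    by (subst integral_gaussian_measure) (auto simp: split_beta')
  also have "\<dots> = (\<Prod>i\<in>UNIV. heat_hermite (\<alpha> i) (of_real (x $ i)) 1)"
    by (subst product_integral_prod) (auto simp: gaussian_shift_moment)
  finally show ?thesis .
qed

lemma heat_hermite_x_tame: "tame (\<lambda>x. \<bar>x\<bar>) (\<lambda>x. heat_hermite n (of_real x) 1)"
  by (intro tame_heat_hermite tame_of_real tame_id tame_const) auto

lemma heat_hermite_x_deriv:
  "((\<lambda>x. heat_hermite n (of_real x) 1) has_vector_derivative of_nat n * heat_hermite (n - 1) (of_real x) 1) (at x)"
  using heat_hermite_has_vector_derivative[OF has_vector_derivative_of_real[OF DERIV_ident] has_vector_derivative_const, of n 1 x]
  by simp

lemma heat_hermite_x_isCont: "isCont (\<lambda>x. heat_hermite n (of_real x) 1) x"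
  using heat_hermite_x_deriv has_vector_derivative_continuous by blast

text \<open>The recursion says that multiplication by \<open>x\<close> minus differentiation raises the index; integration by parts
moves this operator to the other factor, where it is plain differentiation.\<close>
lemma heat_hermite_shift:
  "(LINT x|std_gauss. heat_hermite (Suc m) (of_real x) 1 * heat_hermite n (of_real x) 1)
    = of_nat n * (LINT x|std_gauss. heat_hermite m (of_real x) 1 * heat_hermite (n - 1) (of_real x) 1)"
proof -
  let ?h = "\<lambda>n x. heat_hermite n (of_real x) 1"
  have i: "integrable std_gauss (\<lambda>x. ?h k x * ?h l x)" for k l
    by (intro integrates_tame_integrable[OF integrates_tame_std_gauss] tame_mult heat_hermite_x_tame) measurable
  have i2: "integrable std_gauss (\<lambda>x. x *\<^sub>R (?h k x * ?h l x))" for k l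
    by (intro integrates_tame_integrable[OF integrates_tame_std_gauss] tame_mult tame_scaleR tame_id heat_hermite_x_tame) measurable
  have "(LINT x|std_gauss. x *\<^sub>R (?h m x * ?h n x))
     = (LINT x|std_gauss. ?h m x * (of_nat n * ?h (n - 1) x) + of_nat m * ?h (m - 1) x * ?h n x)"
    by (rule gaussian_integration_by_parts)
      (auto intro!: has_vector_derivative_mult heat_hermite_x_deriv continuous_intros heat_hermite_x_isCont
        tame_mult tame_add tame_const heat_hermite_x_tame simp del: One_nat_def)
  also have "\<dots> = of_nat n * (LINT x|std_gauss. ?h m x * ?h (n - 1) x) + of_nat m * (LINT x|std_gauss. ?h (m - 1) x * ?h n x)"
    using i[of m "n - 1"] i[of "m - 1" n] by (simp add: mult.assoc mult.left_commute[of _ "of_nat n"])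
  finally have 1: "(LINT x|std_gauss. x *\<^sub>R (?h m x * ?h n x)) = \<dots>" .
  have "(LINT x|std_gauss. ?h (Suc m) x * ?h n x)
      = (LINT x|std_gauss. x *\<^sub>R (?h m x * ?h n x) - of_nat m * (?h (m - 1) x * ?h n x))"
    unfolding heat_hermite_Suc by (simp add: algebra_simps scaleR_conv_of_real)
  also have "\<dots> = (LINT x|std_gauss. x *\<^sub>R (?h m x * ?h n x)) - of_nat m * (LINT x|std_gauss. ?h (m - 1) x * ?h n x)"
    using i i2 by (subst Bochner_Integration.integral_diff) auto
  finally show ?thesis unfolding 1 by simp
qed

lemma heat_hermite_orthogonal:
  "(LINT x|std_gauss. heat_hermite m (of_real x) 1 * heat_hermite n (of_real x) 1) = (if m = n then fact m else 0)"
proof (induction m arbitrary: n)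
  case (0 n)
  interpret prob_space std_gauss by (rule prob_space_std_gauss)
  have *: "(LINT x|std_gauss. heat_hermite (Suc k) (of_real x) 1) = 0" for k
    using heat_hermite_shift[of k 0] by simp
  show ?case using *[of "n - 1"] prob_space by (cases n) auto
next
  case (Suc m)
  show ?case using heat_hermite_shift[of m n] Suc[of "n - 1"] by (cases n) auto
qed

lemma hermite_measurable [measurable]: "hermite \<alpha> \<in> borel_measurable borel"
proof -
  have "(\<lambda>x :: real ^ 'a. x $ i) \<in> borel_measurable borel" for i
    by (intro borel_measurable_continuous_onI continuous_intros)
  then show ?thesis unfolding hermite_eq_prod[abs_def]
    by (intro borel_measurable_prod borel_measurable_heat_hermite) auto
qed

lemma hermite_orthogonal:
  fixes \<alpha> \<beta> :: "'k::finite \<Rightarrow> nat"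
  shows "integrable (gauss_prod UNIV) (\<lambda>x. hermite \<alpha> (\<chi> i. x i) * hermite \<beta> (\<chi> i. x i))" (is ?int)
    and "(LINT x|gauss_prod UNIV. hermite \<alpha> (\<chi> i. x i) * hermite \<beta> (\<chi> i. x i))
      = (if \<alpha> = \<beta> then \<Prod>i\<in>UNIV. fact (\<alpha> i) else 0)" (is ?eq)
proof -
  interpret product_prob_space "\<lambda>_. std_gauss" by (rule product_prob_space_std_gauss)
  have i: "integrable std_gauss (\<lambda>x. heat_hermite k (of_real x) 1 * heat_hermite l (of_real x) 1)" for k l
    by (intro integrates_tame_integrable[OF integrates_tame_std_gauss] tame_mult heat_hermite_x_tame) measurable
  show ?int unfolding hermite_eq_prod prod.distrib[symmetric] vec_lambda_beta
    by (intro product_integrable_prod[of _ "\<lambda>i x. heat_hermite (\<alpha> i) (of_real x) 1 * heat_hermite (\<beta> i) (of_real x) 1"] i) auto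
  have "(LINT x|gauss_prod UNIV. hermite \<alpha> (\<chi> i. x i) * hermite \<beta> (\<chi> i. x i))
    = (\<Prod>i\<in>UNIV. LINT x|std_gauss. heat_hermite (\<alpha> i) (of_real x) 1 * heat_hermite (\<beta> i) (of_real x) 1)"
    unfolding hermite_eq_prod prod.distrib[symmetric] vec_lambda_beta
    by (intro product_integral_prod[of _ "\<lambda>i x. heat_hermite (\<alpha> i) (of_real x) 1 * heat_hermite (\<beta> i) (of_real x) 1"] i) auto
  also have "\<dots> = (if \<alpha> = \<beta> then \<Prod>i\<in>UNIV. fact (\<alpha> i) else 0)"
    unfolding heat_hermite_orthogonal by (auto simp: fun_eq_iff intro: prod_zero)
  finally show ?eq .
qed

text \<open>Orthogonality recovers the coefficients from the function, so that expansions are unique.\<close>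
lemma hermite_expansion_coeff:
  assumes "hermite_expansion f c"
  shows "(LINT x|gauss_prod UNIV. f (\<chi> i. x i) * hermite \<beta> (\<chi> i. x i)) = c \<beta> * (\<Prod>i\<in>UNIV. fact (\<beta> i))"
proof -
  have fin: "finite {\<alpha>. c \<alpha> \<noteq> 0}" and f: "\<And>x. f x = (\<Sum>\<alpha> | c \<alpha> \<noteq> 0. c \<alpha> * hermite \<alpha> x)"
    using assms unfolding hermite_expansion_def by auto
  have "(LINT x|gauss_prod UNIV. f (\<chi> i. x i) * hermite \<beta> (\<chi> i. x i))
    = (LINT x|gauss_prod UNIV. (\<Sum>\<alpha> | c \<alpha> \<noteq> 0. c \<alpha> * (hermite \<alpha> (\<chi> i. x i) * hermite \<beta> (\<chi> i. x i))))"
    unfolding f sum_distrib_right by (simp only: mult.assoc)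
  also have "\<dots> = (\<Sum>\<alpha> | c \<alpha> \<noteq> 0. c \<alpha> * (LINT x|gauss_prod UNIV. hermite \<alpha> (\<chi> i. x i) * hermite \<beta> (\<chi> i. x i)))"
    by (subst Bochner_Integration.integral_sum) (auto intro!: integrable_mult_right hermite_orthogonal(1))
  also have "\<dots> = c \<beta> * (\<Prod>i\<in>UNIV. fact (\<beta> i))"
    unfolding hermite_orthogonal(2) using fin by (auto simp: if_distrib sum.delta cong: if_cong)
  finally show ?thesis .
qed

lemma hermite_expansion_unique:
  assumes "hermite_expansion f c" "hermite_expansion f c'"
  shows "c = c'"
proof
  fix \<beta>
  have "c \<beta> * (\<Prod>i\<in>UNIV. fact (\<beta> i)) = c' \<beta> * (\<Prod>i\<in>UNIV. fact (\<beta> i) :: complex)"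
    using hermite_expansion_coeff[OF assms(1), of \<beta>] hermite_expansion_coeff[OF assms(2), of \<beta>] by simp
  then show "c \<beta> = c' \<beta>" by simp
qed

definition hermite_expandable :: "(real ^ 'k \<Rightarrow> complex) \<Rightarrow> bool" where
  "hermite_expandable f \<longleftrightarrow> (\<exists>c. hermite_expansion f c)"

lemma hermite_expandableI:
  assumes "finite S" "\<And>x. f x = (\<Sum>\<alpha>\<in>S. c \<alpha> * hermite \<alpha> x)"
  shows "hermite_expandable f"
proof -
  define c' where "c' \<alpha> = (if \<alpha> \<in> S then c \<alpha> else 0)" for \<alpha>
  have sub: "{\<alpha>. c' \<alpha> \<noteq> 0} \<subseteq> S" by (auto simp: c'_def)
  have "f x = (\<Sum>\<alpha> | c' \<alpha> \<noteq> 0. c' \<alpha> * hermite \<alpha> x)" for x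
    unfolding assms(2) using assms(1) sub by (intro sum.mono_neutral_cong_right) (auto simp: c'_def)
  then have "hermite_expansion f c'"
    unfolding hermite_expansion_def using finite_subset[OF sub assms(1)] by blast
  then show ?thesis unfolding hermite_expandable_def by blast
qed

lemma hermite_expandable_add:
  assumes "hermite_expandable f" "hermite_expandable g"
  shows "hermite_expandable (\<lambda>x. f x + g x)"
proof -
  obtain c d where c: "finite {\<alpha>. c \<alpha> \<noteq> 0}" "\<And>x. f x = (\<Sum>\<alpha> | c \<alpha> \<noteq> 0. c \<alpha> * hermite \<alpha> x)"
    and d: "finite {\<alpha>. d \<alpha> \<noteq> 0}" "\<And>x. g x = (\<Sum>\<alpha> | d \<alpha> \<noteq> 0. d \<alpha> * hermite \<alpha> x)"
    using assms unfolding hermite_expandable_def hermite_expansion_def by blast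
  let ?S = "{\<alpha>. c \<alpha> \<noteq> 0} \<union> {\<alpha>. d \<alpha> \<noteq> 0}"
  show ?thesis
  proof (rule hermite_expandableI[where S = ?S and c = "\<lambda>\<alpha>. c \<alpha> + d \<alpha>"])
    fix x
    have "f x = (\<Sum>\<alpha>\<in>?S. c \<alpha> * hermite \<alpha> x)" "g x = (\<Sum>\<alpha>\<in>?S. d \<alpha> * hermite \<alpha> x)"
      unfolding c(2) d(2) using c(1) d(1) by (auto intro!: sum.mono_neutral_left)
    then show "f x + g x = (\<Sum>\<alpha>\<in>?S. (c \<alpha> + d \<alpha>) * hermite \<alpha> x)"
      by (simp add: distrib_right sum.distrib)
  qed (use c d in auto)
qed

lemma hermite_expandable_cmult:
  assumes "hermite_expandable f"
  shows "hermite_expandable (\<lambda>x. a * f x)"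
proof -
  obtain c where c: "finite {\<alpha>. c \<alpha> \<noteq> 0}" "\<And>x. f x = (\<Sum>\<alpha> | c \<alpha> \<noteq> 0. c \<alpha> * hermite \<alpha> x)"
    using assms unfolding hermite_expandable_def hermite_expansion_def by blast
  show ?thesis
    by (rule hermite_expandableI[OF c(1), where c = "\<lambda>\<alpha>. a * c \<alpha>"]) (simp add: c(2) sum_distrib_left mult.assoc)
qed

lemma hermite_expandable_hermite: "hermite_expandable (hermite \<alpha>)"
  by (rule hermite_expandableI[where S = "{\<alpha>}" and c = "\<lambda>_. 1"]) auto

lemma hermite_expandable_const: "hermite_expandable (\<lambda>x. a)"
proof -
  have "hermite_expandable (\<lambda>x :: real ^ 'a. a * hermite (\<lambda>_. 0) x)"
    by (intro hermite_expandable_cmult hermite_expandable_hermite)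
  then show ?thesis by (simp add: hermite_eq_prod)
qed

lemma hermite_expandable_sum:
  "(\<And>i. i \<in> S \<Longrightarrow> hermite_expandable (g i)) \<Longrightarrow> hermite_expandable (\<lambda>x. \<Sum>i\<in>S. g i x)"
  by (induction S rule: infinite_finite_induct) (auto intro: hermite_expandable_const hermite_expandable_add)

text \<open>The recursion read backwards: expandable functions are stable under multiplication by coordinates, and hence
contain all polynomials.\<close>
lemma coordinate_times_hermite:
  "of_real (x $ i) * hermite \<alpha> x = hermite (\<alpha>(i := Suc (\<alpha> i))) x + of_nat (\<alpha> i) * hermite (\<alpha>(i := \<alpha> i - 1)) x"
proof -
  let ?R = "\<Prod>j\<in>UNIV - {i}. heat_hermite (\<alpha> j) (of_real (x $ j)) 1"
  have *: "hermite (\<alpha>(i := n)) x = heat_hermite n (of_real (x $ i)) 1 * ?R" for n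
    unfolding hermite_eq_prod by (subst prod.remove[of _ i]) (auto intro!: prod.cong)
  have "hermite \<alpha> x = heat_hermite (\<alpha> i) (of_real (x $ i)) 1 * ?R" using *[of "\<alpha> i"] by simp
  then show ?thesis unfolding * by (simp add: heat_hermite_Suc algebra_simps)
qed

lemma hermite_expandable_coordinate:
  assumes "hermite_expandable f"
  shows "hermite_expandable (\<lambda>x. of_real (x $ i) * f x)"
proof -
  obtain c where c: "finite {\<alpha>. c \<alpha> \<noteq> 0}" "\<And>x. f x = (\<Sum>\<alpha> | c \<alpha> \<noteq> 0. c \<alpha> * hermite \<alpha> x)"
    using assms unfolding hermite_expandable_def hermite_expansion_def by blast
  have "of_real (x $ i) * f x = (\<Sum>\<alpha> | c \<alpha> \<noteq> 0. c \<alpha> * (hermite (\<alpha>(i := Suc (\<alpha> i))) x + of_nat (\<alpha> i) * hermite (\<alpha>(i := \<alpha> i - 1)) x))" for x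
    unfolding c(2) sum_distrib_left mult.left_commute[of "of_real _"] coordinate_times_hermite ..
  then show ?thesis
    by (simp only:) (intro hermite_expandable_sum hermite_expandable_cmult hermite_expandable_add hermite_expandable_hermite)
qed

lemma hermite_expandable_real_polynomial:
  fixes p :: "real ^ 'k \<Rightarrow> real"
  assumes "real_polynomial_function p" "hermite_expandable g"
  shows "hermite_expandable (\<lambda>x. of_real (p x) * g x)"
  using assms
proof (induction p arbitrary: g rule: real_polynomial_function.induct)
  case (linear p)
  interpret bounded_linear p by fact
  have p: "p x = (\<Sum>i\<in>UNIV. x $ i * p (axis i 1))" for x
  proof -
    have "p x = p (\<Sum>i\<in>UNIV. x $ i *\<^sub>R axis i 1)" using basis_expansion[of x] by (simp add: scalar_mult_eq_scaleR)
    then show ?thesis by (simp add: sum scaleR)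
  qed
  have "of_real (p x) * g x = (\<Sum>i\<in>UNIV. of_real (p (axis i 1)) * (of_real (x $ i) * g x))" for x
    by (subst p) (simp add: sum_distrib_right mult.assoc mult.left_commute)
  then have e: "(\<lambda>x. of_real (p x) * g x) = (\<lambda>x. \<Sum>i\<in>UNIV. of_real (p (axis i 1)) * (of_real (x $ i) * g x))"
    by (rule ext)
  show ?case
    by (subst e, rule hermite_expandable_sum, rule hermite_expandable_cmult, rule hermite_expandable_coordinate,
      rule linear.prems)
next
  case (const c)
  then show ?case by (intro hermite_expandable_cmult)
next
  case (add p q)
  then show ?case using hermite_expandable_add[OF add.IH(1)[OF add.prems] add.IH(2)[OF add.prems]]
    by (simp add: algebra_simps)
next
  case (mult p q)
  from mult.IH(1)[OF mult.IH(2)[OF mult.prems]] show ?case by (simp add: mult.assoc)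
qed

lemma hermite_expansion_exists:
  fixes f :: "real ^ 'k \<Rightarrow> complex"
  assumes "polynomial_function f"
  shows "hermite_expansion f (hermite_coeffs f)"
proof -
  have "real_polynomial_function (Re \<circ> f)" "real_polynomial_function (Im \<circ> f)"
    using assms bounded_linear_Re bounded_linear_Im unfolding polynomial_function_def by blast+
  note this[THEN hermite_expandable_real_polynomial, OF hermite_expandable_const]
  from this(1)[of 1] this(2)[of \<i>]
  have "hermite_expandable (\<lambda>x. of_real ((Re \<circ> f) x) * 1)" "hermite_expandable (\<lambda>x. of_real ((Im \<circ> f) x) * \<i>)" .
  from hermite_expandable_add[OF this]
  have "hermite_expandable (\<lambda>x. of_real ((Re \<circ> f) x) * 1 + of_real ((Im \<circ> f) x) * \<i>)" .
  also have "(\<lambda>x. of_real ((Re \<circ> f) x) * 1 + of_real ((Im \<circ> f) x) * \<i>) = f"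
    by (auto simp: fun_eq_iff complex_eq_iff)
  finally have "hermite_expandable f" .
  then have "\<exists>c. hermite_expansion f c" by (simp only: hermite_expandable_def)
  then have "\<exists>!c. hermite_expansion f c"
  proof (elim exE, intro ex1I)
    fix c c' assume c: "hermite_expansion f c"
    show "hermite_expansion f c" by (fact c)
    assume "hermite_expansion f c'"
    then show "c' = c" using c by (rule hermite_expansion_unique)
  qed
  then show ?thesis unfolding hermite_coeffs_def by (rule theI')
qed

section \<open>Consequences of the growth condition\<close>

lemma slow_onI_tame:
  assumes "tame (\<lambda>t. \<bar>t\<bar>) g" "\<And>t. t \<in> S \<Longrightarrow> \<bar>b t\<bar> \<le> \<bar>g t\<bar>"
  shows "slow_on S b"
proof -
  obtain C M where CM: "0 \<le> C" "\<And>t. \<bar>g t\<bar> \<le> exp (C * ln (3 + \<bar>t\<bar>) ^ M)"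
    using assms(1) unfolding tame_def by auto
  have "\<bar>b t\<bar> \<le> exp (C * ln (3 + \<bar>t\<bar>) ^ M)" if "t \<in> S" for t
    using order_trans[OF assms(2)[OF that] CM(2)] .
  then show ?thesis unfolding slow_on_def using CM(1) by blast
qed

lemma slow_on_antiderivative:
  assumes d: "\<And>t. e \<le> t \<Longrightarrow> (B has_real_derivative B' t) (at t)" and s: "slow_on {e..} B'" and e: "0 < e"
  shows "slow_on {e..} B"
proof -
  obtain C M where CM: "0 \<le> C" "\<And>t. e \<le> t \<Longrightarrow> \<bar>B' t\<bar> \<le> exp (C * ln (3 + \<bar>t\<bar>) ^ M)"
    using s unfolding slow_on_def by auto
  show ?thesis
  proof (rule slow_onI_tame)
    have "tame (\<lambda>t. \<bar>t\<bar>) (\<lambda>t :: real. exp (C * ln (3 + \<bar>t\<bar>) ^ M))"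
      by (rule tameI[where C = C and M = M]) (auto intro: CM)
    then show "tame (\<lambda>t. \<bar>t\<bar>) (\<lambda>t. \<bar>B e\<bar> + exp (C * ln (3 + \<bar>t\<bar>) ^ M) * \<bar>t\<bar>)"
      by (intro tame_add tame_mult tame_const tame_size) auto
    fix t assume "t \<in> {e..}"
    then have t: "e \<le> t" by simp
    have "norm (B t - B e) \<le> exp (C * ln (3 + \<bar>t\<bar>) ^ M) * norm (t - e)"
    proof (rule field_differentiable_bound[where S = "{e..t}" and f' = B'])
      fix s assume s: "s \<in> {e..t}"
      then show "(B has_field_derivative B' s) (at s within {e..t})"
        using d[of s] by (auto intro: has_field_derivative_at_within)
      have "ln (3 + \<bar>s\<bar>) \<le> ln (3 + \<bar>t\<bar>)" using s e by (subst ln_le_cancel_iff) auto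
      then have "C * ln (3 + \<bar>s\<bar>) ^ M \<le> C * ln (3 + \<bar>t\<bar>) ^ M"
        using ln_three_ge_one[of "\<bar>s\<bar>"] by (intro mult_left_mono power_mono CM) auto
      then show "norm (B' s) \<le> exp (C * ln (3 + \<bar>t\<bar>) ^ M)"
        using order_trans[OF CM(2)[of s], of "exp (C * ln (3 + \<bar>t\<bar>) ^ M)"] s by simp
    qed (use t in auto)
    also have "\<dots> \<le> exp (C * ln (3 + \<bar>t\<bar>) ^ M) * \<bar>t\<bar>" using t e by (intro mult_left_mono) auto
    finally have "\<bar>B t - B e\<bar> \<le> exp (C * ln (3 + \<bar>t\<bar>) ^ M) * \<bar>t\<bar>" by simp
    then show "\<bar>B t\<bar> \<le> \<bar>\<bar>B e\<bar> + exp (C * ln (3 + \<bar>t\<bar>) ^ M) * \<bar>t\<bar>\<bar>" by linarith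
  qed
qed

lemma C2_onD:
  assumes "C2_on {0<..} B" "0 < t"
  shows "(B has_real_derivative deriv B t) (at t)"
    and "(deriv B has_real_derivative deriv (deriv B) t) (at t)"
proof -
  have "B differentiable at t" "deriv B differentiable at t"
    using assms unfolding C2_on_def
    by (auto simp: differentiable_on_def dest!: bspec[where x = t] simp: at_within_open[of t "{0<..}"])
  then show "(B has_real_derivative deriv B t) (at t)"
    "(deriv B has_real_derivative deriv (deriv B) t) (at t)"
    by (simp_all add: DERIV_deriv_iff_real_differentiable)
qed

lemma C2_on_halfline_strict_increasing:
  assumes "C2_on {0<..} B" "continuous_on {0..} B" "\<And>t. 0 < t \<Longrightarrow> 0 < deriv B t" "0 \<le> s" "s < t"
  shows "B s < B t"
proof (rule DERIV_pos_imp_increasing_open[OF assms(5)])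
  show "\<exists>y. (B has_real_derivative y) (at x) \<and> 0 < y" if "s < x" "x < t" for x
    using C2_onD(1)[OF assms(1), of x] assms(3)[of x] assms(4) that by auto
  show "continuous_on {s..t} B" using assms(4) by (auto intro: continuous_on_subset[OF assms(2)])
qed

lemma growth_condition_slow:
  assumes g: "growth_condition B" and e: "0 < e"
  shows "slow_on {e..} (deriv (deriv B))" "slow_on {e..} (deriv B)" "slow_on {e..} B"
proof -
  obtain N R where NR: "0 < N" "0 < R" "\<And>t. R \<le> t \<Longrightarrow> \<bar>deriv (deriv B) t\<bar> < exp (ln (t + N) powr N)"
    and c2: "C2_on {0<..} B"
    using g unfolding growth_condition_def by auto
  define R' where "R' = max R 3"
  have "continuous_on {e..R'} (deriv (deriv B))"
    using c2 e unfolding C2_on_def by (auto intro: continuous_on_subset)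
  then have "bounded (deriv (deriv B) ` {e..R'})"
    by (intro compact_imp_bounded compact_continuous_image) auto
  then obtain K where "\<forall>y\<in>deriv (deriv B) ` {e..R'}. norm y \<le> K"
    unfolding bounded_iff by blast
  then have K: "\<bar>deriv (deriv B) t\<bar> \<le> K" if "t \<in> {e..R'}" for t
    using that by auto
  define M where "M = nat \<lceil>N\<rceil>"
  define D where "D = (1 + ln (3 + N)) ^ M"
  have D: "0 \<le> D" using NR ln_three_ge_one[of N] by (simp add: D_def)
  show 1: "slow_on {e..} (deriv (deriv B))"
  proof (rule slow_onI_tame)
    have "tame (\<lambda>t. \<bar>t\<bar>) (\<lambda>t :: real. exp (D * ln (3 + \<bar>t\<bar>) ^ M))"
      by (rule tameI[where C = D and M = M]) (auto intro: D)
    then show "tame (\<lambda>t. \<bar>t\<bar>) (\<lambda>t. \<bar>K\<bar> + exp (D * ln (3 + \<bar>t\<bar>) ^ M))"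
      by (intro tame_add tame_const) auto
    fix t assume "t \<in> {e..}"
    then have t: "e \<le> t" by simp
    show "\<bar>deriv (deriv B) t\<bar> \<le> \<bar>\<bar>K\<bar> + exp (D * ln (3 + \<bar>t\<bar>) ^ M)\<bar>"
    proof (cases "t \<le> R'")
      case True
      then show ?thesis using K[of t] t by (smt (verit) atLeastAtMost_iff exp_ge_zero)
    next
      case False
      then have tR: "R \<le> t" "3 \<le> t" by (auto simp: R'_def)
      let ?l = "ln (t + N)"
      have l1: "1 \<le> ?l" using ln_three_ge_one[of "t + N - 3"] tR NR by simp
      have L: "1 \<le> ln (3 + t)" using ln_three_ge_one[of t] tR by simp
      have "?l \<le> ln ((3 + N) * (3 + t))"
        using tR NR by (subst ln_le_cancel_iff) (auto simp: algebra_simps add_pos_pos)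
      also have "\<dots> = ln (3 + N) + ln (3 + t)" using tR NR by (intro ln_mult_pos) auto
      also have "\<dots> \<le> (1 + ln (3 + N)) * ln (3 + t)"
      proof -
        have "ln (3 + N) * 1 \<le> ln (3 + N) * ln (3 + t)"
          using L ln_three_ge_one[of N] NR by (intro mult_left_mono) auto
        then show ?thesis by (simp add: algebra_simps)
      qed
      finally have l2: "?l \<le> (1 + ln (3 + N)) * ln (3 + t)" .
      have "?l powr N \<le> ?l powr real M"
        using l1 NR by (intro powr_mono) (auto simp: M_def)
      also have "\<dots> = ?l ^ M" using l1 by (intro powr_realpow) auto
      also have "\<dots> \<le> ((1 + ln (3 + N)) * ln (3 + t)) ^ M" using l1 l2 by (intro power_mono) auto
      also have "\<dots> = D * ln (3 + \<bar>t\<bar>) ^ M" using tR by (simp add: D_def power_mult_distrib)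
      finally have "exp (?l powr N) \<le> exp (D * ln (3 + \<bar>t\<bar>) ^ M)" by simp
      then show ?thesis using NR(3)[OF tR(1)] by linarith
    qed
  qed
  show 2: "slow_on {e..} (deriv B)"
    using e by (intro slow_on_antiderivative[OF _ 1 e] C2_onD(2)[OF c2]) auto
  show "slow_on {e..} B"
    using e by (intro slow_on_antiderivative[OF _ 2 e] C2_onD(1)[OF c2]) auto
qed

section \<open>The pointwise inequality and regularization at the origin\<close>

text \<open>The condition on \<open>z\<close> in Hessian form, with \<open>a = t P''/P'\<close>, \<open>b = t Q''/Q'\<close> and \<open>r = t\<close>. Writing
\<open>2 (\<zeta> \<bullet> w)\<^sup>2 = |\<zeta>|\<^sup>2 |w|\<^sup>2 + Re((cnj \<zeta> w)\<^sup>2)\<close> isolates the oscillating part, whose worst case over all \<open>\<eta>\<close> is the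
absolute value in the condition. For \<open>r > |\<zeta>|\<close> the excess \<open>(r\<^sup>2 - |\<zeta>|\<^sup>2)(|\<eta>|\<^sup>2 - |z \<eta>|\<^sup>2)\<close> is nonnegative; this is the
case needed after regularization.\<close>
lemma rotation_inequality:
  fixes z \<zeta> \<eta> :: complex and a b r :: real
  assumes "cmod (of_real (a - 1) - z\<^sup>2 * of_real (b - 1)) \<le> (a + 1) - (cmod z)\<^sup>2 * (b + 1)"
    and z: "cmod z \<le> 1" and r: "(cmod \<zeta>)\<^sup>2 \<le> r\<^sup>2"
  shows "(b - 1) * (\<zeta> \<bullet> (z * \<eta>))\<^sup>2 + r\<^sup>2 * ((z * \<eta>) \<bullet> (z * \<eta>)) \<le> (a - 1) * (\<zeta> \<bullet> \<eta>)\<^sup>2 + r\<^sup>2 * (\<eta> \<bullet> \<eta>)"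
proof -
  let ?u = "cnj \<zeta>"
  have sq: "2 * (\<zeta> \<bullet> w)\<^sup>2 = (cmod \<zeta>)\<^sup>2 * (cmod w)\<^sup>2 + Re (?u\<^sup>2 * w\<^sup>2)" for w
    unfolding inner_complex_def cmod_power2 by (simp add: power2_eq_square algebra_simps)
  have n: "w \<bullet> w = (cmod w)\<^sup>2" for w :: complex by (simp add: power2_norm_eq_inner)
  define A where "A = (cmod \<zeta>)\<^sup>2" define E where "E = (cmod \<eta>)\<^sup>2" define Z where "Z = (cmod z)\<^sup>2"
  have Z: "Z \<le> 1" using z by (simp add: Z_def power_le_one)
  have "Re (- (?u\<^sup>2 * \<eta>\<^sup>2) * (of_real (a - 1) - z\<^sup>2 * of_real (b - 1)))
     \<le> cmod (- (?u\<^sup>2 * \<eta>\<^sup>2) * (of_real (a - 1) - z\<^sup>2 * of_real (b - 1)))" by (rule complex_Re_le_cmod)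
  also have "\<dots> = A * E * cmod (of_real (a - 1) - z\<^sup>2 * of_real (b - 1))"
    by (simp add: norm_mult norm_power A_def E_def)
  also have "\<dots> \<le> A * E * ((a + 1) - Z * (b + 1))"
    using assms(1) by (intro mult_left_mono) (auto simp: A_def E_def Z_def)
  finally have 1: "Re (- (?u\<^sup>2 * \<eta>\<^sup>2) * (of_real (a - 1) - z\<^sup>2 * of_real (b - 1))) \<le> A * E * ((a + 1) - Z * (b + 1))" .
  have e: "Re (- (?u\<^sup>2 * \<eta>\<^sup>2) * (of_real (a - 1) - z\<^sup>2 * of_real (b - 1)))
     = (b - 1) * Re (?u\<^sup>2 * (z * \<eta>)\<^sup>2) - (a - 1) * Re (?u\<^sup>2 * \<eta>\<^sup>2)"
  proof -
    have "- (?u\<^sup>2 * \<eta>\<^sup>2) * (of_real (a - 1) - z\<^sup>2 * of_real (b - 1))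
      = of_real (b - 1) * (?u\<^sup>2 * (z * \<eta>)\<^sup>2) - of_real (a - 1) * (?u\<^sup>2 * \<eta>\<^sup>2)"
      by (simp add: algebra_simps power_mult_distrib)
    moreover have "Re (of_real p * X - of_real q * Y) = p * Re X - q * Re Y" for p q X Y by simp
    ultimately show ?thesis by (simp only:)
  qed
  have zE: "(cmod (z * \<eta>))\<^sup>2 = Z * E" by (simp add: norm_mult power_mult_distrib Z_def E_def)
  define S1 S2 where "S1 = Re (?u\<^sup>2 * (z * \<eta>)\<^sup>2)" and "S2 = Re (?u\<^sup>2 * \<eta>\<^sup>2)"
  have 2: "(b - 1) * S1 - (a - 1) * S2 \<le> A * E * ((a + 1) - Z * (b + 1))"
    using 1 unfolding e S1_def S2_def .
  have 3: "0 \<le> (r\<^sup>2 - A) * E * (1 - Z)" using r Z by (intro mult_nonneg_nonneg) (auto simp: A_def E_def)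
  have half: "2 * t = s \<Longrightarrow> t = s / 2" for s t :: real by simp
  have X: "(\<zeta> \<bullet> (z * \<eta>))\<^sup>2 = (A * (Z * E) + S1) / 2"
    using sq[of "z * \<eta>"] unfolding zE A_def[symmetric] S1_def[symmetric] by (rule half)
  have Y: "(\<zeta> \<bullet> \<eta>)\<^sup>2 = (A * E + S2) / 2"
    using sq[of \<eta>] unfolding A_def[symmetric] E_def[symmetric] S2_def[symmetric] by (rule half)
  have "((a - 1) * ((A * E + S2) / 2) + r\<^sup>2 * E) - ((b - 1) * ((A * (Z * E) + S1) / 2) + r\<^sup>2 * (Z * E))
      = (A * E * ((a + 1) - Z * (b + 1)) - ((b - 1) * S1 - (a - 1) * S2)) / 2 + (r\<^sup>2 - A) * E * (1 - Z)"
    by (simp add: field_simps)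
  moreover have "0 \<le> (A * E * ((a + 1) - Z * (b + 1)) - ((b - 1) * S1 - (a - 1) * S2)) / 2 + (r\<^sup>2 - A) * E * (1 - Z)"
    using 2 3 by (intro add_nonneg_nonneg) auto
  ultimately have "(b - 1) * ((A * (Z * E) + S1) / 2) + r\<^sup>2 * (Z * E) \<le> (a - 1) * ((A * E + S2) / 2) + r\<^sup>2 * E"
    by (metis diff_ge_0_iff_ge)
  then show ?thesis unfolding n X Y zE E_def[symmetric] .
qed

text \<open>Replacing \<open>|\<zeta>|\<close> by \<open>sqrt(|\<zeta>|\<^sup>2 + \<epsilon>\<^sup>2)\<close> keeps the argument of \<open>P\<close> at least \<open>\<epsilon>\<close> and that of \<open>F\<close> at least \<open>P \<epsilon>\<close>,
where both functions are twice continuously differentiable and their growth is controlled. The function \<open>b\<close>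
is \<open>t Q''/Q'\<close> for \<open>Q = F \<circ> P\<close>, expressed through \<open>P\<close> and \<open>F\<close>.\<close>
lemma hypercontractive_pair_regularized:
  fixes P F :: "real \<Rightarrow> real" and z :: complex
  assumes eps: "0 < \<epsilon>"
    and P_growth: "growth_condition P" and F_growth: "growth_condition F"
    and P_mono: "\<And>s t. 0 \<le> s \<Longrightarrow> s \<le> t \<Longrightarrow> P s \<le> P t" and P_pos: "\<And>t. 0 < t \<Longrightarrow> 0 < P t"
    and P_deriv: "\<And>t. 0 < t \<Longrightarrow> 0 < deriv P t"
    and F_deriv: "\<And>t. 0 < t \<Longrightarrow> 0 < deriv F t" and F_deriv2: "\<And>t. 0 < t \<Longrightarrow> 0 < deriv (deriv F) t"
    and F_concave: "concave_on {0<..} (\<lambda>t. deriv F t / deriv (deriv F) t)"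
    and z_le: "cmod z \<le> 1"
    and cond: "\<And>t. 0 < t \<Longrightarrow> cmod (of_real (a t - 1) - z\<^sup>2 * of_real (b t - 1)) \<le> (a t + 1) - (cmod z)\<^sup>2 * (b t + 1)"
    and a: "\<And>t. 0 < t \<Longrightarrow> a t = t * deriv (deriv P) t / deriv P t"
    and b: "\<And>t. 0 < t \<Longrightarrow> b t = a t + t * deriv P t * deriv (deriv F) (P t) / deriv F (P t)"
  defines "r \<equiv> \<lambda>\<rho>. sqrt (\<rho> + \<epsilon>\<^sup>2)"
  shows "hypercontractive_pair (\<lambda>\<rho>. P (r \<rho>)) (\<lambda>\<rho>. deriv P (r \<rho>) / (2 * r \<rho>))
    (\<lambda>\<rho>. deriv (deriv P) (r \<rho>) / (4 * r \<rho> ^ 2) - deriv P (r \<rho>) / (4 * r \<rho> ^ 3))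
    F (deriv F) (deriv (deriv F)) (P \<epsilon>) z"
proof -
  have PC2: "C2_on {0<..} P" and FC2: "C2_on {0<..} F"
    using P_growth F_growth by (auto simp: growth_condition_def)
  have r_ge: "\<epsilon> \<le> r \<rho>" if "0 \<le> \<rho>" for \<rho>
    using real_sqrt_le_mono[of "\<epsilon>\<^sup>2" "\<rho> + \<epsilon>\<^sup>2"] that eps by (simp add: r_def)
  then have r_pos: "0 < r \<rho>" if "0 \<le> \<rho>" for \<rho> using that eps by (meson less_le_trans)
  have r_deriv: "(r has_real_derivative 1 / (2 * r \<rho>)) (at \<rho>)" if "0 \<le> \<rho>" for \<rho>
  proof -
    have "0 < \<rho> + \<epsilon>\<^sup>2" using that eps by (simp add: add_nonneg_pos)
    then show ?thesis unfolding r_def by (auto intro!: derivative_eq_intros simp: field_simps)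
  qed
  have Pe: "0 < P \<epsilon>" using P_pos eps by auto
  let ?cl = "\<lambda>\<rho>. r (max 0 \<rho>)"
  have r_tame: "tame (\<lambda>t. \<bar>t\<bar>) ?cl"
  proof (rule tame_norm_le)
    show "tame (\<lambda>t. \<bar>t\<bar>) (\<lambda>t :: real. 1 + \<bar>t\<bar> + \<epsilon>\<^sup>2)"
      by (intro tame_add tame_const tame_size) auto
    fix t :: real
    define s where "s = \<bar>t\<bar> + \<epsilon>\<^sup>2"
    have s: "0 \<le> s" by (simp add: s_def)
    have "max 0 t + \<epsilon>\<^sup>2 \<le> s" by (simp add: s_def)
    also have "s \<le> (1 + s)\<^sup>2" using s by (simp add: power2_sum add_increasing2)
    finally have "?cl t \<le> sqrt ((1 + s)\<^sup>2)" unfolding r_def by (rule real_sqrt_le_mono)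
    then have "?cl t \<le> 1 + \<bar>t\<bar> + \<epsilon>\<^sup>2" using s by (simp add: s_def add.assoc)
    then show "norm (?cl t) \<le> norm (1 + \<bar>t\<bar> + \<epsilon>\<^sup>2)" using r_pos[of "max 0 t"] by simp
  qed
  have inv_tame: "tame (\<lambda>t. \<bar>t\<bar>) (\<lambda>t. 1 / ?cl t)"
  proof (rule tame_norm_le)
    show "tame (\<lambda>t. \<bar>t\<bar>) (\<lambda>t :: real. 1 / \<epsilon>)" by (rule tame_const) auto
    show "norm (1 / ?cl t) \<le> norm (1 / \<epsilon>)" for t
      using r_ge[of "max 0 t"] r_pos[of "max 0 t"] eps by (auto intro!: divide_left_mono)
  qed
  have Pt: "tame (\<lambda>t. \<bar>t\<bar>) (\<lambda>t. P (?cl t))" "tame (\<lambda>t. \<bar>t\<bar>) (\<lambda>t. deriv P (?cl t))"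
    "tame (\<lambda>t. \<bar>t\<bar>) (\<lambda>t. deriv (deriv P) (?cl t))"
    using growth_condition_slow[OF P_growth eps] r_ge
    by (auto intro!: tame_compose[OF r_tame])
  show ?thesis
  proof
    fix \<rho> :: real assume \<rho>: "0 \<le> \<rho>"
    show "((\<lambda>\<rho>. P (r \<rho>)) has_real_derivative deriv P (r \<rho>) / (2 * r \<rho>)) (at \<rho>)"
      using DERIV_chain2[OF C2_onD(1)[OF PC2 r_pos[OF \<rho>]] r_deriv[OF \<rho>]] by simp
    have "((\<lambda>\<rho>. deriv P (r \<rho>)) has_real_derivative deriv (deriv P) (r \<rho>) * (1 / (2 * r \<rho>))) (at \<rho>)"
      by (rule DERIV_chain2[OF C2_onD(2)[OF PC2 r_pos[OF \<rho>]] r_deriv[OF \<rho>]])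
    from DERIV_divide[OF this DERIV_cmult[OF r_deriv[OF \<rho>], of 2]] r_pos[OF \<rho>]
    show "((\<lambda>\<rho>. deriv P (r \<rho>) / (2 * r \<rho>)) has_real_derivative
       deriv (deriv P) (r \<rho>) / (4 * r \<rho> ^ 2) - deriv P (r \<rho>) / (4 * r \<rho> ^ 3)) (at \<rho>)"
      by (simp add: field_simps power2_eq_square power3_eq_cube)
    show "P \<epsilon> \<le> P (r \<rho>)" using r_ge[OF \<rho>] eps by (intro P_mono) auto
  next
    have rc: "continuous_on {0..} r" unfolding r_def by (intro continuous_intros)
    have "continuous_on {0<..} (deriv (deriv P))" "continuous_on {0<..} (deriv P)"
      using PC2 C2_onD(2)[OF PC2] unfolding C2_on_def
      by (auto intro!: continuous_at_imp_continuous_on DERIV_isCont)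
    then have "continuous_on {0..} (\<lambda>\<rho>. deriv (deriv P) (r \<rho>))" "continuous_on {0..} (\<lambda>\<rho>. deriv P (r \<rho>))"
      using rc r_pos by (auto intro: continuous_on_compose2)
    then show "continuous_on {0..} (\<lambda>\<rho>. deriv (deriv P) (r \<rho>) / (4 * r \<rho> ^ 2) - deriv P (r \<rho>) / (4 * r \<rho> ^ 3))"
      using rc r_pos by (intro continuous_intros) (auto simp: less_le)
  next
    show "slow_on {0..} (\<lambda>\<rho>. P (r \<rho>))" by (rule slow_onI_tame[OF Pt(1)]) (simp add: max_absorb2)
    show "slow_on {0..} (\<lambda>\<rho>. deriv P (r \<rho>) / (2 * r \<rho>))"
    proof (rule slow_onI_tame)
      show "tame (\<lambda>t. \<bar>t\<bar>) (\<lambda>t. deriv P (?cl t) * (1 / 2) * (1 / ?cl t))"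
        by (rule tame_mult[OF tame_mult[OF Pt(2) tame_const] inv_tame]) simp
    qed (simp add: max_absorb2)
    show "slow_on {0..} (\<lambda>\<rho>. deriv (deriv P) (r \<rho>) / (4 * r \<rho> ^ 2) - deriv P (r \<rho>) / (4 * r \<rho> ^ 3))"
    proof (rule slow_onI_tame)
      show "tame (\<lambda>t. \<bar>t\<bar>) (\<lambda>t. deriv (deriv P) (?cl t) * (1 / 4) * (1 / ?cl t) ^ 2 - deriv P (?cl t) * (1 / 4) * (1 / ?cl t) ^ 3)"
        by (rule tame_diff[OF tame_mult[OF tame_mult[OF Pt(3) tame_const] tame_power[OF inv_tame]]
              tame_mult[OF tame_mult[OF Pt(2) tame_const] tame_power[OF inv_tame]]]) simp_all
    qed (simp add: max_absorb2 power_divide)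
  next
    fix v :: real assume v: "P \<epsilon> \<le> v"
    then have "0 < v" using Pe by simp
    then show "(F has_real_derivative deriv F v) (at v)" "(deriv F has_real_derivative deriv (deriv F) v) (at v)"
      "0 < deriv F v" "0 < deriv (deriv F) v"
      using C2_onD[OF FC2] F_deriv F_deriv2 by auto
    let ?\<theta> = "\<lambda>t. deriv F t / deriv (deriv F) t"
    have "convex_on {0<..} (\<lambda>t. - ?\<theta> t)" using F_concave by (simp add: concave_on_def)
    from convex_le_Inf_differential[OF this, of v] \<open>0 < v\<close> interior_open[of "{0::real<..}"]
    obtain m where m: "\<And>h. 0 < h \<Longrightarrow> - ?\<theta> v + m * (h - v) \<le> - ?\<theta> h" by auto
    have "?\<theta> h \<le> ?\<theta> v + (- m) * (h - v)" if "P \<epsilon> \<le> h" for h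
      using m[of h] that Pe by (simp add: algebra_simps)
    then show "\<exists>m. \<forall>h\<ge>P \<epsilon>. ?\<theta> h \<le> ?\<theta> v + m * (h - v)" by blast
  next
    show "continuous_on {P \<epsilon>..} (deriv (deriv F))"
      using FC2 Pe unfolding C2_on_def by (auto intro: continuous_on_subset)
    show "slow_on {P \<epsilon>..} F" "slow_on {P \<epsilon>..} (deriv F)" "slow_on {P \<epsilon>..} (deriv (deriv F))"
      using growth_condition_slow[OF F_growth Pe] by auto
  next
    fix \<zeta> \<eta> :: complex
    define R where "R = r (\<zeta> \<bullet> \<zeta>)"
    have R: "0 < R" unfolding R_def by (rule r_pos) simp
    have R2: "(cmod \<zeta>)\<^sup>2 \<le> R\<^sup>2"
      using eps by (simp add: R_def r_def power2_norm_eq_inner add_nonneg_nonneg)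
    define X Y Z N where "X = \<zeta> \<bullet> (z * \<eta>)" and "Y = \<zeta> \<bullet> \<eta>" and "Z = (z * \<eta>) \<bullet> (z * \<eta>)" and "N = \<eta> \<bullet> \<eta>"
    define p' p'' f where "p' = deriv P R" and "p'' = deriv (deriv P) R" and "f = deriv (deriv F) (P R) / deriv F (P R)"
    have p': "0 < p'" unfolding p'_def using P_deriv R by auto
    have ab: "a R = R * p'' / p'" "b R = R * p'' / p' + R * p' * f"
      using a[OF R] b[OF R] by (simp_all add: p'_def p''_def f_def)
    have "(b R - 1) * X\<^sup>2 + R\<^sup>2 * Z \<le> (a R - 1) * Y\<^sup>2 + R\<^sup>2 * N"
      unfolding X_def Y_def Z_def N_def by (rule rotation_inequality[OF cond[OF R] z_le R2])
    \<comment> \<open>This factor turns the normalized inequality into one between the derivatives of the profile.\<close>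
    from mult_left_mono[OF this, of "p' / R ^ 3"] p' R
    have "p' / R ^ 3 * ((b R - 1) * X\<^sup>2 + R\<^sup>2 * Z) \<le> p' / R ^ 3 * ((a R - 1) * Y\<^sup>2 + R\<^sup>2 * N)" by simp
    moreover have "p' / R ^ 3 * ((b R - 1) * X\<^sup>2 + R\<^sup>2 * Z)
      = 4 * (p'' / (4 * R ^ 2) - p' / (4 * R ^ 3)) * X\<^sup>2 + 2 * (p' / (2 * R)) * Z + (2 * (p' / (2 * R)) * X)\<^sup>2 * f"
      unfolding ab using p' R by (simp add: field_simps power2_eq_square power3_eq_cube)
    moreover have "p' / R ^ 3 * ((a R - 1) * Y\<^sup>2 + R\<^sup>2 * N)
      = 4 * (p'' / (4 * R ^ 2) - p' / (4 * R ^ 3)) * Y\<^sup>2 + 2 * (p' / (2 * R)) * N"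
      unfolding ab using p' R by (simp add: field_simps power2_eq_square power3_eq_cube)
    ultimately show "4 * (deriv (deriv P) (r (\<zeta> \<bullet> \<zeta>)) / (4 * r (\<zeta> \<bullet> \<zeta>) ^ 2) - deriv P (r (\<zeta> \<bullet> \<zeta>)) / (4 * r (\<zeta> \<bullet> \<zeta>) ^ 3)) * (\<zeta> \<bullet> (z * \<eta>))\<^sup>2
       + 2 * (deriv P (r (\<zeta> \<bullet> \<zeta>)) / (2 * r (\<zeta> \<bullet> \<zeta>))) * ((z * \<eta>) \<bullet> (z * \<eta>))
       + (2 * (deriv P (r (\<zeta> \<bullet> \<zeta>)) / (2 * r (\<zeta> \<bullet> \<zeta>))) * (\<zeta> \<bullet> (z * \<eta>)))\<^sup>2 * (deriv (deriv F) (P (r (\<zeta> \<bullet> \<zeta>))) / deriv F (P (r (\<zeta> \<bullet> \<zeta>))))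
      \<le> 4 * (deriv (deriv P) (r (\<zeta> \<bullet> \<zeta>)) / (4 * r (\<zeta> \<bullet> \<zeta>) ^ 2) - deriv P (r (\<zeta> \<bullet> \<zeta>)) / (4 * r (\<zeta> \<bullet> \<zeta>) ^ 3)) * (\<zeta> \<bullet> \<eta>)\<^sup>2
       + 2 * (deriv P (r (\<zeta> \<bullet> \<zeta>)) / (2 * r (\<zeta> \<bullet> \<zeta>))) * (\<eta> \<bullet> \<eta>)"
      unfolding R_def[symmetric] X_def[symmetric] Y_def[symmetric] Z_def[symmetric] N_def[symmetric]
        p'_def[symmetric] p''_def[symmetric] f_def[symmetric] by linarith
  qed
qed

section \<open>Complex hypercontractivity\<close>

theorem theorem1:
  fixes P Q F :: "real \<Rightarrow> real" and z :: complex and f :: "real ^ 'k \<Rightarrow> complex"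
  assumes P_C2: "C2_on {0<..} P" and P_cont: "continuous_on {0..} P"
    and Q_C2: "C2_on {0<..} Q" and Q_cont: "continuous_on {0..} Q"
    and P_nonneg: "\<And>t. t \<ge> 0 \<Longrightarrow> P t \<ge> 0" and Q_nonneg: "\<And>t. t \<ge> 0 \<Longrightarrow> Q t \<ge> 0"
    and P_deriv: "\<And>t. t > 0 \<Longrightarrow> deriv P t > 0" and Q_deriv: "\<And>t. t > 0 \<Longrightarrow> deriv Q t > 0"
    and P_0: "P 0 = 0" and P_at_top: "filterlim P at_top at_top"
    and F_eq: "F = Q \<circ> inv_into {0..} P"
    and P_growth: "growth_condition P" and F_growth: "growth_condition F"
    and F_deriv2: "\<And>t. t > 0 \<Longrightarrow> deriv (deriv F) t > 0"
    and F_concave: "concave_on {0<..} (\<lambda>t. deriv F t / deriv (deriv F) t)"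
    and z_le: "cmod z \<le> 1"
    and z_cond: "\<And>t. t > 0 \<Longrightarrow>
      cmod (of_real (t * deriv (deriv P) t / deriv P t)
            - z\<^sup>2 * of_real (t * deriv (deriv Q) t / deriv Q t) + z\<^sup>2 - 1)
      \<le> t * deriv (deriv P) t / deriv P t
         - (cmod z)\<^sup>2 * (t * deriv (deriv Q) t / deriv Q t) + 1 - (cmod z)\<^sup>2"
    and f_poly: "polynomial_function f"
  shows "inv_into {0..} Q (\<integral>x. Q (cmod (hermite_operator z f x)) \<partial>gaussian_measure)
         \<le> inv_into {0..} P (\<integral>x. P (cmod (f x)) \<partial>gaussian_measure)"
proof -
  have F_C2: "C2_on {0<..} F" using F_growth by (simp add: growth_condition_def)
  have P_strict: "P s < P t" if "0 \<le> s" "s < t" for s t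
    by (rule C2_on_halfline_strict_increasing[OF P_C2 P_cont P_deriv that])
  have Q_strict: "Q s < Q t" if "0 \<le> s" "s < t" for s t
    by (rule C2_on_halfline_strict_increasing[OF Q_C2 Q_cont Q_deriv that])
  have P_mono: "P s \<le> P t" if "0 \<le> s" "s \<le> t" for s t using P_strict[of s t] that by (cases "s = t") auto
  have Q_mono: "Q s \<le> Q t" if "0 \<le> s" "s \<le> t" for s t using Q_strict[of s t] that by (cases "s = t") auto
  have P_le_D: "s \<le> t" if "P s \<le> P t" "0 \<le> t" for s t using P_strict[of t s] that by linarith
  have Q_le_D: "s \<le> t" if "Q s \<le> Q t" "0 \<le> t" for s t using Q_strict[of t s] that by linarith
  have P_inj: "inj_on P {0..}" by (rule inj_onI) (metis P_le_D antisym atLeast_iff order_refl)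
  have Q_inj: "inj_on Q {0..}" by (rule inj_onI) (metis Q_le_D antisym atLeast_iff order_refl)
  have P_pos: "0 < P t" if "0 < t" for t using P_strict[of 0 t] that P_0 by simp
  have P_surj: "v \<in> P ` {0..}" if v: "0 \<le> v" for v
  proof -
    have "eventually (\<lambda>t. v \<le> P t) at_top"
      using P_at_top unfolding filterlim_at_top by blast
    then obtain T0 where T0: "\<And>t. T0 \<le> t \<Longrightarrow> v \<le> P t"
      unfolding eventually_at_top_linorder by blast
    have "continuous_on {0..max T0 0} P" by (rule continuous_on_subset[OF P_cont]) auto
    then obtain t where "0 \<le> t" "P t = v"
      using IVT'[of P 0 v "max T0 0"] P_0 v T0[of "max T0 0"] by auto
    then show ?thesis by auto
  qed
  let ?Pi = "inv_into {0..} P"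
  have P_Pi: "P (?Pi v) = v" if "0 \<le> v" for v using f_inv_into_f[OF P_surj[OF that]] .
  have Pi_nonneg: "0 \<le> ?Pi v" if "0 \<le> v" for v using inv_into_into[OF P_surj[OF that]] by simp
  have F_P: "F (P t) = Q t" if "0 \<le> t" for t
    using that P_inj by (simp add: F_eq inv_into_f_f)
  have dQ: "(Q has_real_derivative deriv F (P t) * deriv P t) (at t)" if "0 < t" for t
    using DERIV_chain2[OF C2_onD(1)[OF F_C2 P_pos[OF that]] C2_onD(1)[OF P_C2 that]]
    by (rule has_field_derivative_transform_within_open[where S = "{0<..}"]) (use that F_P in auto)
  have deriv_Q: "deriv Q t = deriv F (P t) * deriv P t" if "0 < t" for t
    using dQ[OF that] by (rule DERIV_imp_deriv)
  have deriv2_Q: "deriv (deriv Q) t = deriv (deriv F) (P t) * (deriv P t)\<^sup>2 + deriv F (P t) * deriv (deriv P) t"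
    if "0 < t" for t
  proof (rule DERIV_imp_deriv)
    have "((\<lambda>t. deriv F (P t) * deriv P t) has_real_derivative
      deriv (deriv F) (P t) * deriv P t * deriv P t + deriv (deriv P) t * deriv F (P t)) (at t)"
      by (intro DERIV_mult DERIV_chain2[OF C2_onD(2)[OF F_C2 P_pos[OF that]] C2_onD(1)[OF P_C2 that]] C2_onD(2)[OF P_C2 that])
    then have "(deriv Q has_real_derivative
      deriv (deriv F) (P t) * deriv P t * deriv P t + deriv (deriv P) t * deriv F (P t)) (at t)"
      by (rule has_field_derivative_transform_within_open[where S = "{0<..}"]) (use that deriv_Q in auto)
    then show "(deriv Q has_real_derivative deriv (deriv F) (P t) * (deriv P t)\<^sup>2 + deriv F (P t) * deriv (deriv P) t) (at t)"
      by (simp add: power2_eq_square mult_ac)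
  qed
  have F_deriv_P: "0 < deriv F (P t)" if "0 < t" for t
    using Q_deriv[OF that] P_deriv[OF that] deriv_Q[OF that] by (simp add: zero_less_mult_iff)
  have F_deriv: "0 < deriv F v" if "0 < v" for v
  proof -
    have "?Pi v \<noteq> 0" using P_Pi[of v] P_0 that by auto
    then have "0 < ?Pi v" using Pi_nonneg[of v] that by simp
    from F_deriv_P[OF this] show ?thesis using P_Pi[of v] that by simp
  qed
  define a where "a t = t * deriv (deriv P) t / deriv P t" for t
  define b where "b t = t * deriv (deriv Q) t / deriv Q t" for t
  have b_eq: "b t = a t + t * deriv P t * deriv (deriv F) (P t) / deriv F (P t)" if "0 < t" for t
    unfolding a_def b_def deriv_Q[OF that] deriv2_Q[OF that]
    using P_deriv[OF that] F_deriv_P[OF that] by (simp add: field_simps power2_eq_square)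
  have cond: "cmod (of_real (a t - 1) - z\<^sup>2 * of_real (b t - 1)) \<le> (a t + 1) - (cmod z)\<^sup>2 * (b t + 1)" if "0 < t" for t
    using z_cond[OF that] unfolding a_def[symmetric] b_def[symmetric] by (simp add: algebra_simps)
  have hc: "hypercontractive_pair (\<lambda>\<rho>. P (sqrt (\<rho> + \<epsilon>\<^sup>2))) (\<lambda>\<rho>. deriv P (sqrt (\<rho> + \<epsilon>\<^sup>2)) / (2 * sqrt (\<rho> + \<epsilon>\<^sup>2)))
    (\<lambda>\<rho>. deriv (deriv P) (sqrt (\<rho> + \<epsilon>\<^sup>2)) / (4 * sqrt (\<rho> + \<epsilon>\<^sup>2) ^ 2) - deriv P (sqrt (\<rho> + \<epsilon>\<^sup>2)) / (4 * sqrt (\<rho> + \<epsilon>\<^sup>2) ^ 3))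
    F (deriv F) (deriv (deriv F)) (P \<epsilon>) z" if "0 < \<epsilon>" for \<epsilon>
    by (rule hypercontractive_pair_regularized[OF that P_growth F_growth P_mono P_pos P_deriv F_deriv F_deriv2 F_concave z_le cond a_def b_eq])

  define c where "c = hermite_coeffs f"
  define S where "S = {\<alpha>. c \<alpha> \<noteq> 0}"
  define c' where "c' \<alpha> = c \<alpha> * (\<Prod>i\<in>UNIV. z ^ \<alpha> i)" for \<alpha>
  define fv where "fv x = (\<Sum>\<alpha>\<in>S. c \<alpha> * hermite_prod UNIV \<alpha> x)" for x :: "'k \<Rightarrow> real"
  define Tv where "Tv x = (\<Sum>\<alpha>\<in>S. c' \<alpha> * hermite_prod UNIV \<alpha> x)" for x :: "'k \<Rightarrow> real"
  have S: "finite S" and f_sum: "\<And>x. f x = (\<Sum>\<alpha>\<in>S. c \<alpha> * hermite \<alpha> x)"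
    using hermite_expansion_exists[OF f_poly] unfolding hermite_expansion_def c_def S_def by auto
  have T_sum: "hermite_operator z f x = (\<Sum>\<alpha>\<in>S. c' \<alpha> * hermite \<alpha> x)" for x
    unfolding hermite_operator_def c_def[symmetric] S_def[symmetric] c'_def multi_degree_def power_sum
    by (simp add: mult_ac)
  have f_fv: "f (\<chi> i. x i) = fv x" and T_Tv: "hermite_operator z f (\<chi> i. x i) = Tv x" for x
    unfolding f_sum T_sum fv_def Tv_def hermite_eq_prod by simp_all
  have [measurable]: "fv \<in> borel_measurable (gauss_prod UNIV)" "Tv \<in> borel_measurable (gauss_prod UNIV)"
    unfolding fv_def Tv_def by measurable
  have clamp: "(\<lambda>t. B (max 0 t)) \<in> borel_measurable borel" if "continuous_on {0..} B" for B :: "real \<Rightarrow> real"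
    by (intro borel_measurable_continuous_onI continuous_on_compose2[OF that]) (auto intro!: continuous_intros)
  have clamp_cmod: "B (cmod w) = B (max 0 (cmod w))" for B :: "real \<Rightarrow> real" and w by (simp add: max_absorb2)
  note [measurable] = clamp[OF P_cont] clamp[OF Q_cont]
  have f_meas[measurable]: "f \<in> borel_measurable borel" unfolding f_sum[abs_def] by measurable
  have T_meas[measurable]: "hermite_operator z f \<in> borel_measurable borel" unfolding T_sum[abs_def] by measurable
  define L where "L = (LINT x|gauss_prod UNIV. P (cmod (fv x)))"
  define A where "A = (LINT x|gauss_prod UNIV. Q (cmod (Tv x)))"
  have L_eq: "(LINT x|gaussian_measure. P (cmod (f x))) = L"
    unfolding L_def f_fv[symmetric]
    by (rule integral_gaussian_measure) (subst clamp_cmod, measurable)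
  have A_eq: "(LINT x|gaussian_measure. Q (cmod (hermite_operator z f x))) = A"
    unfolding A_def T_Tv[symmetric]
    by (rule integral_gaussian_measure) (subst clamp_cmod, measurable)
  have [measurable]: "(\<lambda>x. P (cmod (fv x))) \<in> borel_measurable (gauss_prod UNIV)"
     "(\<lambda>x. Q (cmod (Tv x))) \<in> borel_measurable (gauss_prod UNIV)"
    by (subst clamp_cmod, measurable)+

  define R where "R \<epsilon> = (LINT x|gauss_prod UNIV. P (sqrt ((cmod (fv x))\<^sup>2 + \<epsilon>\<^sup>2)))" for \<epsilon>
  have P_int: "integrable (gauss_prod UNIV) (\<lambda>x. P (sqrt ((cmod (fv x))\<^sup>2 + \<epsilon>\<^sup>2)))" if "0 < \<epsilon>" for \<epsilon>
    using hypercontractive_pair.hermite_sum_integrable(1)[OF hc[OF that] finite_class.finite_UNIV, where S = S and c = c]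
    unfolding hypercontractive_pair.pp_def[OF hc[OF that]] fv_def[symmetric] dot_square_norm .
  have Q_int: "integrable (gauss_prod UNIV) (\<lambda>x. Q (sqrt ((cmod (Tv x))\<^sup>2 + \<epsilon>\<^sup>2)))" if "0 < \<epsilon>" for \<epsilon>
    using hypercontractive_pair.hermite_sum_integrable(2)[OF hc[OF that] finite_class.finite_UNIV, where S = S and c = c']
    unfolding hypercontractive_pair.pp_def[OF hc[OF that]] Tv_def[symmetric] dot_square_norm
    by (simp add: F_P)
  have reg: "(LINT x|gauss_prod UNIV. Q (sqrt ((cmod (Tv x))\<^sup>2 + \<epsilon>\<^sup>2))) \<le> F (R \<epsilon>)" if "0 < \<epsilon>" for \<epsilon>
    using hypercontractive_pair.tensorization[OF hc[OF that] finite_class.finite_UNIV S, where c = c]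
    unfolding hypercontractive_pair.pp_def[OF hc[OF that]] c'_def[symmetric] Tv_def[symmetric] fv_def[symmetric] dot_square_norm
      R_def[symmetric]
    by (simp add: F_P)
  interpret prob_space "gauss_prod (UNIV :: 'k set)" by (rule prob_space_gauss_prod)
  have le_sqrt: "cmod w \<le> sqrt ((cmod w)\<^sup>2 + \<epsilon>\<^sup>2)" for w \<epsilon> by (rule real_le_rsqrt) simp
  have QT_int: "integrable (gauss_prod UNIV) (\<lambda>x. Q (cmod (Tv x)))"
  proof (rule Bochner_Integration.integrable_bound[OF Q_int[of 1]])
    show "AE x in gauss_prod UNIV. norm (Q (cmod (Tv x))) \<le> norm (Q (sqrt ((cmod (Tv x))\<^sup>2 + 1\<^sup>2)))"
      using Q_mono[OF norm_ge_zero le_sqrt[of _ 1]] Q_nonneg by (intro AE_I2) (simp add: abs_of_nonneg)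
  qed auto
  \<comment> \<open>On the left the regularization only increases the integrand, so no limit is needed there.\<close>
  have A_le: "A \<le> F (R \<epsilon>)" if "0 < \<epsilon>" for \<epsilon>
  proof -
    have "A \<le> (LINT x|gauss_prod UNIV. Q (sqrt ((cmod (Tv x))\<^sup>2 + \<epsilon>\<^sup>2)))"
      unfolding A_def by (intro integral_mono QT_int Q_int[OF that] Q_mono le_sqrt) auto
    with reg[OF that] show ?thesis by linarith
  qed
  have R_nonneg: "0 \<le> R \<epsilon>" for \<epsilon> unfolding R_def
    by (intro Bochner_Integration.integral_nonneg P_nonneg) auto
  have L_nonneg: "0 \<le> L" unfolding L_def by (intro Bochner_Integration.integral_nonneg P_nonneg) auto
  have A_ge: "Q 0 \<le> A" unfolding A_def
    by (intro integral_ge_const QT_int AE_I2 Q_mono) auto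

  define T where "T = ?Pi (R 1)"
  have T: "0 \<le> T" "A \<le> Q T" using A_le[of 1] Pi_nonneg[OF R_nonneg[of 1]] by (auto simp: T_def F_eq)
  obtain \<tau> where \<tau>: "0 \<le> \<tau>" "Q \<tau> = A"
  proof -
    have "continuous_on {0..T} Q" by (rule continuous_on_subset[OF Q_cont]) auto
    then show ?thesis using IVT'[of Q 0 A T] A_ge T that by blast
  qed
  \<comment> \<open>Both inverse functions are undone before the limit is taken, so only \<open>R\<close> has to converge.\<close>
  have P_tau_le: "P \<tau> \<le> R \<epsilon>" if "0 < \<epsilon>" for \<epsilon>
  proof -
    have "Q \<tau> \<le> Q (?Pi (R \<epsilon>))" using A_le[OF that] \<tau> by (simp add: F_eq)
    then have "\<tau> \<le> ?Pi (R \<epsilon>)" by (rule Q_le_D) (rule Pi_nonneg[OF R_nonneg])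
    then have "P \<tau> \<le> P (?Pi (R \<epsilon>))" by (rule P_mono[OF \<tau>(1)])
    then show ?thesis by (simp add: P_Pi R_nonneg)
  qed
  have "(\<lambda>n. R (1 / Suc n)) \<longlonglongrightarrow> L" unfolding R_def L_def
  proof (rule integral_dominated_convergence[where w = "\<lambda>x. P (sqrt ((cmod (fv x))\<^sup>2 + 1\<^sup>2))"])
    show "integrable (gauss_prod UNIV) (\<lambda>x. P (sqrt ((cmod (fv x))\<^sup>2 + 1\<^sup>2)))" by (rule P_int) simp
    show "(\<lambda>x. P (sqrt ((cmod (fv x))\<^sup>2 + (1 / Suc n)\<^sup>2))) \<in> borel_measurable (gauss_prod UNIV)" for n
      using P_int[of "1 / Suc n"] by auto
    show "AE x in gauss_prod UNIV. (\<lambda>n. P (sqrt ((cmod (fv x))\<^sup>2 + (1 / Suc n)\<^sup>2))) \<longlonglongrightarrow> P (cmod (fv x))"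
    proof (rule AE_I2)
      fix x
      have "(\<lambda>n. sqrt ((cmod (fv x))\<^sup>2 + (1 / Suc n)\<^sup>2)) \<longlonglongrightarrow> sqrt ((cmod (fv x))\<^sup>2 + 0\<^sup>2)"
        by (intro tendsto_intros LIMSEQ_Suc[OF lim_1_over_n])
      then have "(\<lambda>n. sqrt ((cmod (fv x))\<^sup>2 + (1 / Suc n)\<^sup>2)) \<longlonglongrightarrow> cmod (fv x)" by simp
      then show "(\<lambda>n. P (sqrt ((cmod (fv x))\<^sup>2 + (1 / Suc n)\<^sup>2))) \<longlonglongrightarrow> P (cmod (fv x))"
        by (rule continuous_on_tendsto_compose[OF P_cont]) auto
    qed
    show "AE x in gauss_prod UNIV. norm (P (sqrt ((cmod (fv x))\<^sup>2 + (1 / Suc n)\<^sup>2))) \<le> P (sqrt ((cmod (fv x))\<^sup>2 + 1\<^sup>2))" for n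
    proof (rule AE_I2)
      fix x
      have "(1 / Suc n)\<^sup>2 \<le> (1::real)\<^sup>2" by (rule power_mono) auto
      then have "P (sqrt ((cmod (fv x))\<^sup>2 + (1 / Suc n)\<^sup>2)) \<le> P (sqrt ((cmod (fv x))\<^sup>2 + 1\<^sup>2))"
        by (intro P_mono real_sqrt_le_mono) auto
      moreover have "0 \<le> P (sqrt ((cmod (fv x))\<^sup>2 + (1 / Suc n)\<^sup>2))" by (rule P_nonneg) simp
      ultimately show "norm (P (sqrt ((cmod (fv x))\<^sup>2 + (1 / Suc n)\<^sup>2))) \<le> P (sqrt ((cmod (fv x))\<^sup>2 + 1\<^sup>2))"
        by simp
    qed
  qed auto
  then have "P \<tau> \<le> L" by (rule LIMSEQ_le_const) (use P_tau_le in auto)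
  then have "P \<tau> \<le> P (?Pi L)" by (simp add: P_Pi L_nonneg)
  then have "\<tau> \<le> ?Pi L" by (rule P_le_D) (rule Pi_nonneg[OF L_nonneg])
  moreover have "inv_into {0..} Q A = \<tau>" using \<tau> Q_inj by (auto simp: inv_into_f_f)
  ultimately show ?thesis unfolding L_eq A_eq by simp
qed

end
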